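(* Let $p\ge 2$ be an integer and let $a_1,\dots,a_p,b_1,\dots,b_{p-1}\in\mathbb C$ satisfy $$a_i,\ b_j,\ a_i-b_j,\ b_j-b_{j'},\ \sum_{i=1}^pa_i-\sum_{j=1}^{p-1}b_j\notin\mathbb Z\qquad(1\le i\le p,\ 1\le j,j'\le p-1,\ j\ne j').$$ Let $\varepsilon$ be a sufficiently small positive real number and $\dot x=\varepsilon$. Put $A_i=e^{2\pi\sqrt{-1}a_i}$ $(1\le i\le p)$, $B_j=e^{2\pi\sqrt{-1}b_j}$ $(1\le j\le p-1)$, $\lambda=\big(\prod_{j=1}^{p-1}B_j\big)\big/\big(\prod_{i=1}^pA_i\big)$, $\mathrm v=(1,\dots,1)$ (a row vector of size $p$), and $H=\mathrm{diag}(1,h_1,\dots,h_{p-1})$ with $$h_k=\frac{-\Big(\prod_{1\le j\le p-1,\,j\ne k}(B_j-1)\Big)\Big(\prod_{i=1}^p(A_i-B_k)\Big)}{B_k\Big(\prod_{1\le j\le p-1,\,j\ne k}(B_j-B_k)\Big)\Big(\prod_{i=1}^p(A_i-1)\Big)}\qquad(1\le k\le p-1).$$ Then there exists a fundamental system $\mathbf F_p(x)$ (a column vector of $p$ linearly independent solutions) of solutions around $\dot x$ to the generalized hypergeometric differential equation $$\Big(x\tfrac{d}{dx}+a_1\Big)\cdots\Big(x\tfrac{d}{dx}+a_p\Big)f(x)=\tfrac{d}{dx}\Big(x\tfrac{d}{dx}+b_1-1\Big)\cdots\Big(x\tfrac{d}{dx}+b_{p-1}-1\Big)f(x)$$ such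 that the circuit matrices $M_0$ and $M_1$ of $\mathbf F_p(x)$ along the loops $\rho_0$ and $\rho_1$ are $$M_0=\mathrm{diag}(1,B_1^{-1},\dots,B_{p-1}^{-1}),\qquad M_1=\mathrm{id}_p-\frac{1-\lambda}{\mathrm vH\,{}^t\mathrm v}\,H\,{}^t\mathrm v\,\mathrm v .$$
   Context: $X=\mathbb C\setminus\{0,1\}$ with base point $\dot x=\varepsilon$. The loops are $\rho_0:[0,1]\ni t\mapsto \varepsilon e^{2\pi\sqrt{-1}t}\in X$ and $\rho_1:[0,1]\ni t\mapsto 1-(1-\varepsilon)e^{2\pi\sqrt{-1}t}\in X$. The circuit matrix along a loop $\rho$ based at $\dot x$, with respect to a column vector $\mathbf F(x)$ of linearly independent solutions around $\dot x$ spanning the solution space, is the invertible matrix $M_\rho$ such that the analytic continuation of $\mathbf F(x)$ along $\rho$ equals $M_\rho\mathbf F(x)$ around $\dot x$. $\mathrm{id}_p$ is the identity matrix of size $p$, ${}^t$ denotes transpose, and empty products are $1$. *)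

theory Defs
  imports "HOL-Complex_Analysis.Complex_Analysis" "Jordan_Normal_Form.Matrix"
begin

unbundle no vec_syntax

definition \<theta>_shift :: "complex \<Rightarrow> (complex \<Rightarrow> complex) \<Rightarrow> (complex \<Rightarrow> complex)" where
  "\<theta>_shift c f = (\<lambda>x. x * deriv f x + c * f x)"

text \<open>Local solutions are germs: \<^term>\<open>f\<close> is required to be holomorphic and to solve the
  equation on some neighbourhood of \<^term>\<open>x0\<close>; its values elsewhere are irrelevant.
  The parameters are \<open>a 1, \<dots>, a p\<close> and \<open>b 1, \<dots>, b (p - 1)\<close>.\<close>

definition hypergeometric_solution ::
    "nat \<Rightarrow> (nat \<Rightarrow> complex) \<Rightarrow> (nat \<Rightarrow> complex) \<Rightarrow> complex \<Rightarrow> (complex \<Rightarrow> complex) \<Rightarrow> bool" where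
  "hypergeometric_solution p a b x0 f \<longleftrightarrow>
     f analytic_on {x0} \<and>
     (\<forall>\<^sub>F x in nhds x0.
        foldr (\<lambda>i. \<theta>_shift (a i)) [1..<p + 1] f x =
        deriv (foldr (\<lambda>j. \<theta>_shift (b j - 1)) [1..<p] f) x)"

text \<open>A column vector whose components form a basis of the space of germs of solutions
  at \<^term>\<open>x0\<close>. Components are indexed from \<open>0\<close> to \<open>p - 1\<close>.\<close>

definition fundamental_system ::
    "nat \<Rightarrow> (nat \<Rightarrow> complex) \<Rightarrow> (nat \<Rightarrow> complex) \<Rightarrow> complex \<Rightarrow> (complex \<Rightarrow> complex vec) \<Rightarrow> bool" where
  "fundamental_system p a b x0 F \<longleftrightarrow>
     (\<forall>x. F x \<in> carrier_vec p) \<and>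
     (\<forall>i<p. hypergeometric_solution p a b x0 (\<lambda>x. F x $ i)) \<and>
     (\<forall>c. (\<forall>\<^sub>F x in nhds x0. (\<Sum>i<p. c i * F x $ i) = 0) \<longrightarrow> (\<forall>i<p. c i = 0)) \<and>
     (\<forall>f. hypergeometric_solution p a b x0 f \<longrightarrow>
        (\<exists>c. \<forall>\<^sub>F x in nhds x0. f x = (\<Sum>i<p. c i * F x $ i)))"

text \<open>The germ of \<^term>\<open>g\<close> at \<open>\<gamma> 1\<close> is the analytic continuation along \<open>\<gamma>\<close> of the germ of
  \<^term>\<open>f\<close> at \<open>\<gamma> 0\<close>. In the witnessing family, the germ of \<open>\<phi> t\<close> at \<open>\<gamma> t\<close> is the value of the
  continuation at time \<open>t\<close>; for \<open>s\<close> near \<open>t\<close>, the germ of \<open>\<phi> s\<close> at \<open>\<gamma> s\<close> is that of \<open>\<phi> t\<close>.\<close>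

definition continues_along ::
    "(real \<Rightarrow> complex) \<Rightarrow> (complex \<Rightarrow> complex) \<Rightarrow> (complex \<Rightarrow> complex) \<Rightarrow> bool" where
  "continues_along \<gamma> f g \<longleftrightarrow>
     path \<gamma> \<and>
     (\<exists>\<phi> :: real \<Rightarrow> complex \<Rightarrow> complex.
        (\<forall>t\<in>{0..1}. \<phi> t analytic_on {\<gamma> t} \<and>
           (\<forall>\<^sub>F s in at t within {0..1}. \<forall>\<^sub>F x in nhds (\<gamma> s). \<phi> s x = \<phi> t x)) \<and>
        (\<forall>\<^sub>F x in nhds (\<gamma> 0). \<phi> 0 x = f x) \<and>
        (\<forall>\<^sub>F x in nhds (\<gamma> 1). \<phi> 1 x = g x))"

definition circuit_matrix ::
    "nat \<Rightarrow> (complex \<Rightarrow> complex vec) \<Rightarrow> (real \<Rightarrow> complex) \<Rightarrow> complex mat \<Rightarrow> bool" where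
  "circuit_matrix p F \<rho> M \<longleftrightarrow>
     M \<in> carrier_mat p p \<and> invertible_mat M \<and>
     (\<forall>i<p. continues_along \<rho> (\<lambda>x. F x $ i) (\<lambda>x. (M *\<^sub>v F x) $ i))"

definition \<rho>\<^sub>0 :: "real \<Rightarrow> real \<Rightarrow> complex" where
  "\<rho>\<^sub>0 \<epsilon> t = of_real \<epsilon> * exp (2 * of_real pi * \<i> * of_real t)"

definition \<rho>\<^sub>1 :: "real \<Rightarrow> real \<Rightarrow> complex" where
  "\<rho>\<^sub>1 \<epsilon> t = 1 - (1 - of_real \<epsilon>) * exp (2 * of_real pi * \<i> * of_real t)"

end

theory Submission
  imports Defs "Jordan_Normal_Form.Determinant"
begin

text \<open>In the coordinate \<open>t = log x\<close> the equation becomes \<open>exp t P(D) f = Q(D) f\<close>, singular exactly at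
  the points \<open>2 \<pi> \<i> n\<close>. Solutions on the left half-plane have the shift \<open>t \<mapsto> t + 2 \<pi> \<i>\<close> as monodromy
  around \<open>x = 0\<close>; those on the right half-plane have it as monodromy around \<open>\<infinity>\<close>. In either half-plane
  the characteristic polynomial of the shift is found without any condition on the exponents:
  the transition matrix over a vertical segment of length \<open>2 \<pi>\<close> is always conjugate to the
  shift, and far away from the imaginary axis it is as close to diagonal as one likes.

  Hence the shift on the left has the distinct eigenvalues \<open>1, 1/B\<^sub>j\<close>, which yields a basis with diagonal
  \<open>M\<^sub>0\<close>, and the product of \<open>M\<^sub>0\<close> with the circuit matrix around \<open>x = 1\<close> has the eigenvalues \<open>1/A\<^sub>i\<close>.
  Near \<open>t = 0\<close> there are \<open>p - 1\<close> independent holomorphic solutions, so the circuit matrix around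
  \<open>1\<close> is \<open>id - w u\<close> with a column \<open>w\<close> and a row \<open>u\<close>. Evaluating the characteristic polynomial of the
  product at the eigenvalues of \<open>M\<^sub>0\<close> determines every \<open>w\<^sub>k u\<^sub>k\<close> and shows \<open>u\<^sub>k \<noteq> 0\<close>, so that \<open>u\<close> can be
  scaled to \<open>(1, \<dots>, 1)\<close>.\<close>

section \<open>Linear systems of differential equations\<close>

text \<open>Differences of the \<open>a i\<close> may be integers, so the shift on the right
  half-plane may fail to be diagonalizable and an eigenbasis at infinity cannot be relied on. This
  is why only its characteristic polynomial is computed, as a limit of determinants. Rescaling an
  eigenbasis of \<open>M\<^sub>0\<close> changes the column \<open>w\<close> and the row
  \<open>u\<close> but not the products \<open>w k * u k\<close>, which are therefore what has to be
  found. The conditions on \<open>a i\<close> and \<open>a i - b k\<close> keep these products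
  nonzero. The condition on the sum makes the nontrivial local exponent at x = 1 non-integral; this
  yields the p - 1 holomorphic solutions there, and also \<open>lam \<noteq> 1\<close>. Evaluating
  the characteristic polynomial at 0 as well shows that the products add up to
  \<open>1 - lam\<close>. This is the origin of the scalar in \<open>M\<^sub>1\<close>: it equals
  \<open>w 0 * u 0\<close>, while \<open>h k\<close> is the ratio of the product with index k to the
  one with index 0.\<close>

lemma geometric_growth:
  fixes U :: "nat \<Rightarrow> real"
  assumes "K \<ge> 0" "\<rho> > 1" "\<And>n. U n \<ge> 0"
    and step: "\<And>n. n \<ge> n0 \<Longrightarrow> real n * U (Suc n) \<le> (real n + K) * U n"
  shows "\<exists>C\<ge>0. \<forall>n. U n \<le> C * \<rho> ^ n"
proof -
  \<comment> \<open>From \<open>m\<close> on, \<open>K \<le> n * (\<rho> - 1)\<close>, so one step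
    multiplies \<open>U\<close> by at most \<open>\<rho>\<close>; the finitely many earlier values
    go into the constant.\<close>
  obtain m where m: "m \<ge> n0" "m \<ge> 1" "K / (\<rho> - 1) \<le> real m"
  proof
    show "max n0 (max 1 (nat \<lceil>K / (\<rho> - 1)\<rceil>)) \<ge> n0" by simp
    show "K / (\<rho> - 1) \<le> real (max n0 (max 1 (nat \<lceil>K / (\<rho> - 1)\<rceil>)))" by linarith
  qed simp
  have growth: "U (m + k) \<le> U m * \<rho> ^ k" for k
  proof (induction k)
    case (Suc k)
    have pos: "real (m + k) > 0" using m by simp
    have "K \<le> real m * (\<rho> - 1)" using m(3) assms(2) by (simp add: field_simps)
    also have "\<dots> \<le> real (m + k) * (\<rho> - 1)" using assms(2) by (intro mult_right_mono) auto
    finally have "real (m + k) + K \<le> real (m + k) * \<rho>" by (simp add: algebra_simps)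
    hence "real (m + k) * U (Suc (m + k)) \<le> real (m + k) * \<rho> * U (m + k)"
      using step[of "m + k"] m assms(3)[of "m + k"]
      by (meson le_add1 mult_right_mono order.trans)
    hence "U (Suc (m + k)) \<le> \<rho> * U (m + k)" using pos by (simp add: mult.assoc)
    also have "\<dots> \<le> \<rho> * (U m * \<rho> ^ k)" using Suc assms(2) by (intro mult_left_mono) auto
    finally show ?case by (simp add: mult_ac)
  qed simp
  define C where "C = (\<Sum>k\<le>m. U k)"
  have C: "U k \<le> C" if "k \<le> m" for k
    unfolding C_def using that assms(3) by (intro member_le_sum) auto
  have "U n \<le> C * \<rho> ^ n" for n
  proof (cases "n \<le> m")
    case True
    have "C \<ge> 0" using C[of 0] assms(3)[of 0] by simp
    then have "C * 1 \<le> C * \<rho> ^ n" using assms(2) by (intro mult_left_mono one_le_power) auto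
    then show ?thesis using C[OF True] by simp
  next
    case False
    then have "U n \<le> U m * \<rho> ^ (n - m)" using growth[of "n - m"] by simp
    also have "\<dots> \<le> C * \<rho> ^ n"
      using C[of m] assms(2) assms(3)[of m] False by (intro mult_mono power_increasing) auto
    finally show ?thesis .
  qed
  moreover have "C \<ge> 0" using C[of 0] assms(3)[of 0] by simp
  ultimately show ?thesis by blast
qed

text \<open>With \<open>u\<^sub>n = (\<Sum>i. \<bar>Y\<^sub>n\<^sub>i\<bar>) r\<^sup>n\<close> the recurrence and the Cauchy estimates for the
  coefficients of \<open>A\<close> give \<open>n u\<^sub>n \<le> K (u\<^sub>0 + \<dots> + u\<^sub>n)\<close>, so that \<open>u\<close> grows subexponentially.\<close>

lemma fuchsian_formal_solution_converges:
  fixes A :: "nat \<Rightarrow> nat \<Rightarrow> complex fps" and Y :: "nat \<Rightarrow> complex fps" and R :: real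
  assumes A: "\<And>i j. i < p \<Longrightarrow> j < p \<Longrightarrow> fps_conv_radius (A i j) \<ge> R"
    and Y: "\<And>i. i < p \<Longrightarrow> fps_X * fps_deriv (Y i) = (\<Sum>j<p. A i j * Y j)"
    and i: "i < p"
  shows "fps_conv_radius (Y i) \<ge> R"
  unfolding fps_conv_radius_def
proof (rule conv_radius_geI_ex')
  fix r' :: real assume r': "0 < r'" "ereal r' < ereal R"
  then obtain r where r: "r' < r" "r < R" using dense by auto
  \<comment> \<open>The midpoint of 1 and \<open>r / r'\<close>, so that growth of order
    \<open>\<rho> ^ n\<close> is still beaten by the factor \<open>(r' / r) ^ n\<close>.\<close>
  define \<rho> where "\<rho> = (1 + r / r') / 2"
  have \<rho>: "\<rho> > 1" "\<rho> * r' < r" using r r' by (auto simp: \<rho>_def field_simps)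
  have r0: "r > 0" using r r' by simp
  have "\<exists>M\<ge>0. \<forall>n. norm (fps_nth (A j k) n) * r ^ n \<le> M" if "j < p" "k < p" for j k
  proof -
    have "summable (\<lambda>n. norm (fps_nth (A j k) n * of_real r ^ n))"
      by (rule abs_summable_in_conv_radius)
        (use A[OF that] r r0 in \<open>auto simp: fps_conv_radius_def intro: less_le_trans[of _ "ereal R"]\<close>)
    then have "Bseq (\<lambda>n. norm (fps_nth (A j k) n * of_real r ^ n))"
      using summable_imp_Bseq by blast
    then obtain M where "M > 0" "\<forall>n. norm (norm (fps_nth (A j k) n * of_real r ^ n)) \<le> M"
      by (auto simp: Bseq_def)
    then show ?thesis using r0 by (intro exI[of _ M]) (auto simp: norm_mult norm_power)
  qed
  then obtain M where M: "\<And>j k. j < p \<Longrightarrow> k < p \<Longrightarrow> M j k \<ge> 0"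
     "\<And>j k n. j < p \<Longrightarrow> k < p \<Longrightarrow> norm (fps_nth (A j k) n) * r ^ n \<le> M j k"
    by metis
  define K where "K = (\<Sum>j<p. \<Sum>k<p. M j k)"
  have K0: "K \<ge> 0" unfolding K_def by (intro sum_nonneg M(1)) auto
  define u where "u = (\<lambda>n. \<Sum>j<p. norm (fps_nth (Y j) n) * r ^ n)"
  have u0: "u n \<ge> 0" for n unfolding u_def using r0 by (intro sum_nonneg) auto
  have ui: "norm (fps_nth (Y j) n) * r ^ n \<le> u n" if "j < p" for j n
    unfolding u_def using that r0
    by (intro member_le_sum[where f="\<lambda>j. norm (fps_nth (Y j) n) * r ^ n"]) auto
  have rec: "real n * u n \<le> K * (\<Sum>m\<le>n. u m)" for n
  proof -
    have "real n * (norm (fps_nth (Y j) n) * r ^ n) \<le> (\<Sum>k<p. M j k) * (\<Sum>m\<le>n. u m)" if j: "j < p" for j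
    proof -
      have "of_nat n * fps_nth (Y j) n = fps_nth (fps_X * fps_deriv (Y j)) n"
        by (cases n) auto
      also have "\<dots> = (\<Sum>k<p. \<Sum>m=0..n. fps_nth (A j k) m * fps_nth (Y k) (n - m))"
        by (simp add: Y[OF j] fps_sum_nth fps_mult_nth)
      finally have "real n * norm (fps_nth (Y j) n) =
          norm (\<Sum>k<p. \<Sum>m=0..n. fps_nth (A j k) m * fps_nth (Y k) (n - m))"
        by (metis norm_mult norm_of_nat)
      also have "\<dots> \<le> (\<Sum>k<p. \<Sum>m=0..n. norm (fps_nth (A j k) m) * norm (fps_nth (Y k) (n - m)))"
        by (intro sum_norm_le) (simp add: norm_mult)
      finally have "real n * norm (fps_nth (Y j) n) * r ^ n \<le>
         (\<Sum>k<p. \<Sum>m=0..n. norm (fps_nth (A j k) m) * norm (fps_nth (Y k) (n - m))) * r ^ n"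
        using r0 by (intro mult_right_mono) auto
      also have "\<dots> = (\<Sum>k<p. \<Sum>m=0..n. (norm (fps_nth (A j k) m) * r ^ m) *
                          (norm (fps_nth (Y k) (n - m)) * r ^ (n - m)))"
      proof -
        have "r ^ n = r ^ m * r ^ (n - m)" if "m \<in> {0..n}" for m
          using that by (simp flip: power_add)
        then show ?thesis unfolding sum_distrib_right
          by (intro sum.cong refl) (simp add: mult_ac)
      qed
      also have "\<dots> \<le> (\<Sum>k<p. \<Sum>m=0..n. M j k * u (n - m))"
        using M j ui u0 r0 by (intro sum_mono mult_mono) auto
      also have "\<dots> = (\<Sum>k<p. M j k * (\<Sum>m\<le>n. u m))"
        using sum.nat_diff_reindex[of u "Suc n"]
        by (simp add: sum_distrib_left[symmetric] atLeast0AtMost lessThan_Suc_atMost)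
      finally show ?thesis by (simp only: sum_distrib_right mult.assoc)
    qed
    then have "(\<Sum>j<p. real n * (norm (fps_nth (Y j) n) * r ^ n)) \<le>
               (\<Sum>j<p. (\<Sum>k<p. M j k) * (\<Sum>m\<le>n. u m))"
      by (intro sum_mono) auto
    then show ?thesis by (simp add: K_def u_def sum_distrib_left[symmetric] sum_distrib_right[symmetric])
  qed
  \<comment> \<open>Partial sums turn the recurrence with full history into a one-step inequality.
    For \<open>n \<ge> 2 * K\<close> the term \<open>K * u n\<close> is absorbed into half of
    \<open>n * u n\<close>, whence the factor 2 in front of \<open>K\<close>.\<close>
  define U where "U = (\<lambda>n. \<Sum>m<n. u m)"
  have U0: "U n \<ge> 0" for n unfolding U_def using u0 by (intro sum_nonneg) auto
  have step: "real n * U (Suc n) \<le> (real n + 2 * K) * U n" if "n \<ge> nat \<lceil>2 * K\<rceil>" for n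
  proof -
    have "2 * K \<le> real n" using that by linarith
    then have "K * u n \<le> real n / 2 * u n" using u0 by (intro mult_right_mono) auto
    moreover have "real n * u n \<le> K * U n + K * u n"
      using rec[of n] by (simp add: U_def lessThan_Suc_atMost[symmetric] distrib_left)
    ultimately have "real n * u n \<le> 2 * K * U n" by linarith
    moreover have "U (Suc n) = U n + u n" by (simp add: U_def)
    ultimately show ?thesis by (simp add: algebra_simps)
  qed
  obtain C where C: "C \<ge> 0" "\<And>n. U n \<le> C * \<rho> ^ n"
    using geometric_growth[of "2 * K" \<rho> U "nat \<lceil>2 * K\<rceil>", OF _ \<rho>(1) U0 step] K0 by auto
  have bound: "norm (fps_nth (Y i) n * of_real r' ^ n) \<le> (C * \<rho>) * ((\<rho> * r' / r) ^ n)" for n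
  proof -
    have "norm (fps_nth (Y i) n) * r ^ n \<le> U (Suc n)"
      using ui[OF i, of n] U0[of n] by (simp add: U_def)
    also have "\<dots> \<le> C * \<rho> ^ Suc n" by (rule C)
    finally have "norm (fps_nth (Y i) n) \<le> C * \<rho> ^ Suc n / r ^ n"
      using r0 by (simp add: field_simps)
    then have "norm (fps_nth (Y i) n) * r' ^ n \<le> C * \<rho> ^ Suc n / r ^ n * r' ^ n"
      using r' by (intro mult_right_mono) auto
    then show ?thesis using r' by (simp add: norm_mult norm_power power_divide power_mult_distrib mult_ac)
  qed
  have "summable (\<lambda>n. (C * \<rho>) * ((\<rho> * r' / r) ^ n))"
    using \<rho> r r' r0 by (intro summable_mult summable_geometric) (auto simp: field_simps)
  then show "summable (\<lambda>n. fps_nth (Y i) n * of_real r' ^ n)"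
    using bound by (rule summable_comparison_test')
qed

text \<open>Comparing coefficients of z^n gives (n - A(0)) c_n = terms in c_0, ..., c_(n-1). The
  hypothesis \<open>y0\<close> is the case n = 0, and \<open>regular\<close> makes every later step
  solvable. Convergence is \<open>fuchsian_formal_solution_converges\<close>.\<close>

lemma fuchsian_system_solution:
  fixes A :: "nat \<Rightarrow> nat \<Rightarrow> complex \<Rightarrow> complex" and R :: real
  assumes R: "R > 0"
    and A: "\<And>i j. i < p \<Longrightarrow> j < p \<Longrightarrow> A i j holomorphic_on ball 0 R"
    and y0: "\<And>i. i < p \<Longrightarrow> (\<Sum>j<p. A i j 0 * y0 j) = 0"
    and regular: "\<And>n V. n \<ge> 1 \<Longrightarrow> \<exists>Y. \<forall>i<p. of_nat n * Y i - (\<Sum>j<p. A i j 0 * Y j) = V i"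
  shows "\<exists>Y. \<forall>i<p. Y i holomorphic_on ball 0 R \<and> Y i 0 = y0 i \<and>
           (\<forall>z\<in>ball 0 R. z * deriv (Y i) z = (\<Sum>j<p. A i j z * Y j z))"
proof -
  define B where "B = (\<lambda>i j. fps_expansion (A i j) 0)"
  have B_radius: "fps_conv_radius (B i j) \<ge> ereal R" if "i < p" "j < p" for i j
    unfolding B_def using A[OF that] by (intro conv_radius_fps_expansion) auto
  have B_eval: "eval_fps (B i j) z = A i j z" if "i < p" "j < p" "norm z < R" for i j z
    unfolding B_def using A[OF that(1,2)] that(3) by (subst eval_fps_expansion'[where r = "ereal R"]) auto
  have B0: "fps_nth (B i j) 0 = A i j 0" if "i < p" "j < p" for i j
    using B_eval[OF that, of 0] R by (simp add: eval_fps_at_0)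
  obtain S where S: "\<And>n V i. n \<ge> 1 \<Longrightarrow> i < p \<Longrightarrow>
      of_nat n * S n V i - (\<Sum>j<p. A i j 0 * S n V j) = V i"
    using regular by metis
  define G where "G = (\<lambda>(y :: nat \<Rightarrow> nat \<Rightarrow> complex) n. if n = 0 then y0 else
     S n (\<lambda>i. \<Sum>j<p. \<Sum>m=1..n. fps_nth (B i j) m * y (n - m) j))"
  \<comment> \<open>Course-of-values recursion: through the Cauchy product each coefficient depends
    on all earlier ones.\<close>
  define c where "c = wfrec less_than G"
  have "adm_wf less_than G"
    unfolding adm_wf_def
  proof (intro allI impI)
    fix y y' :: "nat \<Rightarrow> nat \<Rightarrow> complex" and n
    assume "\<forall>m. (m, n) \<in> less_than \<longrightarrow> y m = y' m"
    then have "(\<Sum>m=1..n. fps_nth (B i j) m * y (n - m) j) = (\<Sum>m=1..n. fps_nth (B i j) m * y' (n - m) j)" for i j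
      by (intro sum.cong) auto
    then show "G y n = G y' n" by (simp only: G_def)
  qed
  then have c: "c n = G c n" for n
    unfolding c_def by (subst wfrec_fixpoint) auto
  have c0: "c 0 = y0" using c[of 0] by (simp add: G_def)
  have c_rec: "c n = S n (\<lambda>i. \<Sum>j<p. \<Sum>m=1..n. fps_nth (B i j) m * c (n - m) j)" if "n \<ge> 1" for n
    using that c[of n] by (simp add: G_def)
  define F where "F = (\<lambda>i. Abs_fps (\<lambda>n. c n i))"
  have F: "fps_X * fps_deriv (F i) = (\<Sum>j<p. B i j * F j)" if i: "i < p" for i
  proof (rule fps_ext)
    fix n
    have L: "fps_nth (fps_X * fps_deriv (F i)) n = of_nat n * c n i"
      by (cases n) (auto simp: F_def)
    show "fps_nth (fps_X * fps_deriv (F i)) n = fps_nth (\<Sum>j<p. B i j * F j) n"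
    proof (cases "n = 0")
      case True
      then show ?thesis using L y0[OF i] i by (simp add: fps_sum_nth F_def B0 c0)
    next
      case False
      have "of_nat n * c n i = (\<Sum>j<p. A i j 0 * c n j) +
               (\<Sum>j<p. \<Sum>m=1..n. fps_nth (B i j) m * c (n - m) j)"
        using S[of n i "\<lambda>i. \<Sum>j<p. \<Sum>m=1..n. fps_nth (B i j) m * c (n - m) j"] False i c_rec[of n]
        by (simp add: algebra_simps)
      also have "\<dots> = (\<Sum>j<p. \<Sum>m=0..n. fps_nth (B i j) m * c (n - m) j)"
        unfolding sum.distrib[symmetric]
        by (intro sum.cong refl) (use i in \<open>simp add: sum.atLeast_Suc_atMost B0\<close>)
      finally show ?thesis unfolding L by (simp add: fps_sum_nth fps_mult_nth F_def)
    qed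
  qed
  have radius: "fps_conv_radius (F i) \<ge> ereal R" if "i < p" for i
    by (rule fuchsian_formal_solution_converges[OF B_radius F that])
  have in_ball: "z \<in> eball 0 (fps_conv_radius (F i))" if "i < p" "norm z < R" for i z
    using radius[OF that(1)] that(2) by (auto intro: less_le_trans[of _ "ereal R"])
  have "eval_fps (F i) holomorphic_on ball 0 R" if "i < p" for i
    by (intro holomorphic_on_eval_fps) (use in_ball[OF that] in auto)
  moreover have "eval_fps (F i) 0 = y0 i" for i
    by (simp add: eval_fps_at_0 F_def c0)
  moreover have "z * deriv (eval_fps (F i)) z = (\<Sum>j<p. A i j z * eval_fps (F j) z)"
    if i: "i < p" and z: "z \<in> ball 0 R" for i z
  proof -
    have zr: "norm z < R" using z by simp
    have fz: "ereal (norm z) < fps_conv_radius (F j)" if "j < p" for j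
      using in_ball[OF that zr] by simp
    have bz: "ereal (norm z) < fps_conv_radius (B i j)" if "j < p" for j
      using B_radius[OF i that] zr by (auto intro: less_le_trans[of _ "ereal R"])
    have D: "(eval_fps (F i) has_field_derivative eval_fps (fps_deriv (F i)) z) (at z)"
      by (intro has_field_derivative_eval_fps fz i)
    have "z * deriv (eval_fps (F i)) z = eval_fps (fps_X * fps_deriv (F i)) z"
      using DERIV_imp_deriv[OF D] less_le_trans[OF fz[OF i] fps_conv_radius_deriv]
      by (simp add: eval_fps_mult)
    also have "\<dots> = (\<Sum>j<p. A i j z * eval_fps (F j) z)"
      unfolding F[OF i] 
    proof -
      have "ereal (norm z) < fps_conv_radius (\<Sum>j\<in>J. B i j * F j) \<and>
         eval_fps (\<Sum>j\<in>J. B i j * F j) z = (\<Sum>j\<in>J. A i j z * eval_fps (F j) z)"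
        if "finite J" "J \<subseteq> {..<p}" for J
        using that
      proof (induction J rule: finite_induct)
        case (insert j J)
        then have j: "j < p" by auto
        have r: "ereal (norm z) < fps_conv_radius (B i j * F j)"
          by (rule less_le_trans[OF _ fps_conv_radius_mult]) (simp add: fz[OF j] bz[OF j])
        have e: "eval_fps (B i j * F j) z = A i j z * eval_fps (F j) z"
          using fz[OF j] bz[OF j] B_eval[OF i j zr] by (simp add: eval_fps_mult)
        show ?case
          using insert r e
          by (auto simp: eval_fps_add intro!: less_le_trans[OF _ fps_conv_radius_add])
      qed simp
      from this[of "{..<p}"] show "eval_fps (\<Sum>j<p. B i j * F j) z = (\<Sum>j<p. A i j z * eval_fps (F j) z)"
        by simp
    qed
    finally show ?thesis .
  qed
  ultimately show ?thesis by (intro exI[of _ "\<lambda>i. eval_fps (F i)"]) auto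
qed

section \<open>Holomorphic linear systems without singular points\<close>

definition linear_system ::
    "nat \<Rightarrow> (nat \<Rightarrow> nat \<Rightarrow> complex \<Rightarrow> complex) \<Rightarrow> complex set \<Rightarrow> (nat \<Rightarrow> complex \<Rightarrow> complex) \<Rightarrow> bool" where
  "linear_system p C S Y \<longleftrightarrow>
     (\<forall>i<p. Y i holomorphic_on S \<and> (\<forall>t\<in>S. deriv (Y i) t = (\<Sum>j<p. C i j t * Y j t)))"

lemma higher_deriv_sum':
  fixes z :: complex
  assumes "finite J" "\<And>j. j \<in> J \<Longrightarrow> f j holomorphic_on S" "open S" "z \<in> S"
  shows "(deriv ^^ n) (\<lambda>w. \<Sum>j\<in>J. f j w) z = (\<Sum>j\<in>J. (deriv ^^ n) (f j) z)"
  using assms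
proof (induction J rule: finite_induct)
  case (insert j J)
  have "(deriv ^^ n) (\<lambda>w. f j w + (\<Sum>j\<in>J. f j w)) z =
        (deriv ^^ n) (f j) z + (deriv ^^ n) (\<lambda>w. \<Sum>j\<in>J. f j w) z"
    by (rule higher_deriv_add) (use insert.prems in \<open>auto intro!: holomorphic_intros\<close>)
  then show ?case using insert by simp
qed (simp add: higher_deriv_const)

text \<open>Differentiating the system with the Leibniz rule expresses each derivative at
  \<open>t0\<close> through lower ones, so all of them vanish and the identity theorem
  applies.\<close>

lemma linear_system_unique:
  assumes S: "open S" "connected S" "t0 \<in> S"
    and C: "\<And>i j. i < p \<Longrightarrow> j < p \<Longrightarrow> C i j holomorphic_on S"
    and Y: "linear_system p C S Y" and Y0: "\<And>i. i < p \<Longrightarrow> Y i t0 = 0"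
    and i: "i < p" "t \<in> S"
  shows "Y i t = 0"
proof -
  have holo: "Y i holomorphic_on S" if "i < p" for i
    using Y that by (auto simp: linear_system_def)
  have "\<forall>i<p. (deriv ^^ n) (Y i) t0 = 0" for n
  proof (induction n rule: less_induct)
    case (less n)
    show ?case
    proof (intro allI impI)
      fix i assume i: "i < p"
      show "(deriv ^^ n) (Y i) t0 = 0"
      proof (cases n)
        case 0
        then show ?thesis using Y0 i by simp
      next
        case (Suc m)
        have "(deriv ^^ n) (Y i) t0 = (deriv ^^ m) (deriv (Y i)) t0"
          using Suc by (simp add: funpow_swap1)
        also have "\<dots> = (deriv ^^ m) (\<lambda>t. \<Sum>j<p. C i j t * Y j t) t0"
        proof (intro higher_deriv_cong_ev refl)
          have "eventually (\<lambda>t. t \<in> S) (nhds t0)"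
            using S by (auto simp: eventually_nhds)
          then show "\<forall>\<^sub>F t in nhds t0. deriv (Y i) t = (\<Sum>j<p. C i j t * Y j t)"
            by eventually_elim (use Y i in \<open>auto simp: linear_system_def\<close>)
        qed
        also have "\<dots> = (\<Sum>j<p. (deriv ^^ m) (\<lambda>t. C i j t * Y j t) t0)"
          by (rule higher_deriv_sum'[of _ _ S]) (use S i in \<open>auto intro!: holomorphic_intros C holo\<close>)
        also have "\<dots> = (\<Sum>j<p. \<Sum>k=0..m. of_nat (m choose k) * (deriv ^^ k) (C i j) t0 * (deriv ^^ (m - k)) (Y j) t0)"
          by (intro sum.cong refl higher_deriv_mult[of _ S] C holo S i) auto
        also have "\<dots> = 0"
          by (intro sum.neutral ballI) (use less Suc in auto)
        finally show ?thesis .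
      qed
    qed
  qed
  then show ?thesis
    using holomorphic_fun_eq_0_on_connected[OF holo[OF i(1)] S(1,2) _ S(3) i(2)] i by blast
qed

text \<open>Multiplied by z, the system is Fuchsian with zero residue at the origin: every initial
  vector is admissible, and the matrices to invert are n times the identity.\<close>

lemma linear_system_disc:
  assumes C: "\<And>i j. i < p \<Longrightarrow> j < p \<Longrightarrow> C i j holomorphic_on ball 0 1"
  shows "\<exists>Y. linear_system p C (ball 0 1) Y \<and> (\<forall>i<p. Y i 0 = y0 i)"
proof -
  have "\<exists>Y. \<forall>i<p. Y i holomorphic_on ball 0 1 \<and> Y i 0 = y0 i \<and>
           (\<forall>z\<in>ball 0 1. z * deriv (Y i) z = (\<Sum>j<p. z * C i j z * Y j z))"
  proof (rule fuchsian_system_solution)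
    fix n :: nat and V :: "nat \<Rightarrow> complex" assume "n \<ge> 1"
    then show "\<exists>Y. \<forall>i<p. of_nat n * Y i - (\<Sum>j<p. 0 * C i j 0 * Y j) = V i"
      by (intro exI[of _ "\<lambda>i. V i / of_nat n"]) auto
  qed (use C in \<open>auto intro!: holomorphic_intros\<close>)
  then obtain Y where Y: "\<And>i. i < p \<Longrightarrow> Y i holomorphic_on ball 0 1" "\<And>i. i < p \<Longrightarrow> Y i 0 = y0 i"
    "\<And>i z. i < p \<Longrightarrow> z \<in> ball 0 1 \<Longrightarrow> z * deriv (Y i) z = (\<Sum>j<p. z * C i j z * Y j z)"
    by blast
  have eq: "deriv (Y i) z = (\<Sum>j<p. C i j z * Y j z)" if i: "i < p" and z: "z \<in> ball 0 1" "z \<noteq> 0" for i z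
    using Y(3)[OF i z(1)] z(2) by (simp add: mult.assoc sum_distrib_left[symmetric])
  \<comment> \<open>Dividing by z loses the origin, where the equation is recovered by
    continuity.\<close>
  have "deriv (Y i) 0 = (\<Sum>j<p. C i j 0 * Y j 0)" if i: "i < p" for i
  proof -
    have c1: "continuous_on (ball 0 1) (deriv (Y i))"
      by (intro holomorphic_on_imp_continuous_on holomorphic_deriv Y(1) i) auto
    have c2: "continuous_on (ball 0 1) (\<lambda>z. \<Sum>j<p. C i j z * Y j z)"
      by (intro holomorphic_on_imp_continuous_on holomorphic_intros Y(1) C i) auto
    have "(deriv (Y i) \<longlongrightarrow> deriv (Y i) 0) (at 0)"
      using c1 by (simp add: continuous_on_eq_continuous_at isCont_def)
    moreover have "((\<lambda>z. \<Sum>j<p. C i j z * Y j z) \<longlongrightarrow> (\<Sum>j<p. C i j 0 * Y j 0)) (at 0)"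
      using c2 by (auto simp: continuous_on_eq_continuous_at isCont_def)
    moreover have "\<forall>\<^sub>F z in at 0. (\<Sum>j<p. C i j z * Y j z) = deriv (Y i) z"
      unfolding eventually_at by (rule exI[of _ 1]) (use eq i in auto)
    ultimately show ?thesis
      using Lim_transform_eventually LIM_unique by blast
  qed
  with eq have "deriv (Y i) z = (\<Sum>j<p. C i j z * Y j z)" if "i < p" "z \<in> ball 0 1" for i z
    using that by (cases "z = 0") auto
  then show ?thesis using Y unfolding linear_system_def by blast
qed

text \<open>The Riemann map turns the system into one on the unit disc.\<close>

lemma linear_system_exists:
  assumes S: "open S" "simply_connected S" "S \<noteq> UNIV" "t0 \<in> S"
    and C: "\<And>i j. i < p \<Longrightarrow> j < p \<Longrightarrow> C i j holomorphic_on S"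
  shows "\<exists>Y. linear_system p C S Y \<and> (\<forall>i<p. Y i t0 = y0 i)"
proof -
  obtain f g where fg: "f holomorphic_on S" "g holomorphic_on ball 0 1"
     "\<And>z. z \<in> S \<Longrightarrow> f z \<in> ball 0 1 \<and> g (f z) = z"
     "\<And>z. z \<in> ball 0 1 \<Longrightarrow> g z \<in> S \<and> f (g z) = z"
  proof -
    have "\<exists>f g. f holomorphic_on S \<and> g holomorphic_on ball 0 1 \<and>
           (\<forall>z \<in> S. f z \<in> ball 0 1 \<and> g(f z) = z) \<and>
           (\<forall>z \<in> ball 0 1. g z \<in> S \<and> f(g z) = z)"
      using Riemann_mapping_theorem[of S] S by blast
    then show ?thesis using that by blast
  qed
  have "f t0 \<in> ball 0 1" using fg(3)[OF S(4)] by blast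
  \<comment> \<open>An automorphism of the disc moves the image of \<open>t0\<close> to the centre,
    where \<open>linear_system_disc\<close> prescribes the initial values.\<close>
  then obtain f' g' where fg': "f' (f t0) = 0" "f' holomorphic_on ball 0 1" "f' ` ball 0 1 \<subseteq> ball 0 1"
     "g' holomorphic_on ball 0 1" "g' ` ball 0 1 \<subseteq> ball 0 1"
     "\<And>z. z \<in> ball 0 1 \<Longrightarrow> f' (g' z) = z" "\<And>z. z \<in> ball 0 1 \<Longrightarrow> g' (f' z) = z"
    using ball_biholomorphism_exists by blast
  have f'_ball: "f' z \<in> ball 0 1" and g'_ball: "g' z \<in> ball 0 1" if "z \<in> ball 0 1" for z
    using fg'(3,5) that by blast+
  define F where "F = f' \<circ> f"
  define G where "G = g \<circ> g'"
  have F: "F holomorphic_on S" unfolding F_def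
    by (rule holomorphic_on_compose_gen[OF fg(1) fg'(2)]) (use fg in auto)
  have G: "G holomorphic_on ball 0 1" unfolding G_def
    by (rule holomorphic_on_compose_gen[OF fg'(4) fg(2)]) (use fg' in auto)
  have FS: "F z \<in> ball 0 1" and GF: "G (F z) = z" if "z \<in> S" for z
    using fg(3)[OF that] f'_ball[of "f z"] fg'(7)[of "f z"] by (auto simp: F_def G_def)
  have GS: "G z \<in> S" if "z \<in> ball 0 1" for z
    using fg(4) g'_ball that by (auto simp: G_def)
  have F0: "F t0 = 0" by (simp add: F_def fg')
  \<comment> \<open>The system pulled back along \<open>G\<close>; the factor
    \<open>deriv G z\<close> comes from the chain rule and is undone by \<open>inv\<close>
    below.\<close>
  define C' where "C' = (\<lambda>i j z. C i j (G z) * deriv G z)"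
  have "C' i j holomorphic_on ball 0 1" if "i < p" "j < p" for i j
  proof -
    have "(C i j \<circ> G) holomorphic_on ball 0 1"
      by (rule holomorphic_on_compose_gen[OF G C[OF that]]) (use GS in auto)
    then show ?thesis unfolding C'_def
      by (intro holomorphic_intros holomorphic_deriv G) (auto simp: o_def)
  qed
  then obtain Z where Z: "linear_system p C' (ball 0 1) Z" "\<And>i. i < p \<Longrightarrow> Z i 0 = y0 i"
    using linear_system_disc[of p C' y0] by blast
  have Zh: "Z i holomorphic_on ball 0 1" if "i < p" for i
    using Z(1) that by (simp add: linear_system_def)
  have "linear_system p C S (\<lambda>i. Z i \<circ> F)"
    unfolding linear_system_def
  proof (intro allI impI conjI ballI)
    fix i assume i: "i < p"
    show "Z i \<circ> F holomorphic_on S"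
      by (rule holomorphic_on_compose_gen[OF F Zh[OF i]]) (use FS in auto)
    fix t assume t: "t \<in> S"
    have dF: "(F has_field_derivative deriv F t) (at t)"
      using F S t by (simp add: holomorphic_derivI)
    have dG: "(G has_field_derivative deriv G (F t)) (at (F t))"
      using G FS[OF t] by (simp add: holomorphic_derivI)
    have "((G \<circ> F) has_field_derivative deriv G (F t) * deriv F t) (at t)"
      by (rule DERIV_chain[OF dG dF])
    moreover have "((G \<circ> F) has_field_derivative 1) (at t)"
      using has_field_derivative_transform_within_open[OF DERIV_ident S(1) t] GF by (simp add: o_def)
    ultimately have inv: "deriv G (F t) * deriv F t = 1" by (rule DERIV_unique)
    have "(Z i has_field_derivative deriv (Z i) (F t)) (at (F t))"
      using Zh[OF i] FS[OF t] by (simp add: holomorphic_derivI)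
    then have "((Z i \<circ> F) has_field_derivative deriv (Z i) (F t) * deriv F t) (at t)"
      using dF by (rule DERIV_chain)
    then have "deriv (Z i \<circ> F) t = deriv (Z i) (F t) * deriv F t"
      by (rule DERIV_imp_deriv)
    also have "\<dots> = (\<Sum>j<p. C i j (G (F t)) * deriv G (F t) * Z j (F t)) * deriv F t"
      using Z(1) i FS[OF t] by (auto simp: linear_system_def C'_def)
    also have "\<dots> = (\<Sum>j<p. C i j t * Z j (F t)) * (deriv G (F t) * deriv F t)"
      unfolding sum_distrib_right GF[OF t] by (intro sum.cong refl) (simp add: mult_ac)
    finally show "deriv (Z i \<circ> F) t = (\<Sum>j<p. C i j t * (Z j \<circ> F) t)"
      using inv by simp
  qed
  then show ?thesis using Z(2) F0 by (intro exI[of _ "\<lambda>i. Z i \<circ> F"]) auto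
qed

section \<open>Differential operators with constant coefficients\<close>

definition diff_op :: "complex poly \<Rightarrow> (complex \<Rightarrow> complex) \<Rightarrow> complex \<Rightarrow> complex" where
  "diff_op q f t = (\<Sum>i\<le>degree q. coeff q i * (deriv ^^ i) f t)"

lemma diff_op_altdef:
  assumes "degree q \<le> n"
  shows "diff_op q f t = (\<Sum>i\<le>n. coeff q i * (deriv ^^ i) f t)"
  unfolding diff_op_def using assms
  by (intro sum.mono_neutral_left) (auto simp: coeff_eq_0)

lemma diff_op_0 [simp]: "diff_op 0 f t = 0"
  and diff_op_1 [simp]: "diff_op 1 f t = f t"
  by (simp_all add: diff_op_def)

lemma diff_op_add: "diff_op (q + r) f t = diff_op q f t + diff_op r f t"
proof -
  define n where "n = max (degree q) (degree r)"
  have "degree (q + r) \<le> n" "degree q \<le> n" "degree r \<le> n"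
    unfolding n_def by (auto intro: degree_add_le)
  then show ?thesis by (simp add: diff_op_altdef sum.distrib distrib_right)
qed

lemma diff_op_smult: "diff_op (Polynomial.smult c q) f t = c * diff_op q f t"
  by (subst diff_op_altdef[of _ "degree q"])
    (auto simp: diff_op_def sum_distrib_left mult_ac degree_smult_le)

lemma diff_op_sum: "diff_op (\<Sum>i\<in>I. q i) f t = (\<Sum>i\<in>I. diff_op (q i) f t)"
  by (induction I rule: infinite_finite_induct) (auto simp: diff_op_add)

lemma diff_op_holomorphic:
  "f holomorphic_on S \<Longrightarrow> open S \<Longrightarrow> diff_op q f holomorphic_on S"
  unfolding diff_op_def by (intro holomorphic_intros holomorphic_higher_deriv)

lemma diff_op_cong:
  "eventually (\<lambda>t. f t = g t) (nhds t) \<Longrightarrow> diff_op q f t = diff_op q g t"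
  unfolding diff_op_def by (intro sum.cong refl arg_cong2[where f = "(*)"] higher_deriv_cong_ev)

lemma diff_op_cong_open:
  assumes "open S" "t \<in> S" "\<And>t. t \<in> S \<Longrightarrow> f t = g t"
  shows "diff_op q f t = diff_op q g t"
  by (rule diff_op_cong) (use assms in \<open>auto simp: eventually_nhds\<close>)

lemma diff_op_lincomb:
  assumes "finite J" "open S" "t \<in> S" "\<And>j. j \<in> J \<Longrightarrow> f j holomorphic_on S"
  shows "diff_op q (\<lambda>t. \<Sum>j\<in>J. c j * f j t) t = (\<Sum>j\<in>J. c j * diff_op q (f j) t)"
proof -
  have "(deriv ^^ i) (\<lambda>t. \<Sum>j\<in>J. c j * f j t) t = (\<Sum>j\<in>J. c j * (deriv ^^ i) (f j) t)" for i
    by (subst higher_deriv_sum'[of _ _ S])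
      (use assms in \<open>auto intro!: holomorphic_intros sum.cong higher_deriv_cmult[of _ S]\<close>)
  then show ?thesis
    unfolding diff_op_def by (simp add: sum_distrib_left mult_ac sum.swap[of _ _ J])
qed

lemma diff_op_linear_factor:
  assumes "f holomorphic_on S" "open S" "t \<in> S"
  shows "diff_op ([:c, 1:] * q) f t = deriv (diff_op q f) t + c * diff_op q f t"
proof -
  define n where "n = degree q"
  have D: "deriv (\<lambda>t. \<Sum>i\<in>{..n}. coeff q i * (deriv ^^ i) f t) t =
        (\<Sum>i\<in>{..n}. coeff q i * (deriv ^^ Suc i) f t)"
  proof (rule DERIV_imp_deriv, intro DERIV_sum DERIV_cmult)
    fix i show "((deriv ^^ i) f has_field_derivative (deriv ^^ Suc i) f t) (at t)"
      using assms by (rule has_field_derivative_higher_deriv)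
  qed
  have "diff_op ([:c, 1:] * q) f t = c * diff_op q f t + diff_op (pCons 0 q) f t"
    by (simp add: diff_op_add diff_op_smult)
  also have "diff_op (pCons 0 q) f t = (\<Sum>i\<le>Suc n. coeff (pCons 0 q) i * (deriv ^^ i) f t)"
    by (rule diff_op_altdef) (simp add: n_def degree_pCons_le)
  also have "\<dots> = (\<Sum>i\<le>n. coeff q i * (deriv ^^ Suc i) f t)"
    by (subst sum.atMost_Suc_shift) simp
  also have "\<dots> = deriv (diff_op q f) t"
    using D by (simp add: diff_op_def[abs_def] n_def)
  finally show ?thesis by simp
qed

lemma higher_deriv_shift:
  fixes f :: "complex \<Rightarrow> complex"
  shows "(deriv ^^ n) (\<lambda>t. f (t + w)) = (\<lambda>t. (deriv ^^ n) f (t + w))"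
proof (induction n)
  case (Suc n)
  have "deriv (\<lambda>t. g (t + w)) = (\<lambda>t. deriv g (t + w))" for g :: "complex \<Rightarrow> complex"
    by (simp add: deriv_def DERIV_shift fun_eq_iff)
  then show ?case using Suc by simp
qed simp

lemma diff_op_shift: "diff_op q (\<lambda>t. f (t + w)) t = diff_op q f (t + w)"
  by (simp add: diff_op_def higher_deriv_shift)

text \<open>Newton polynomials with nodes \<open>- \<gamma> i\<close>; the sign is that of the
  factors x d/dx + a_i. Unlike the powers of D, they make every row but the last of the companion
  system bidiagonal, with the exponents on the diagonal.\<close>

definition newton_basis :: "(nat \<Rightarrow> complex) \<Rightarrow> nat \<Rightarrow> complex poly" where
  "newton_basis \<gamma> k = (\<Prod>i<k. [:\<gamma> i, 1:])"

lemma newton_basis_0 [simp]: "newton_basis \<gamma> 0 = 1"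
  by (simp add: newton_basis_def)

lemma newton_basis_Suc: "newton_basis \<gamma> (Suc k) = [:\<gamma> k, 1:] * newton_basis \<gamma> k"
  by (simp add: newton_basis_def mult.commute)

lemma degree_newton_basis: "degree (newton_basis \<gamma> k) = k"
  by (simp add: newton_basis_def degree_prod_eq_sum_degree)

lemma coeff_newton_basis: "coeff (newton_basis \<gamma> k) k = 1"
proof (induction k)
  case (Suc k)
  have "coeff (newton_basis \<gamma> k) (Suc k) = 0"
    by (intro coeff_eq_0) (simp add: degree_newton_basis)
  then show ?case using Suc by (simp add: newton_basis_Suc)
qed simp

lemma coeff_newton_basis_Suc: "coeff (newton_basis \<gamma> (Suc k)) k = (\<Sum>i\<le>k. \<gamma> i)"
proof (induction k)
  case 0
  then show ?case by (simp add: newton_basis_Suc)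
next
  case (Suc k)
  then show ?case
    using coeff_newton_basis[of \<gamma> "Suc k"]
    by (subst newton_basis_Suc) simp
qed

lemma newton_expansion:
  assumes "\<And>i. i \<ge> n \<Longrightarrow> coeff r i = 0"
  shows "\<exists>q. r = (\<Sum>k<n. Polynomial.smult (q k) (newton_basis \<gamma> k))"
  using assms
proof (induction n arbitrary: r)
  case 0
  then show ?case by (intro exI[of _ "\<lambda>_. 0"]) (auto simp: poly_eq_iff)
next
  case (Suc n)
  have "coeff (r - Polynomial.smult (coeff r n) (newton_basis \<gamma> n)) i = 0" if "i \<ge> n" for i
    using Suc.prems[of i] that coeff_newton_basis[of \<gamma> n] coeff_eq_0[of "newton_basis \<gamma> n" i]
    by (cases "i = n") (auto simp: degree_newton_basis)
  then obtain q where q: "r - Polynomial.smult (coeff r n) (newton_basis \<gamma> n) = (\<Sum>k<n. Polynomial.smult (q k) (newton_basis \<gamma> k))"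
    using Suc.IH by blast
  have "r = (\<Sum>k<Suc n. Polynomial.smult ((q(n := coeff r n)) k) (newton_basis \<gamma> k))"
    using q by (simp add: algebra_simps)
  then show ?case by blast
qed

text \<open>Both polynomials are monic, so the difference has degree below p, and its coefficient at
  p - 1 is read off from the subleading terms. This \<open>q (p - 1)\<close> later becomes the
  nontrivial local exponent at t = 0.\<close>

lemma newton_basis_change:
  assumes "p > 0"
  shows "\<exists>q. newton_basis \<beta> p = newton_basis \<alpha> p + (\<Sum>k<p. Polynomial.smult (q k) (newton_basis \<alpha> k)) \<and>
          q (p - 1) = (\<Sum>i<p. \<beta> i) - (\<Sum>i<p. \<alpha> i)"
proof -
  define r where "r = newton_basis \<beta> p - newton_basis \<alpha> p"
  have "coeff r i = 0" if "i \<ge> p" for i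
    using that coeff_eq_0[of "newton_basis \<alpha> p" i] coeff_eq_0[of "newton_basis \<beta> p" i]
      coeff_newton_basis[of \<alpha> p] coeff_newton_basis[of \<beta> p]
    by (cases "i = p") (auto simp: r_def degree_newton_basis)
  then obtain q where q: "r = (\<Sum>k<p. Polynomial.smult (q k) (newton_basis \<alpha> k))"
    using newton_expansion by blast
  obtain m where m: "p = Suc m" using assms by (cases p) auto
  have "coeff r m = (\<Sum>k<p. q k * coeff (newton_basis \<alpha> k) m)"
    unfolding q by (simp add: coeff_sum)
  also have "\<dots> = q m" unfolding m
    by (simp add: coeff_newton_basis coeff_eq_0 degree_newton_basis)
  finally have "q (p - 1) = (\<Sum>i<p. \<beta> i) - (\<Sum>i<p. \<alpha> i)"
    by (simp add: r_def m coeff_newton_basis_Suc lessThan_Suc_atMost)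
  then show ?thesis using q by (intro exI[of _ q]) (simp add: r_def algebra_simps)
qed

text \<open>The hypergeometric equation in the coordinate \<open>t = log x\<close>, where \<open>x d/dx = d/dt\<close>.\<close>

definition hg_solution ::
    "nat \<Rightarrow> (nat \<Rightarrow> complex) \<Rightarrow> (nat \<Rightarrow> complex) \<Rightarrow> complex set \<Rightarrow> (complex \<Rightarrow> complex) \<Rightarrow> bool" where
  "hg_solution p \<alpha> \<beta> S f \<longleftrightarrow> f holomorphic_on S \<and>
     (\<forall>t\<in>S. exp t * diff_op (newton_basis \<alpha> p) f t = diff_op (newton_basis \<beta> p) f t)"

lemma hg_solution_subset: "hg_solution p \<alpha> \<beta> S f \<Longrightarrow> U \<subseteq> S \<Longrightarrow> hg_solution p \<alpha> \<beta> U f"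
  unfolding hg_solution_def by (meson holomorphic_on_subset subsetD)

lemma hg_solution_lincomb:
  assumes "open S" "\<And>j. j \<in> J \<Longrightarrow> hg_solution p \<alpha> \<beta> S (f j)" "finite J"
  shows "hg_solution p \<alpha> \<beta> S (\<lambda>t. \<Sum>j\<in>J. c j * f j t)"
proof -
  have h: "f j holomorphic_on S" if "j \<in> J" for j using assms(2)[OF that] by (simp add: hg_solution_def)
  have "exp t * diff_op (newton_basis \<alpha> p) (\<lambda>t. \<Sum>j\<in>J. c j * f j t) t =
        diff_op (newton_basis \<beta> p) (\<lambda>t. \<Sum>j\<in>J. c j * f j t) t" if t: "t \<in> S" for t
  proof -
    have "exp t * (\<Sum>j\<in>J. c j * diff_op (newton_basis \<alpha> p) (f j) t) =
          (\<Sum>j\<in>J. c j * diff_op (newton_basis \<beta> p) (f j) t)"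
      unfolding sum_distrib_left
      by (intro sum.cong refl) (use assms(2) t in \<open>auto simp: hg_solution_def mult.left_commute\<close>)
    then show ?thesis using assms t h by (simp add: diff_op_lincomb[of J S])
  qed
  then show ?thesis using h unfolding hg_solution_def by (auto intro!: holomorphic_intros)
qed

lemma hg_solution_shift:
  assumes "hg_solution p \<alpha> \<beta> S f" "exp w = 1"
  shows "hg_solution p \<alpha> \<beta> {t. t + w \<in> S} (\<lambda>t. f (t + w))"
proof -
  have "(f \<circ> (\<lambda>t. t + w)) holomorphic_on {t. t + w \<in> S}"
    by (rule holomorphic_on_compose_gen[of _ _ _ S])
      (use assms(1) in \<open>auto intro!: holomorphic_intros simp: hg_solution_def\<close>)
  then show ?thesis
    using assms unfolding hg_solution_def by (auto simp: diff_op_shift exp_add o_def)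
qed

lemma diff_op_newton_reflect:
  assumes "f holomorphic_on S" "open S" "- t \<in> S"
  shows "diff_op (newton_basis \<gamma> k) (\<lambda>t. f (- t)) t =
         (-1) ^ k * diff_op (newton_basis (\<lambda>i. - \<gamma> i) k) f (- t)"
  using assms(3)
proof (induction k arbitrary: t)
  case (Suc k)
  have op: "open (uminus ` S)" using assms(2) by (rule open_negations)
  have "(f \<circ> uminus) holomorphic_on uminus ` S"
    by (rule holomorphic_on_compose_gen[of _ _ _ S]) (use assms in \<open>auto intro!: holomorphic_intros\<close>)
  then have h: "(\<lambda>t. f (- t)) holomorphic_on uminus ` S" by (simp add: o_def)
  have t: "t \<in> uminus ` S" using Suc.prems by (metis image_eqI minus_minus)
  define g where "g = diff_op (newton_basis (\<lambda>i. - \<gamma> i) k) f"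
  have gd: "(g has_field_derivative deriv g (- t)) (at (- t))"
    unfolding g_def using assms Suc.prems by (intro holomorphic_derivI diff_op_holomorphic) auto
  have "((\<lambda>t. g (- t)) has_field_derivative deriv g (- t) * (- 1)) (at t)"
    by (rule DERIV_chain'[where f = uminus and g = g, OF _ gd]) (auto intro!: derivative_eq_intros)
  then have "((\<lambda>t. (-1) ^ k * g (- t)) has_field_derivative (-1) ^ k * (deriv g (- t) * (- 1))) (at t)"
    by (rule DERIV_cmult)
  moreover have "deriv (diff_op (newton_basis \<gamma> k) (\<lambda>t. f (- t))) t = deriv (\<lambda>t. (-1) ^ k * g (- t)) t"
  proof (rule deriv_cong_ev)
    have "\<forall>\<^sub>F t in nhds t. t \<in> uminus ` S" using op t by (rule eventually_nhds_in_open)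
    then show "\<forall>\<^sub>F t in nhds t. diff_op (newton_basis \<gamma> k) (\<lambda>t. f (- t)) t = (-1) ^ k * g (- t)"
      by eventually_elim (use Suc.IH g_def in auto)
  qed simp
  ultimately have D: "deriv (diff_op (newton_basis \<gamma> k) (\<lambda>t. f (- t))) t = (-1) ^ k * (deriv g (- t) * (- 1))"
    using DERIV_imp_deriv by metis
  have "diff_op (newton_basis \<gamma> (Suc k)) (\<lambda>t. f (- t)) t =
        (-1) ^ k * (deriv g (- t) * (- 1)) + \<gamma> k * ((-1) ^ k * g (- t))"
    unfolding newton_basis_Suc diff_op_linear_factor[OF h op t] D
    using Suc by (simp add: g_def)
  also have "\<dots> = (-1) ^ Suc k * (deriv g (- t) + - \<gamma> k * g (- t))"
    by (simp add: algebra_simps)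
  finally show ?case
    unfolding newton_basis_Suc diff_op_linear_factor[OF assms(1,2) Suc.prems] g_def by simp
qed simp

text \<open>The substitution t -> -t replaces D by -D and \<open>exp t\<close> by its inverse, so
  the two sides of the equation trade places and the exponents change sign; the factors (-1)^p
  cancel. In terms of x this is x -> 1/x.\<close>

lemma hg_solution_reflect:
  assumes "hg_solution p (\<lambda>i. - \<beta> i) (\<lambda>i. - \<alpha> i) S f" "open S"
  shows "hg_solution p \<alpha> \<beta> (uminus ` S) (\<lambda>t. f (- t))"
proof -
  have h: "f holomorphic_on S" using assms by (simp add: hg_solution_def)
  have "(f \<circ> uminus) holomorphic_on uminus ` S"
    by (rule holomorphic_on_compose_gen[of _ _ _ S]) (use h in \<open>auto intro!: holomorphic_intros\<close>)
  moreover have "exp t * diff_op (newton_basis \<alpha> p) (\<lambda>t. f (- t)) t =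
      diff_op (newton_basis \<beta> p) (\<lambda>t. f (- t)) t" if t: "- t \<in> S" for t
  proof -
    have "exp (- t) * diff_op (newton_basis (\<lambda>i. - \<beta> i) p) f (- t) =
          diff_op (newton_basis (\<lambda>i. - \<alpha> i) p) f (- t)"
      using assms t by (simp add: hg_solution_def)
    then have "exp t * (exp (- t) * diff_op (newton_basis (\<lambda>i. - \<beta> i) p) f (- t)) =
          exp t * diff_op (newton_basis (\<lambda>i. - \<alpha> i) p) f (- t)" by simp
    then have "diff_op (newton_basis (\<lambda>i. - \<beta> i) p) f (- t) =
          exp t * diff_op (newton_basis (\<lambda>i. - \<alpha> i) p) f (- t)"
      by (simp add: exp_minus field_simps)
    then show ?thesis
      using t by (simp add: diff_op_newton_reflect[OF h assms(2)])
  qed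
  ultimately show ?thesis unfolding hg_solution_def by (auto simp: o_def)
qed

section \<open>Determinants\<close>

definition sq_mat :: "nat \<Rightarrow> (nat \<Rightarrow> nat \<Rightarrow> 'a) \<Rightarrow> 'a mat" where
  "sq_mat p f = Matrix.mat p p (\<lambda>(i, j). f i j)"

abbreviation sq_det :: "nat \<Rightarrow> (nat \<Rightarrow> nat \<Rightarrow> complex) \<Rightarrow> complex" where
  "sq_det p f \<equiv> Determinant.det (sq_mat p f)"

lemma sq_mat_carrier [simp]: "sq_mat p f \<in> carrier_mat p p"
  by (simp add: sq_mat_def)

lemma sq_mat_mult:
  "sq_mat p f * sq_mat p g = sq_mat p (\<lambda>i j. \<Sum>k<p. f i k * (g k j :: 'a :: comm_semiring_0))"
  by (rule eq_matI) (auto simp: sq_mat_def scalar_prod_def atLeast0LessThan)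

lemma sq_mat_cong:
  "(\<And>i j. i < p \<Longrightarrow> j < p \<Longrightarrow> f i j = g i j) \<Longrightarrow> sq_mat p f = sq_mat p g"
  by (auto simp: sq_mat_def)

lemma sq_mat_one: "sq_mat p (\<lambda>i j. if i = j then 1 else 0) = 1\<^sub>m p"
  by (auto simp: sq_mat_def)

lemma sq_mat_eq_iff: "sq_mat p f = sq_mat p g \<longleftrightarrow> (\<forall>i<p. \<forall>j<p. f i j = g i j)"
  by (auto simp: sq_mat_def mat_eq_iff)

lemma sq_mat_mult_eq_one_iff:
  "sq_mat p f * sq_mat p g = 1\<^sub>m p \<longleftrightarrow>
     (\<forall>i<p. \<forall>j<p. (\<Sum>k<p. f i k * (g k j :: 'a :: comm_semiring_1)) = (if i = j then 1 else 0))"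
  unfolding sq_mat_mult sq_mat_one[symmetric] sq_mat_eq_iff ..

text \<open>The kernel is taken on the left because rows will be indexed by solutions: a kernel
  vector is then a linear relation among them.\<close>

lemma det_sq_mat_eq_0_iff:
  fixes f :: "nat \<Rightarrow> nat \<Rightarrow> complex"
  shows "sq_det p f = 0 \<longleftrightarrow>
         (\<exists>c. (\<exists>i<p. c i \<noteq> 0) \<and> (\<forall>j<p. (\<Sum>i<p. c i * f i j) = 0))" (is "?L \<longleftrightarrow> ?R")
proof -
  have "?L \<longleftrightarrow> Determinant.det (transpose_mat (sq_mat p f)) = 0"
    by (simp add: Determinant.det_transpose[of _ p])
  also have "\<dots> \<longleftrightarrow> (\<exists>v. v \<in> carrier_vec p \<and> v \<noteq> 0\<^sub>v p \<and> transpose_mat (sq_mat p f) *\<^sub>v v = 0\<^sub>v p)"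
    by (rule det_0_iff_vec_prod_zero) simp
  also have "\<dots> \<longleftrightarrow> ?R"
  proof
    assume "\<exists>v. v \<in> carrier_vec p \<and> v \<noteq> 0\<^sub>v p \<and> transpose_mat (sq_mat p f) *\<^sub>v v = 0\<^sub>v p"
    then obtain v where v: "v \<in> carrier_vec p" "v \<noteq> 0\<^sub>v p" "transpose_mat (sq_mat p f) *\<^sub>v v = 0\<^sub>v p"
      by blast
    have "\<exists>i<p. v $ i \<noteq> 0"
    proof (rule ccontr)
      assume "\<not> ?thesis"
      then have "v = 0\<^sub>v p" using v(1) by (intro eq_vecI) auto
      then show False using v by simp
    qed
    moreover have "(\<Sum>i<p. v $ i * f i j) = 0" if "j < p" for j
    proof -
      have "(\<Sum>i<p. v $ i * f i j) = (transpose_mat (sq_mat p f) *\<^sub>v v) $ j"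
        using that v(1) by (simp add: sq_mat_def scalar_prod_def atLeast0LessThan mult.commute)
      then show ?thesis using v that by simp
    qed
    ultimately show ?R by (intro exI[of _ "\<lambda>i. v $ i"]) auto
  next
    assume ?R
    then obtain c i where c: "i < p" "c i \<noteq> 0" "\<And>j. j < p \<Longrightarrow> (\<Sum>i<p. c i * f i j) = 0" by blast
    have "vec p c \<noteq> 0\<^sub>v p" using c by (metis index_vec index_zero_vec(1))
    moreover have "transpose_mat (sq_mat p f) *\<^sub>v vec p c = 0\<^sub>v p"
      using c(3) by (intro eq_vecI) (auto simp: sq_mat_def scalar_prod_def atLeast0LessThan mult.commute)
    ultimately show "\<exists>v. v \<in> carrier_vec p \<and> v \<noteq> 0\<^sub>v p \<and> transpose_mat (sq_mat p f) *\<^sub>v v = 0\<^sub>v p"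
      by (intro exI[of _ "vec p c"]) auto
  qed
  finally show ?thesis .
qed

lemma sq_mat_inverse:
  fixes f :: "nat \<Rightarrow> nat \<Rightarrow> complex"
  assumes "sq_det p f \<noteq> 0"
  shows "\<exists>u. sq_mat p u * sq_mat p f = 1\<^sub>m p \<and> sq_mat p f * sq_mat p u = 1\<^sub>m p"
proof -
  obtain B where B: "B \<in> carrier_mat p p" "B * sq_mat p f = 1\<^sub>m p" "sq_mat p f * B = 1\<^sub>m p"
    using det_non_zero_imp_unit[OF sq_mat_carrier assms, of undefined]
    by (auto simp: Units_def ring_mat_def)
  have "B = sq_mat p (\<lambda>i j. B $$ (i, j))"
    using B(1) by (auto simp: sq_mat_def)
  then show ?thesis using B by metis
qed

lemma tendsto_det_sq_mat:
  fixes P :: "'b \<Rightarrow> nat \<Rightarrow> nat \<Rightarrow> complex"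
  assumes "\<And>i j. i < p \<Longrightarrow> j < p \<Longrightarrow> ((\<lambda>x. P x i j) \<longlongrightarrow> D i j) F"
  shows "((\<lambda>x. sq_det p (P x)) \<longlongrightarrow> sq_det p D) F"
proof -
  have perm: "\<pi> i < p" if "\<pi> permutes {0..<p}" "i < p" for \<pi> i
    using permutes_in_image[OF that(1), of i] that(2) by simp
  have *: "sq_det p f =
      (\<Sum>\<pi>\<in>{\<pi>. \<pi> permutes {0..<p}}. signof \<pi> * (\<Prod>i=0..<p. f i (\<pi> i)))" for f :: "nat \<Rightarrow> nat \<Rightarrow> complex"
    unfolding Determinant.det_def'[OF sq_mat_carrier]
    by (intro sum.cong refl arg_cong2[where f = "(*)"] prod.cong) (auto simp: sq_mat_def perm)
  show ?thesis
    unfolding * by (intro tendsto_intros assms) (auto simp: perm)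
qed

lemma prod_list_diag_sq_mat: "prod_list (diag_mat (sq_mat n f)) = (\<Prod>i<n. f i i :: complex)"
proof -
  have "diag_mat (sq_mat n f) = map (\<lambda>i. f i i) [0..<n]"
    by (auto simp: diag_mat_def sq_mat_def)
  then show ?thesis by (simp add: prod.list_conv_set_nth atLeast0LessThan)
qed

lemma det_sq_mat_diag:
  "sq_det p (\<lambda>i j. if i = j then x i else 0) = (\<Prod>i<p. x i :: complex)"
proof -
  have "upper_triangular (sq_mat p (\<lambda>i j. if i = j then x i else 0))"
    by (auto simp: sq_mat_def)
  from det_upper_triangular[OF this sq_mat_carrier] show ?thesis
    unfolding prod_list_diag_sq_mat by simp
qed

lemma det_sq_mat_transpose:
  fixes f :: "nat \<Rightarrow> nat \<Rightarrow> complex"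
  shows "sq_det p (\<lambda>i j. f j i) = sq_det p f"
proof -
  have "transpose_mat (sq_mat p f) = sq_mat p (\<lambda>i j. f j i)"
    by (auto simp: sq_mat_def)
  then show ?thesis using Determinant.det_transpose[OF sq_mat_carrier, of p f] by simp
qed

text \<open>The p - 1 independent rows \<open>c l\<close> annihilate every column of
  \<open>N\<close>. Completed by a unit row that does not annihilate column \<open>j0\<close>, they
  form an invertible matrix \<open>M\<close>. Subtracting from a column the multiple of column
  \<open>j0\<close> that clears entry \<open>i0\<close> gives a vector killed by all rows of
  \<open>M\<close>, hence zero.\<close>

lemma rank_one_if_left_kernel:
  fixes c N :: "nat \<Rightarrow> nat \<Rightarrow> complex"
  assumes p: "p > 0"
    and ind: "\<And>x. (\<And>i. i < p \<Longrightarrow> (\<Sum>l<p-1. x l * c l i) = 0) \<Longrightarrow> \<forall>l<p-1. x l = 0"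
    and kernel: "\<And>l j. l < p - 1 \<Longrightarrow> j < p \<Longrightarrow> (\<Sum>i<p. c l i * N i j) = 0"
  shows "\<exists>w u. \<forall>i<p. \<forall>j<p. N i j = w i * u j"
proof (cases "\<exists>i0<p. \<exists>j0<p. N i0 j0 \<noteq> 0")
  case False
  then show ?thesis by (intro exI[of _ "\<lambda>_. 0"]) auto
next
  case True
  then obtain i0 j0 where ij: "i0 < p" "j0 < p" "N i0 j0 \<noteq> 0" by blast
  obtain m where m: "p = Suc m" using p by (cases p) auto
  define M where "M = (\<lambda>l i. if l = m then (if i = i0 then 1 else 0) else c l i)"
  have M_sum: "(\<Sum>i<p. M m i * y i) = y i0" for y
    using ij by (simp add: M_def if_distrib[of "\<lambda>z. z * _"] cong: if_cong)
  have detM: "sq_det p M \<noteq> 0"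
  proof
    assume "sq_det p M = 0"
    then obtain x l where x: "l < p" "x l \<noteq> 0" "\<And>i. i < p \<Longrightarrow> (\<Sum>l<p. x l * M l i) = 0"
      unfolding det_sq_mat_eq_0_iff by blast
    have "0 = (\<Sum>i<p. (\<Sum>l<p. x l * M l i) * N i j0)" using x(3) by simp
    also have "\<dots> = (\<Sum>l<p. x l * (\<Sum>i<p. M l i * N i j0))"
      unfolding sum_distrib_left sum_distrib_right by (subst sum.swap) (simp add: mult.assoc)
    also have "\<dots> = (\<Sum>l<m. x l * (\<Sum>i<p. c l i * N i j0)) + x m * N i0 j0"
      using M_sum[of "\<lambda>i. N i j0"] unfolding m sum.lessThan_Suc by (simp add: M_def)
    also have "(\<Sum>l<m. x l * (\<Sum>i<p. c l i * N i j0)) = 0"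
      using kernel ij m by (intro sum.neutral) auto
    finally have xm: "x m = 0" using ij by simp
    have "(\<Sum>l<p-1. x l * c l i) = 0" if "i < p" for i
      using x(3)[OF that] xm unfolding m sum.lessThan_Suc by (simp add: M_def)
    then have "\<forall>l<p-1. x l = 0" by (rule ind)
    then show False using x(1,2) xm m by (cases "l = m") auto
  qed
  have "N i j = N i j0 * (N i0 j / N i0 j0)" if "i < p" "j < p" for i j
  proof (rule ccontr)
    define y where "y = (\<lambda>i. N i j - N i j0 * (N i0 j / N i0 j0))"
    assume "N i j \<noteq> N i j0 * (N i0 j / N i0 j0)"
    then have "y i \<noteq> 0" by (simp add: y_def)
    moreover have "(\<Sum>i<p. y i * M l i) = 0" if l: "l < p" for l
    proof (cases "l = m")
      case True
      then show ?thesis using M_sum[of y] ij by (simp add: y_def mult.commute)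
    next
      case False
      have "(\<Sum>i<p. y i * M l i) = (\<Sum>i<p. c l i * N i j) - (N i0 j / N i0 j0) * (\<Sum>i<p. c l i * N i j0)"
        using False by (simp add: y_def M_def algebra_simps sum_subtractf sum_distrib_left)
      then show ?thesis using kernel l False m ij \<open>j < p\<close> by simp
    qed
    ultimately have "sq_det p (\<lambda>i j. M j i) = 0"
      unfolding det_sq_mat_eq_0_iff using \<open>i < p\<close> by blast
    then show False using detM det_sq_mat_transpose[of p M] by simp
  qed
  then show ?thesis by (intro exI[of _ "\<lambda>i. N i j0"] exI[of _ "\<lambda>j. N i0 j / N i0 j0"]) auto
qed

text \<open>The matrix determinant lemma, by bordering with an extra index \<open>p\<close>:
  \<open>E\<close> and \<open>G\<close> are unit lower triangular, \<open>F\<close> contains the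
  given matrix as a block, and \<open>E * F * G\<close> is the upper triangular \<open>H\<close>
  with the claimed value in its corner.\<close>

lemma det_one_plus_rank_one:
  fixes a z :: "nat \<Rightarrow> complex"
  shows "sq_det p (\<lambda>i j. (if i = j then 1 else 0) + a i * z j) = 1 + (\<Sum>i<p. a i * z i)"
proof -
  define E where "E = (\<lambda>i j. if i = j then 1 else if i = p then z j else 0)"
  define F where "F = (\<lambda>i j. if i = p then (if j = p then 1 else 0)
      else if j = p then a i else (if i = j then 1 else 0) + a i * z j)"
  define G where "G = (\<lambda>i j. if i = j then 1 else if i = p then - z j else 0)"
  define H where "H = (\<lambda>i j. if i = p then (if j = p then 1 + (\<Sum>i<p. a i * z i) else 0)
      else if j = p then a i else if i = j then 1 else 0)"
  have lt: "i < p" if "i < Suc p" "i \<noteq> p" for i using that by simp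
  have "sq_mat (Suc p) E * (sq_mat (Suc p) F * sq_mat (Suc p) G) = sq_mat (Suc p) H"
  proof -
    have FG: "(\<Sum>k<Suc p. F i k * G k j) =
        (if i = p then (if j = p then 1 else - z j) else if j = p then a i else if i = j then 1 else 0)"
      if "i < Suc p" "j < Suc p" for i j
    proof (cases "i = p")
      case True
      then show ?thesis by (simp add: F_def G_def if_distrib[of "\<lambda>x. x * _"] cong: if_cong)
    next
      case False
      have "(\<Sum>k<p. F i k * G k j) = (\<Sum>k<p. if k = j then F i j else 0)"
        by (intro sum.cong refl) (auto simp: G_def)
      then show ?thesis using False that
        by (auto simp: F_def G_def less_Suc_eq)
    qed
    have "(\<Sum>k<Suc p. E i k * (\<Sum>l<Suc p. F k l * G l j)) = H i j"
      if ij: "i < Suc p" "j < Suc p" for i j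
    proof -
      have "(\<Sum>k<Suc p. E i k * (\<Sum>l<Suc p. F k l * G l j)) =
          (\<Sum>k<Suc p. E i k * (if k = p then (if j = p then 1 else - z j) else if j = p then a k else if k = j then 1 else 0))"
        by (intro sum.cong refl arg_cong2[where f = "(*)"] FG) (use ij in auto)
      also have "\<dots> = H i j"
      proof (cases "i = p")
        case True
        have "(\<Sum>k<p. z k * (if j = p then a k else if k = j then 1 else 0)) =
              (if j = p then (\<Sum>k<p. a k * z k) else z j)"
          using ij by (auto simp: mult.commute less_Suc_eq if_distrib[of "\<lambda>x. _ * x"] cong: if_cong)
        moreover have "(\<Sum>k<p. E p k * (if k = p then (if j = p then 1 else - z j) else if j = p then a k else if k = j then 1 else 0))
            = (\<Sum>k<p. z k * (if j = p then a k else if k = j then 1 else 0))"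
          by (intro sum.cong refl) (auto simp: E_def)
        ultimately show ?thesis using True by (auto simp: E_def H_def)
      next
        case False
        have "(\<Sum>k<p. E i k * (if k = p then (if j = p then 1 else - z j) else if j = p then a k else if k = j then 1 else 0))
            = (\<Sum>k<p. if k = i then (if j = p then a i else if i = j then 1 else 0) else 0)"
          by (intro sum.cong refl) (use False in \<open>auto simp: E_def\<close>)
        then show ?thesis using False ij by (simp add: E_def H_def)
      qed
      finally show ?thesis .
    qed
    then show ?thesis unfolding sq_mat_mult sq_mat_eq_iff by blast
  qed
  moreover have "sq_det (Suc p) E = 1" "sq_det (Suc p) G = 1"
  proof -
    have "prod_list (diag_mat (sq_mat (Suc p) E)) = 1" "prod_list (diag_mat (sq_mat (Suc p) G)) = 1"
      unfolding prod_list_diag_sq_mat by (simp_all add: E_def G_def)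
    then show "sq_det (Suc p) E = 1" "sq_det (Suc p) G = 1"
      using det_lower_triangular[OF _ sq_mat_carrier, of "Suc p" E]
        det_lower_triangular[OF _ sq_mat_carrier, of "Suc p" G]
      by (auto simp: sq_mat_def E_def G_def)
  qed
  moreover have "sq_det (Suc p) H = 1 + (\<Sum>i<p. a i * z i)"
  proof -
    have "upper_triangular (sq_mat (Suc p) H)" by (auto simp: sq_mat_def H_def)
    then have "sq_det (Suc p) H = prod_list (diag_mat (sq_mat (Suc p) H))"
      by (rule det_upper_triangular[OF _ sq_mat_carrier])
    also have "\<dots> = (\<Prod>i<Suc p. H i i)" by (rule prod_list_diag_sq_mat)
    also have "\<dots> = 1 + (\<Sum>i<p. a i * z i)" by (simp add: H_def)
    finally show ?thesis .
  qed
  moreover have "sq_det (Suc p) F =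
      sq_det p (\<lambda>i j. (if i = j then 1 else 0) + a i * z j)"
  proof -
    have "sq_mat (Suc p) F = four_block_mat (sq_mat p (\<lambda>i j. (if i = j then 1 else 0) + a i * z j))
        (Matrix.mat p 1 (\<lambda>(i, j). a i)) (0\<^sub>m 1 p) (1\<^sub>m 1)"
      by (rule eq_matI) (auto simp: sq_mat_def F_def less_Suc_eq)
    then show ?thesis
      using det_four_block_mat_lower_left_zero[of "sq_mat p (\<lambda>i j. (if i = j then 1 else 0) + a i * z j)" p
          "Matrix.mat p 1 (\<lambda>(i, j). a i)" 1 "0\<^sub>m 1 p" "1\<^sub>m 1"] by simp
  qed
  ultimately show ?thesis
    using Determinant.det_mult[of "sq_mat (Suc p) E" "Suc p" "sq_mat (Suc p) F * sq_mat (Suc p) G"]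
      Determinant.det_mult[of "sq_mat (Suc p) F" "Suc p" "sq_mat (Suc p) G"]
      mult_carrier_mat[of "sq_mat (Suc p) F" "Suc p" "Suc p" "sq_mat (Suc p) G" "Suc p"] by simp
qed

text \<open>For nonzero \<open>x i\<close> the diagonal matrix factors out. Both sides are
  continuous in \<open>x\<close>, which covers the remaining case; that case matters because the
  formula is later evaluated at eigenvalues, where one \<open>x i\<close> vanishes.\<close>

lemma det_diag_plus_rank_one:
  fixes x w z :: "nat \<Rightarrow> complex"
  shows "sq_det p (\<lambda>i j. (if i = j then x i else 0) + w i * z j) =
         (\<Prod>i<p. x i) + (\<Sum>i<p. w i * z i * (\<Prod>j\<in>{..<p} - {i}. x j))"
    (is "?D x = ?P x")
proof -
  have invertible: "?D x = ?P x" if x: "\<And>i. i < p \<Longrightarrow> x i \<noteq> 0" for x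
  proof -
    have "sq_mat p (\<lambda>i j. if i = j then x i else 0) *
          sq_mat p (\<lambda>i j. (if i = j then 1 else 0) + w i / x i * z j) =
          sq_mat p (\<lambda>i j. (if i = j then x i else 0) + w i * z j)"
      unfolding sq_mat_mult sq_mat_eq_iff
    proof (intro allI impI)
      fix i j assume i: "i < p" "j < p"
      have "(\<Sum>k<p. (if i = k then x i else 0) * ((if k = j then 1 else 0) + w k / x k * z j)) =
            (\<Sum>k<p. if k = i then x i * ((if i = j then 1 else 0) + w i / x i * z j) else 0)"
        by (intro sum.cong refl) auto
      then show "(\<Sum>k<p. (if i = k then x i else 0) * ((if k = j then 1 else 0) + w k / x k * z j)) =
            (if i = j then x i else 0) + w i * z j"
        using i x[OF i(1)] by (simp add: algebra_simps)
    qed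
    then have "?D x = sq_det p (\<lambda>i j. if i = j then x i else 0) *
        sq_det p (\<lambda>i j. (if i = j then 1 else 0) + w i / x i * z j)"
      using Determinant.det_mult[OF sq_mat_carrier sq_mat_carrier,
          of p "\<lambda>i j. if i = j then x i else 0" "\<lambda>i j. (if i = j then 1 else 0) + w i / x i * z j"]
      by (simp only:)
    also have "\<dots> = (\<Prod>i<p. x i) * (1 + (\<Sum>i<p. w i / x i * z i))"
      by (simp only: det_sq_mat_diag det_one_plus_rank_one)
    also have "\<dots> = (\<Prod>i<p. x i) + (\<Sum>i<p. (\<Prod>i<p. x i) * (w i / x i * z i))"
      by (simp add: distrib_left sum_distrib_left)
    also have "(\<Sum>i<p. (\<Prod>i<p. x i) * (w i / x i * z i)) = (\<Sum>i<p. w i * z i * (\<Prod>j\<in>{..<p} - {i}. x j))"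
    proof (intro sum.cong refl)
      fix i assume i: "i \<in> {..<p}"
      then have "(\<Prod>i<p. x i) = x i * (\<Prod>j\<in>{..<p} - {i}. x j)" by (intro prod.remove) auto
      then show "(\<Prod>i<p. x i) * (w i / x i * z i) = w i * z i * (\<Prod>j\<in>{..<p} - {i}. x j)"
        using x i by simp
    qed
    finally show ?thesis .
  qed
  \<comment> \<open>If \<open>x i = 0\<close> the perturbed entry is nonzero for all n, otherwise it
    is nonzero for large n because its limit is.\<close>
  define y where "y = (\<lambda>n i. x i + of_real (1 / real (Suc n)))"
  have y: "(\<lambda>n. y n i) \<longlonglongrightarrow> x i" for i
  proof -
    have "(\<lambda>n. x i + of_real (1 / real (Suc n))) \<longlonglongrightarrow> x i + of_real 0"
      by (intro tendsto_add tendsto_const tendsto_of_real LIMSEQ_Suc[OF lim_1_over_n])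
    then show ?thesis by (simp add: y_def)
  qed
  have "eventually (\<lambda>n. y n i \<noteq> 0) sequentially" for i
  proof (cases "x i = 0")
    case True
    then have "y n i \<noteq> 0" for n unfolding y_def by (simp flip: of_nat_Suc)
    then show ?thesis by simp
  next
    case False
    then show ?thesis by (rule tendsto_imp_eventually_ne[OF y])
  qed
  then have "eventually (\<lambda>n. \<forall>i\<in>{..<p}. y n i \<noteq> 0) sequentially"
    by (intro eventually_ball_finite) auto
  then have ev: "eventually (\<lambda>n. ?P (y n) = ?D (y n)) sequentially"
  proof eventually_elim
    case (elim n)
    then have "?D (y n) = ?P (y n)" by (intro invertible) auto
    then show ?case by (rule sym)
  qed
  have "(\<lambda>n. ?D (y n)) \<longlonglongrightarrow> ?D x"
    by (intro tendsto_det_sq_mat tendsto_intros) (auto intro!: tendsto_intros y)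
  moreover have "(\<lambda>n. ?P (y n)) \<longlonglongrightarrow> ?P x" by (intro tendsto_intros y)
  then have "(\<lambda>n. ?D (y n)) \<longlonglongrightarrow> ?P x" using ev by (rule Lim_transform_eventually)
  ultimately show ?thesis by (rule LIMSEQ_unique)
qed

lemma invertible_sq_mat:
  fixes f :: "nat \<Rightarrow> nat \<Rightarrow> complex"
  assumes "sq_det p f \<noteq> 0"
  shows "invertible_mat (sq_mat p f)"
proof -
  obtain u where "sq_mat p u * sq_mat p f = 1\<^sub>m p" "sq_mat p f * sq_mat p u = 1\<^sub>m p"
    using sq_mat_inverse[OF assms] by blast
  then show ?thesis
    unfolding invertible_mat_def inverts_mat_def square_mat.simps
    by (intro conjI exI[of _ "sq_mat p u"]) (simp_all add: sq_mat_def)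
qed

section \<open>The hypergeometric equation as a system\<close>

text \<open>A locale, since it is instantiated twice: with the parameters of the equation, and with
  negated and interchanged ones for the reflected equation.\<close>

locale hg_system =
  fixes p :: nat and \<alpha> \<beta> q :: "nat \<Rightarrow> complex"
  assumes p_pos: "p > 0"
    and expansion: "newton_basis \<beta> p = newton_basis \<alpha> p + (\<Sum>k<p. Polynomial.smult (q k) (newton_basis \<alpha> k))"
begin

abbreviation Y :: "(complex \<Rightarrow> complex) \<Rightarrow> nat \<Rightarrow> complex \<Rightarrow> complex" where
  "Y f k \<equiv> diff_op (newton_basis \<alpha> k) f"

abbreviation sol :: "complex set \<Rightarrow> (complex \<Rightarrow> complex) \<Rightarrow> bool" where
  "sol \<equiv> hg_solution p \<alpha> \<beta>"

text \<open>The companion system for the unknowns \<open>y\<^sub>k = (\<Prod>i<k. D + \<alpha> i) f\<close>: the equation reads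
  \<open>(exp t - 1) (\<Prod>i<p. D + \<alpha> i) f = (\<Sum>k<p. q k y\<^sub>k)\<close>.\<close>

definition C :: "nat \<Rightarrow> nat \<Rightarrow> complex \<Rightarrow> complex" where
  "C i j t = (if j = i then - \<alpha> i else 0) + (if j = Suc i then 1 else 0) +
     (if Suc i = p then q j / (exp t - 1) else 0)"

lemma sum_C:
  assumes "i < p"
  shows "(\<Sum>j<p. C i j t * y j) =
     (if Suc i = p then (\<Sum>j<p. q j * y j) / (exp t - 1) else y (Suc i)) - \<alpha> i * y i"
proof -
  have "(\<Sum>j<p. C i j t * y j) =
     (\<Sum>j<p. if j = i then - \<alpha> i * y i else 0) + (\<Sum>j<p. if j = Suc i then y (Suc i) else 0) +
     (\<Sum>j<p. if Suc i = p then q j * y j / (exp t - 1) else 0)"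
    unfolding sum.distrib[symmetric] by (intro sum.cong refl) (auto simp: C_def algebra_simps)
  also have "(\<Sum>j<p. if Suc i = p then q j * y j / (exp t - 1) else 0) =
             (if Suc i = p then (\<Sum>j<p. q j * y j) / (exp t - 1) else 0)"
    by (simp add: sum_divide_distrib)
  finally show ?thesis using assms by auto
qed

lemma C_holomorphic:
  assumes "\<And>t. t \<in> S \<Longrightarrow> exp t \<noteq> 1"
  shows "C i j holomorphic_on S"
  unfolding C_def[abs_def] using assms
  by (cases "Suc i = p") (auto intro!: holomorphic_intros)

lemma Y_Suc:
  "f holomorphic_on S \<Longrightarrow> open S \<Longrightarrow> t \<in> S \<Longrightarrow> Y f (Suc k) t = deriv (Y f k) t + \<alpha> k * Y f k t"
  unfolding newton_basis_Suc by (rule diff_op_linear_factor)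

lemma diff_op_expansion:
  "diff_op (newton_basis \<beta> p) f t = Y f p t + (\<Sum>k<p. q k * Y f k t)"
  unfolding expansion by (simp add: diff_op_add diff_op_sum diff_op_smult)

lemma sol_linear_system:
  assumes S: "open S" "\<And>t. t \<in> S \<Longrightarrow> exp t \<noteq> 1" and f: "sol S f"
  shows "linear_system p C S (Y f)"
  unfolding linear_system_def
proof (intro allI impI conjI ballI)
  have h: "f holomorphic_on S" using f by (simp add: hg_solution_def)
  fix i assume i: "i < p"
  show "Y f i holomorphic_on S" using h S by (intro diff_op_holomorphic)
  fix t assume t: "t \<in> S"
  have "exp t * Y f p t = Y f p t + (\<Sum>k<p. q k * Y f k t)"
    using f t by (simp add: hg_solution_def diff_op_expansion)
  then have "Y f p t = (\<Sum>k<p. q k * Y f k t) / (exp t - 1)"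
    using S(2)[OF t] by (simp add: field_simps)
  then show "deriv (Y f i) t = (\<Sum>j<p. C i j t * Y f j t)"
    unfolding sum_C[OF i] using Y_Suc[OF h S(1) t, of i] by (auto simp: eq_diff_eq)
qed

text \<open>All rows but the last force each component to be the next quasi-derivative of
  \<open>Z 0\<close>, by induction; the last row is then the equation itself.\<close>

lemma linear_system_sol:
  assumes S: "open S" "\<And>t. t \<in> S \<Longrightarrow> exp t \<noteq> 1" and Z: "linear_system p C S Z"
  shows "sol S (Z 0)" and "\<And>k t. k < p \<Longrightarrow> t \<in> S \<Longrightarrow> Y (Z 0) k t = Z k t"
proof -
  have h: "Z i holomorphic_on S" if "i < p" for i using Z that by (simp add: linear_system_def)
  note h0 = h[OF p_pos]
  have D: "deriv (Z i) t = (if Suc i = p then (\<Sum>j<p. q j * Z j t) / (exp t - 1) else Z (Suc i) t) - \<alpha> i * Z i t"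
    if "i < p" "t \<in> S" for i t
    using Z that sum_C[OF that(1), of t "\<lambda>j. Z j t"] by (simp add: linear_system_def)
  have step: "Y (Z 0) (Suc k) t = (if Suc k = p then (\<Sum>j<p. q j * Z j t) / (exp t - 1) else Z (Suc k) t)"
    if k: "k < p" and t: "t \<in> S" and IH: "\<And>t. t \<in> S \<Longrightarrow> Y (Z 0) k t = Z k t" for k t
  proof -
    have "deriv (Y (Z 0) k) t = deriv (Z k) t"
      by (rule complex_derivative_transform_within_open[OF _ h[OF k] S(1) t])
        (use IH h0 S in \<open>auto intro!: diff_op_holomorphic\<close>)
    then show ?thesis using Y_Suc[OF h0 S(1) t, of k] IH[OF t] D[OF k t] by simp
  qed
  have eq: "\<forall>t\<in>S. Y (Z 0) k t = Z k t" if "k < p" for k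
    using that
  proof (induction k)
    case (Suc k)
    then show ?case using step[of k] by auto
  qed simp
  then show "\<And>k t. k < p \<Longrightarrow> t \<in> S \<Longrightarrow> Y (Z 0) k t = Z k t" by blast
  have "exp t * Y (Z 0) p t = diff_op (newton_basis \<beta> p) (Z 0) t" if t: "t \<in> S" for t
  proof -
    obtain m where m: "p = Suc m" using p_pos by (cases p) auto
    have "Y (Z 0) p t = (\<Sum>j<p. q j * Z j t) / (exp t - 1)"
      using step[of m t] eq[of m] m t by auto
    also have "(\<Sum>j<p. q j * Z j t) = (\<Sum>j<p. q j * Y (Z 0) j t)"
      using eq t by simp
    finally show ?thesis
      using S(2)[OF t] by (simp add: diff_op_expansion field_simps)
  qed
  then show "sol S (Z 0)" using h0 by (simp add: hg_solution_def)
qed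

lemma sol_unique:
  assumes S: "open S" "connected S" "\<And>t. t \<in> S \<Longrightarrow> exp t \<noteq> 1" "t0 \<in> S"
    and f: "sol S f" "\<And>k. k < p \<Longrightarrow> Y f k t0 = 0" and t: "t \<in> S"
  shows "f t = 0"
  using linear_system_unique[OF S(1,2,4) C_holomorphic sol_linear_system[OF S(1) _ f(1)], of 0 t]
    S(3) f(2) p_pos t by simp

lemma sol_exists:
  assumes S: "open S" "simply_connected S" "S \<noteq> UNIV" "\<And>t. t \<in> S \<Longrightarrow> exp t \<noteq> 1" "t0 \<in> S"
  shows "\<exists>f. sol S f \<and> (\<forall>k<p. Y f k t0 = y0 k)"
proof -
  obtain Z where "linear_system p C S Z" "\<And>i. i < p \<Longrightarrow> Z i t0 = y0 i"
    using linear_system_exists[of S t0 p C y0] S C_holomorphic by blast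
  then show ?thesis using linear_system_sol[of S Z] S by (intro exI[of _ "Z 0"]) auto
qed

lemma Y_lincomb:
  assumes "open S" "t \<in> S" "\<And>i. i < p \<Longrightarrow> sol S (f i)"
  shows "Y (\<lambda>t. \<Sum>i<p. c i * f i t) k t = (\<Sum>i<p. c i * Y (f i) k t)"
  using assms by (intro diff_op_lincomb[of _ S]) (auto simp: hg_solution_def)

text \<open>A Wronskian argument: a linear relation among the initial vectors at \<open>t0\<close>
  gives a combination with zero initial data, which vanishes by uniqueness. The weights
  \<open>s k\<close> allow for rescaled coordinates.\<close>

lemma det_Y_nonzero:
  assumes S: "open S" "connected S" "\<And>t. t \<in> S \<Longrightarrow> exp t \<noteq> 1" "t0 \<in> S"
    and f: "\<And>i. i < p \<Longrightarrow> sol S (f i)"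
    and ind: "\<And>c. (\<And>t. t \<in> S \<Longrightarrow> (\<Sum>i<p. c i * f i t) = 0) \<Longrightarrow> \<forall>i<p. c i = 0"
    and s: "\<And>k. k < p \<Longrightarrow> s k \<noteq> 0"
  shows "sq_det p (\<lambda>i k. Y (f i) k t0 / s k) \<noteq> 0"
proof
  assume "sq_det p (\<lambda>i k. Y (f i) k t0 / s k) = 0"
  then obtain c i where c: "i < p" "c i \<noteq> 0" "\<And>k. k < p \<Longrightarrow> (\<Sum>i<p. c i * (Y (f i) k t0 / s k)) = 0"
    unfolding det_sq_mat_eq_0_iff by blast
  have "Y (\<lambda>t. \<Sum>i<p. c i * f i t) k t0 = 0" if "k < p" for k
  proof -
    have "Y (\<lambda>t. \<Sum>i<p. c i * f i t) k t0 = (\<Sum>i<p. c i * Y (f i) k t0)"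
      by (rule Y_lincomb[OF S(1,4)]) (rule f)
    then show ?thesis using c(3)[OF that] s[OF that] by (simp add: sum_divide_distrib[symmetric])
  qed
  moreover have "sol S (\<lambda>t. \<Sum>i<p. c i * f i t)"
    by (rule hg_solution_lincomb[OF S(1)]) (use f in auto)
  ultimately have "(\<Sum>i<p. c i * f i t) = 0" if "t \<in> S" for t
    using sol_unique[OF S _ _ that] by blast
  then show False using ind[of c] c by blast
qed

text \<open>Inverting the Wronskian matrix at a point of \<open>U\<close> gives coefficients that
  match the initial data of \<open>g\<close> there; uniqueness on \<open>U\<close> does the rest.
  \<open>U\<close> may be small, so that germs can be treated as well.\<close>

lemma sol_in_span:
  assumes S: "open S" "connected S" "\<And>t. t \<in> S \<Longrightarrow> exp t \<noteq> 1" "S \<noteq> {}"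
    and f: "\<And>i. i < p \<Longrightarrow> sol S (f i)"
    and ind: "\<And>c. (\<And>t. t \<in> S \<Longrightarrow> (\<Sum>i<p. c i * f i t) = 0) \<Longrightarrow> \<forall>i<p. c i = 0"
    and U: "open U" "connected U" "U \<noteq> {}" "U \<subseteq> S" and g: "sol U g"
  shows "\<exists>c. \<forall>t\<in>U. g t = (\<Sum>i<p. c i * f i t)"
proof -
  obtain t0 where t0: "t0 \<in> U" using U by blast
  then have t0S: "t0 \<in> S" using U by blast
  have "sq_det p (\<lambda>i k. Y (f i) k t0 / 1) \<noteq> 0"
    by (rule det_Y_nonzero[of S t0 f]) (use S t0S f ind in auto)
  then obtain u where u: "sq_mat p u * sq_mat p (\<lambda>i k. Y (f i) k t0) = 1\<^sub>m p"
    using sq_mat_inverse[of p "\<lambda>i k. Y (f i) k t0"] by auto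
  have u': "(\<Sum>l<p. u j l * Y (f l) k t0) = (if j = k then 1 else 0)" if "j < p" "k < p" for j k
    using u that unfolding sq_mat_mult_eq_one_iff by blast
  define c where "c = (\<lambda>l. \<Sum>j<p. Y g j t0 * u j l)"
  have fU: "sol U (f i)" if "i < p" for i using hg_solution_subset[OF f[OF that] U(4)] .
  \<comment> \<open>The difference written as a single linear combination, with index
    \<open>p\<close> standing for \<open>g\<close>.\<close>
  define h where "h = (\<lambda>t. \<Sum>i<Suc p. (if i = p then - 1 else c i) * (if i = p then g else f i) t)"
  have h_eq: "h t = (\<Sum>i<p. c i * f i t) - g t" for t by (simp add: h_def)
  have all: "sol U (if i = p then g else f i)" if "i \<in> {..<Suc p}" for i
    using that fU g by (auto simp: less_Suc_eq)
  have hs: "sol U h"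
    unfolding h_def by (rule hg_solution_lincomb[OF U(1) all]) auto
  have "Y h k t0 = 0" if k: "k < p" for k
  proof -
    have "Y h k t0 = (\<Sum>i<Suc p. (if i = p then - 1 else c i) * Y (if i = p then g else f i) k t0)"
      unfolding h_def using U(1) t0 all
      by (intro diff_op_lincomb[of _ U]) (auto simp: hg_solution_def)
    also have "\<dots> = (\<Sum>i<p. c i * Y (f i) k t0) - Y g k t0" by simp
    also have "(\<Sum>i<p. c i * Y (f i) k t0) = (\<Sum>j<p. Y g j t0 * (\<Sum>l<p. u j l * Y (f l) k t0))"
      unfolding c_def sum_distrib_right sum_distrib_left by (subst sum.swap) (simp add: mult.assoc)
    also have "\<dots> = (\<Sum>j<p. if j = k then Y g k t0 else 0)"
      by (intro sum.cong refl) (use u' k in auto)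
    finally show ?thesis using k by simp
  qed
  then have "h t = 0" if "t \<in> U" for t
    using sol_unique[OF U(1,2) _ t0 hs _ that] S(3) U(4) by blast
  then show ?thesis using h_eq by (intro exI[of _ c]) auto
qed

end

section \<open>The shift on the half-planes\<close>

lemma exp_bound_2pi:
  fixes c w :: complex
  assumes "norm w \<le> 2 * pi"
  shows "norm (exp (c * w)) \<le> exp (2 * pi * norm c)"
proof -
  have "Re (c * w) \<le> norm c * norm w" by (metis complex_Re_le_cmod norm_mult)
  also have "\<dots> \<le> norm c * (2 * pi)" using assms by (intro mult_left_mono) auto
  finally show ?thesis by (simp add: mult_ac)
qed

lemma norm_exp_of_real_minus_1:
  assumes "Re t = x" "x > 0"
  shows "norm (exp t - 1) \<ge> exp x - 1"
  using norm_triangle_ineq2[of "exp t" 1] assms by simp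

context hg_system
begin

text \<open>In the coordinates \<open>y\<^sub>k / \<delta>\<^sup>k\<close> the system along a vertical segment far to the right is a
  perturbation of size \<open>\<kappa>\<close> of the diagonal system \<open>y\<^sub>k' = - \<alpha>\<^sub>k y\<^sub>k\<close>. Comparing with the
  exact exponentials shows that its transition matrix over \<open>2 \<pi> \<i>\<close> is almost diagonal.\<close>

lemma transition_almost_diagonal:
  assumes "\<eta> > 0"
  shows "\<exists>t0 \<delta> :: real. t0 > 0 \<and> \<delta> > 0 \<and> (\<forall>g i. hg_solution p \<alpha> \<beta> {t. Re t > 0} g \<longrightarrow>
      (\<forall>k<p. Y g k (of_real t0) / of_real \<delta> ^ k = (if k = i then 1 else 0)) \<longrightarrow>
      (\<forall>k<p. norm (Y g k (of_real t0 + 2 * of_real pi * \<i>) / of_real \<delta> ^ k -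
                    (if k = i then exp (- (2 * of_real pi * \<i> * \<alpha> k)) else 0)) \<le> \<eta>))"
proof -
  \<comment> \<open>A common bound for \<open>exp (\<alpha> k * w)\<close> and its inverse along the
    segment.\<close>
  define K where "K = exp (2 * pi * (\<Sum>k<p. norm (\<alpha> k)))"
  have K1: "K \<ge> 1" unfolding K_def by (simp add: sum_nonneg)
  have K0: "K > 0" by (simp add: K_def)
  have K: "norm (exp (\<alpha> k * w)) \<le> K" "norm (exp (- \<alpha> k * w)) \<le> K"
    if "k < p" "norm w \<le> 2 * pi" for k w
  proof -
    have "exp (2 * pi * norm (\<alpha> k)) \<le> K"
      unfolding K_def using that(1) by (auto intro!: member_le_sum)
    then show "norm (exp (\<alpha> k * w)) \<le> K" "norm (exp (- \<alpha> k * w)) \<le> K"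
      using order.trans[OF exp_bound_2pi[OF that(2), of "\<alpha> k"]]
        order.trans[OF exp_bound_2pi[OF that(2), of "- \<alpha> k"]]
      by (simp_all del: norm_exp_eq_Re)
  qed
  \<comment> \<open>The first bound makes the feedback in \<open>M \<le> 1 + M / 2\<close> small
    enough, the second makes the final error at most \<open>\<eta>\<close>.\<close>
  define \<kappa> where "\<kappa> = min (1 / (4 * pi * real p * K ^ 2)) (\<eta> / (4 * pi * K ^ 3))"
  have \<kappa>0: "\<kappa> > 0" unfolding \<kappa>_def using assms K0 p_pos by auto
  have "\<kappa> \<le> 1 / (4 * pi * real p * K ^ 2)" by (simp add: \<kappa>_def)
  then have \<kappa>1: "real p * (\<kappa> * K ^ 2 * (2 * pi)) \<le> 1 / 2"
    using K0 p_pos by (simp add: field_simps)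
  have "\<kappa> \<le> \<eta> / (4 * pi * K ^ 3)" by (simp add: \<kappa>_def)
  then have \<kappa>2: "K * (\<kappa> * K ^ 2 * 2 * (2 * pi)) \<le> \<eta>"
    using K0 by (simp add: field_simps power2_eq_square power3_eq_cube)
  \<comment> \<open>Rescaling multiplies the superdiagonal entries 1 of the companion matrix by
    \<open>\<delta>\<close>.\<close>
  define \<delta> where "\<delta> = \<kappa>"
  have \<delta>0: "\<delta> > 0" using \<kappa>0 by (simp add: \<delta>_def)
  define L where "L = (\<Sum>j<p. norm (q j) * \<delta> ^ j) / \<delta> ^ (p - 1)"
  have L0: "L \<ge> 0" unfolding L_def using \<delta>0 by (auto intro!: divide_nonneg_pos sum_nonneg)
  \<comment> \<open>Chosen so that the last row, of size \<open>L / (exp t0 - 1)\<close> after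
    rescaling, is at most \<open>\<kappa>\<close>; the summand 1 keeps \<open>t0\<close> positive
    even if \<open>L = 0\<close>.\<close>
  define t0 where "t0 = ln (1 + (L + 1) / \<kappa>)"
  have pos: "(L + 1) / \<kappa> > 0" using L0 \<kappa>0 by (intro divide_pos_pos) linarith+
  have et0: "exp t0 = 1 + (L + 1) / \<kappa>"
    unfolding t0_def using pos by (subst exp_ln) linarith+
  have t0: "t0 > 0" unfolding t0_def using pos by (intro ln_gt_zero) linarith
  have et0': "exp t0 - 1 > 0" using et0 pos by simp
  have r: "L / (exp t0 - 1) \<le> \<kappa>"
    unfolding et0 using L0 \<kappa>0 by (simp add: field_simps)
  have "norm (Y g k (of_real t0 + 2 * of_real pi * \<i>) / of_real \<delta> ^ k -
                    (if k = i then exp (- (2 * of_real pi * \<i> * \<alpha> k)) else 0)) \<le> \<eta>"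
    if g: "hg_solution p \<alpha> \<beta> {t. Re t > 0} g"
      and init: "\<forall>k<p. Y g k (of_real t0) / of_real \<delta> ^ k = (if k = i then 1 else 0)"
      and k: "k < p" for g i k
  proof -
    define S where "S = {t :: complex. Re t > 0}"
    have S: "open S" unfolding S_def by (rule open_halfspace_Re_gt)
    have Sexp: "exp t \<noteq> 1" if "t \<in> S" for t
      using that norm_exp_of_real_minus_1[of t "Re t"] by (auto simp: S_def)
    have gS: "sol S g" using g by (simp add: S_def)
    have gh: "g holomorphic_on S" using gS by (simp add: hg_solution_def)
    have sys: "linear_system p C S (Y g)" by (rule sol_linear_system[OF S Sexp gS])
    define I where "I = closed_segment 0 (2 * of_real pi * \<i>)"
    have I: "Re w = 0" "norm w \<le> 2 * pi" if "w \<in> I" for w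
    proof -
      from that obtain u where u: "0 \<le> u" "u \<le> 1" "w = of_real u * (2 * of_real pi * \<i>)"
        unfolding I_def by (auto simp: in_segment scaleR_conv_of_real)
      then show "Re w = 0" "norm w \<le> 2 * pi" by (auto simp: norm_mult)
    qed
    have IS: "of_real t0 + w \<in> S" if "w \<in> I" for w
      using I(1)[OF that] t0 by (simp add: S_def)
    \<comment> \<open>Variation of constants: the exponential factor removes the diagonal terms
      \<open>- \<alpha> j\<close>, and \<open>E\<close> collects everything else in the rescaled
      system.\<close>
    define V where "V = (\<lambda>j w. exp (\<alpha> j * w) * (Y g j (of_real t0 + w) / of_real \<delta> ^ j))"
    define E where "E = (\<lambda>j w. (if Suc j = p then (\<Sum>l<p. q l * Y g l (of_real t0 + w)) / (exp (of_real t0 + w) - 1)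
        else Y g (Suc j) (of_real t0 + w)) / of_real \<delta> ^ j)"
    have dV: "(V j has_field_derivative exp (\<alpha> j * w) * E j w) (at w)" if j: "j < p" and w: "w \<in> I" for j w
    proof -
      define t where "t = of_real t0 + w"
      have t: "t \<in> S" using IS[OF w] by (simp add: t_def)
      have "deriv (Y g j) t = (\<Sum>l<p. C j l t * Y g l t)"
        using sys j t by (simp add: linear_system_def)
      then have D: "deriv (Y g j) t / of_real \<delta> ^ j = E j w - \<alpha> j * (Y g j t / of_real \<delta> ^ j)"
        unfolding sum_C[OF j] E_def t_def by (simp add: diff_divide_distrib)
      have "(Y g j has_field_derivative deriv (Y g j) t) (at t)"
        using diff_op_holomorphic[OF gh S] S t by (rule holomorphic_derivI)
      then have "((\<lambda>w. Y g j (of_real t0 + w)) has_field_derivative deriv (Y g j) t) (at w)"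
        unfolding t_def by (subst (asm) add.commute) (simp add: DERIV_shift add.commute)
      moreover have e: "((\<lambda>w. exp (\<alpha> j * w)) has_field_derivative exp (\<alpha> j * w) * \<alpha> j) (at w)"
        by (auto intro!: derivative_eq_intros)
      ultimately have "(V j has_field_derivative
           exp (\<alpha> j * w) * \<alpha> j * (Y g j t / of_real \<delta> ^ j) + exp (\<alpha> j * w) * (deriv (Y g j) t / of_real \<delta> ^ j)) (at w)"
        using DERIV_mult[OF e DERIV_cdivide] unfolding V_def t_def
        by (subst mult.commute[of "exp (\<alpha> j * w)" "deriv _ _ / _"]) blast
      also have "exp (\<alpha> j * w) * \<alpha> j * (Y g j t / of_real \<delta> ^ j) + exp (\<alpha> j * w) * (deriv (Y g j) t / of_real \<delta> ^ j)
           = exp (\<alpha> j * w) * E j w"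
        unfolding D by (simp add: algebra_simps)
      finally show ?thesis .
    qed
    have contV: "continuous_on I (\<lambda>w. \<Sum>j<p. norm (V j w))"
    proof (intro continuous_intros)
      fix j assume "j \<in> {..<p}"
      then have "\<And>w. w \<in> I \<Longrightarrow> isCont (V j) w" using dV DERIV_isCont by blast
      then show "continuous_on I (V j)" by (simp add: continuous_at_imp_continuous_on)
    qed
    have Icomp: "compact I" "I \<noteq> {}" by (auto simp: I_def)
    obtain w0 where w0: "w0 \<in> I" "\<And>w. w \<in> I \<Longrightarrow> (\<Sum>j<p. norm (V j w)) \<le> (\<Sum>j<p. norm (V j w0))"
      using continuous_attains_sup[OF Icomp contV] by blast
    \<comment> \<open>The maximum over the compact segment. The Lipschitz estimate
      \<open>lip\<close> is expressed through \<open>M\<close> itself, which gives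
      \<open>M \<le> 1 + M / 2\<close> and so \<open>M \<le> 2\<close>.\<close>
    define M where "M = (\<Sum>j<p. norm (V j w0))"
    have VM: "norm (V j w) \<le> M" if "j < p" "w \<in> I" for j w
    proof -
      have "norm (V j w) \<le> (\<Sum>j<p. norm (V j w))"
        using that(1) by (intro member_le_sum) auto
      then show ?thesis using w0(2)[OF that(2)] by (simp add: M_def)
    qed
    have M0: "M \<ge> 0" unfolding M_def by (intro sum_nonneg) auto
    have YM: "norm (Y g j (of_real t0 + w) / of_real \<delta> ^ j) \<le> K * M" if "j < p" "w \<in> I" for j w
    proof -
      have "Y g j (of_real t0 + w) / of_real \<delta> ^ j = exp (- \<alpha> j * w) * V j w"
        by (simp add: V_def exp_minus)
      then have "norm (Y g j (of_real t0 + w) / of_real \<delta> ^ j) = norm (exp (- \<alpha> j * w)) * norm (V j w)"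
        by (metis norm_mult)
      also have "\<dots> \<le> K * M"
        using K(2)[OF that(1) I(2)[OF that(2)]] VM[OF that] K0 by (intro mult_mono) auto
      finally show ?thesis .
    qed
    have EM: "norm (E j w) \<le> \<kappa> * (K * M)" if j: "j < p" and w: "w \<in> I" for j w
    proof (cases "Suc j = p")
      case False
      then have "E j w = of_real \<delta> * (Y g (Suc j) (of_real t0 + w) / of_real \<delta> ^ Suc j)"
        using \<delta>0 by (simp add: E_def)
      then have "norm (E j w) = \<delta> * norm (Y g (Suc j) (of_real t0 + w) / of_real \<delta> ^ Suc j)"
        using \<delta>0 by (metis abs_of_pos norm_mult norm_of_real)
      also have "\<dots> \<le> \<delta> * (K * M)"
        using \<delta>0 j w False by (intro mult_left_mono YM) auto
      finally show ?thesis by (simp add: \<delta>_def)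
    next
      case True
      have den: "norm (exp (of_real t0 + w) - 1) \<ge> exp t0 - 1"
        by (rule norm_exp_of_real_minus_1) (use I(1)[OF w] t0 in auto)
      have "norm (\<Sum>l<p. q l * Y g l (of_real t0 + w)) \<le> (\<Sum>l<p. norm (q l) * \<delta> ^ l * (K * M))"
      proof (rule sum_norm_le)
        fix l assume "l \<in> {..<p}"
        then have "norm (Y g l (of_real t0 + w) / of_real \<delta> ^ l) \<le> K * M" using YM w by auto
        then have "norm (Y g l (of_real t0 + w)) \<le> \<delta> ^ l * (K * M)"
          using \<delta>0 by (simp add: norm_divide norm_power field_simps)
        then show "norm (q l * Y g l (of_real t0 + w)) \<le> norm (q l) * \<delta> ^ l * (K * M)"
          by (simp add: norm_mult mult.assoc mult_left_mono)
      qed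
      also have "\<dots> = L * \<delta> ^ (p - 1) * (K * M)"
      proof -
        have "L * \<delta> ^ (p - 1) = (\<Sum>l<p. norm (q l) * \<delta> ^ l)" using \<delta>0 by (simp add: L_def)
        then show ?thesis by (simp add: sum_distrib_right)
      qed
      finally have num: "norm (\<Sum>l<p. q l * Y g l (of_real t0 + w)) \<le> L * \<delta> ^ (p - 1) * (K * M)" .
      have "norm (E j w) = norm (\<Sum>l<p. q l * Y g l (of_real t0 + w)) / norm (exp (of_real t0 + w) - 1) / \<delta> ^ (p - 1)"
        using True \<delta>0 by (auto simp: E_def norm_divide norm_mult norm_power)
      also have "\<dots> \<le> (L * \<delta> ^ (p - 1) * (K * M)) / (exp t0 - 1) / \<delta> ^ (p - 1)"
        using \<delta>0 L0 K0 M0 by (intro divide_right_mono frac_le num den et0') auto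
      also have "\<dots> = L / (exp t0 - 1) * (K * M)" using \<delta>0 by simp
      also have "\<dots> \<le> \<kappa> * (K * M)" using r K0 M0 by (intro mult_right_mono) auto
      finally show ?thesis .
    qed
    have lip: "norm (V j w - V j 0) \<le> \<kappa> * K ^ 2 * M * (2 * pi)" if j: "j < p" and w: "w \<in> I" for j w
    proof -
      have "norm (V j w - V j 0) \<le> (\<kappa> * K ^ 2 * M) * norm (w - 0)"
      proof (rule field_differentiable_bound[of I])
        fix z assume z: "z \<in> I"
        show "(V j has_field_derivative exp (\<alpha> j * z) * E j z) (at z within I)"
          using dV[OF j z] by (rule has_field_derivative_at_within)
        have "norm (exp (\<alpha> j * z) * E j z) \<le> K * (\<kappa> * (K * M))"
          unfolding norm_mult using K(1)[OF j I(2)[OF z]] EM[OF j z] K0 by (intro mult_mono) auto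
        then show "norm (exp (\<alpha> j * z) * E j z) \<le> \<kappa> * K ^ 2 * M" by (simp add: power2_eq_square mult_ac)
      qed (use w in \<open>auto simp: I_def\<close>)
      also have "\<dots> \<le> \<kappa> * K ^ 2 * M * (2 * pi)"
        using I(2)[OF w] \<kappa>0 M0 by (intro mult_left_mono) auto
      finally show ?thesis .
    qed
    have V0: "V j 0 = (if j = i then 1 else 0)" if "j < p" for j
      using init that by (simp add: V_def)
    have sumV0: "(\<Sum>j<p. norm (V j 0)) = (\<Sum>j<p. if j = i then 1 else 0)"
      by (intro sum.cong refl) (simp add: V0)
    have "M \<le> (\<Sum>j<p. norm (V j 0) + \<kappa> * K ^ 2 * M * (2 * pi))"
      unfolding M_def
    proof (rule sum_mono)
      fix j assume "j \<in> {..<p}"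
      then show "norm (V j w0) \<le> norm (V j 0) + \<kappa> * K ^ 2 * (\<Sum>j<p. norm (V j w0)) * (2 * pi)"
        using lip[of j w0] w0(1) norm_triangle_sub[of "V j w0" "V j 0"] by (simp add: M_def)
    qed
    also have "\<dots> = (\<Sum>j<p. if j = i then 1 else 0) + real p * (\<kappa> * K ^ 2 * (2 * pi)) * M"
      by (simp only: sum.distrib sumV0) (simp add: mult_ac)
    also have "\<dots> \<le> 1 + 1 / 2 * M"
      using \<kappa>1 M0 by (intro add_mono mult_right_mono) auto
    finally have M2: "M \<le> 2" by simp
    define W where "W = 2 * of_real pi * \<i>"
    have WI: "W \<in> I" by (simp add: W_def I_def)
    have "Y g k (of_real t0 + W) / of_real \<delta> ^ k - (if k = i then exp (- (W * \<alpha> k)) else 0) =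
          exp (- \<alpha> k * W) * (V k W - V k 0)"
      using V0[OF k] by (auto simp: V_def exp_minus algebra_simps)
    then have "norm (Y g k (of_real t0 + W) / of_real \<delta> ^ k - (if k = i then exp (- (W * \<alpha> k)) else 0)) =
          norm (exp (- \<alpha> k * W)) * norm (V k W - V k 0)"
      by (metis norm_mult)
    also have "\<dots> \<le> K * (\<kappa> * K ^ 2 * M * (2 * pi))"
      using K(2)[OF k I(2)[OF WI]] lip[OF k WI] K0 by (intro mult_mono) auto
    also have "\<dots> \<le> K * (\<kappa> * K ^ 2 * 2 * (2 * pi))"
      using K0 \<kappa>0 M2 by (intro mult_left_mono mult_right_mono) auto
    also have "\<dots> \<le> \<eta>" by (rule \<kappa>2)
    finally show ?thesis unfolding W_def .
  qed
  then show ?thesis using t0 \<delta>0 by blast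
qed

end

text \<open>Iterating the shift gives the relations with weights \<open>d i ^ n\<close>, hence with
  weights \<open>r (d i)\<close> for any polynomial \<open>r\<close>. The one that vanishes at every
  \<open>d i\<close> except \<open>d k\<close> isolates the term with index
  \<open>k\<close>.\<close>

lemma eigenfunctions_independent:
  fixes f :: "nat \<Rightarrow> complex \<Rightarrow> complex" and d :: "nat \<Rightarrow> complex"
  assumes S: "\<And>t. t \<in> S \<Longrightarrow> t + w \<in> S"
    and f: "\<And>i t. i < p \<Longrightarrow> t \<in> S \<Longrightarrow> f i (t + w) = d i * f i t"
    and nz: "\<And>i. i < p \<Longrightarrow> \<exists>t\<in>S. f i t \<noteq> 0"
    and d: "inj_on d {..<p}"
    and c: "\<And>t. t \<in> S \<Longrightarrow> (\<Sum>i<p. c i * f i t) = 0"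
  shows "\<forall>i<p. c i = 0"
proof (intro allI impI)
  fix k assume k: "k < p"
  have pow: "(\<Sum>i<p. c i * d i ^ n * f i t) = 0" if "t \<in> S" for n t
    using that
  proof (induction n arbitrary: t)
    case 0
    then show ?case using c by simp
  next
    case (Suc n)
    have "(\<Sum>i<p. c i * d i ^ n * f i (t + w)) = 0" using Suc S by blast
    then show ?case using Suc.prems f by (simp add: mult_ac)
  qed
  define r where "r = (\<Prod>j\<in>{..<p} - {k}. [:- d j, 1:])"
  have zero: "poly r (d i) = 0" if "i < p" "i \<noteq> k" for i
    using that unfolding r_def poly_prod by (intro prod_zero) auto
  have nonzero: "poly r (d k) \<noteq> 0"
    using d k by (auto simp: r_def poly_prod inj_on_def)
  obtain t where t: "t \<in> S" "f k t \<noteq> 0" using nz[OF k] by blast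
  have "(\<Sum>i<p. c i * poly r (d i) * f i t) = (\<Sum>i<p. \<Sum>n\<le>degree r. coeff r n * (c i * d i ^ n * f i t))"
    by (simp add: poly_altdef sum_distrib_left sum_distrib_right mult_ac)
  also have "\<dots> = (\<Sum>n\<le>degree r. coeff r n * (\<Sum>i<p. c i * d i ^ n * f i t))"
    by (subst sum.swap) (simp add: sum_distrib_left)
  also have "\<dots> = 0" using pow[OF t(1)] by simp
  finally have "(\<Sum>i<p. c i * poly r (d i) * f i t) = 0" .
  moreover have "(\<Sum>i<p. c i * poly r (d i) * f i t) = (\<Sum>i\<in>{k}. c i * poly r (d i) * f i t)"
    using k zero by (intro sum.mono_neutral_right) auto
  ultimately show "c k = 0" using nonzero t by simp
qed

context hg_system
begin

text \<open>The determinant is the same for all the conjugates \<open>P n\<close>, while these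
  converge to the diagonal matrix \<open>D\<close>. Passing to the limit by continuity also covers
  coinciding eigenvalues.\<close>

lemma det_shift_matrix:
  assumes G: "\<And>i. i < p \<Longrightarrow> sol {t. Re t > 0} (G i)"
    and ind: "\<And>c. (\<And>t. Re t > 0 \<Longrightarrow> (\<Sum>i<p. c i * G i t) = 0) \<Longrightarrow> \<forall>i<p. c i = 0"
    and T: "\<And>i t. i < p \<Longrightarrow> Re t > 0 \<Longrightarrow> G i (t + 2 * of_real pi * \<i>) = (\<Sum>j<p. T i j * G j t)"
  shows "sq_det p (\<lambda>i j. (if i = j then \<mu> else 0) - T i j) =
         (\<Prod>k<p. \<mu> - exp (- (2 * of_real pi * \<i> * \<alpha> k)))"
proof -
  define S where "S = {t :: complex. Re t > 0}"
  define w where "w = 2 * of_real pi * \<i>"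
  define D where "D = (\<lambda>i k. if k = i then exp (- (w * \<alpha> k)) else 0)"
  define X where "X = (\<lambda>i j. (if i = j then \<mu> else 0) - T i j)"
  have S: "open S" "connected S" unfolding S_def
    by (rule open_halfspace_Re_gt) (rule convex_connected[OF convex_halfspace_Re_gt])
  have Sexp: "exp t \<noteq> 1" if "t \<in> S" for t
    using that norm_exp_of_real_minus_1[of t "Re t"] by (auto simp: S_def)
  have wS: "t + w \<in> S" if "t \<in> S" for t using that by (simp add: S_def w_def)
  have GS: "sol S (G i)" if "i < p" for i using G[OF that] by (simp add: S_def)
  have Y_shift: "Y (G l) k (t + w) = (\<Sum>j<p. T l j * Y (G j) k t)" if "l < p" "t \<in> S" for l k t
  proof -
    have "Y (G l) k (t + w) = Y (\<lambda>t. G l (t + w)) k t" by (simp add: diff_op_shift)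
    also have "\<dots> = Y (\<lambda>t. \<Sum>j<p. T l j * G j t) k t"
      by (rule diff_op_cong_open[OF S(1) that(2)]) (use T that in \<open>auto simp: S_def w_def\<close>)
    also have "\<dots> = (\<Sum>j<p. T l j * Y (G j) k t)"
      by (rule Y_lincomb[OF S(1) that(2)]) (rule GS)
    finally show ?thesis .
  qed
  define near_D where "near_D = (\<lambda>(n :: nat) P.
     sq_det p (\<lambda>i k. (if i = k then \<mu> else 0) - P i k) = sq_det p X \<and>
     (\<forall>i<p. \<forall>k<p. norm (P i k - D i k) \<le> 1 / real (Suc n)))"
  have "\<exists>P. near_D n P" for n
  proof -
    obtain t0 \<delta> :: real where t0: "t0 > 0" "\<delta> > 0" and
      near: "\<And>g i k. sol S g \<Longrightarrow> (\<And>k. k < p \<Longrightarrow> Y g k (of_real t0) / of_real \<delta> ^ k = (if k = i then 1 else 0)) \<Longrightarrow>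
        k < p \<Longrightarrow> norm (Y g k (of_real t0 + w) / of_real \<delta> ^ k - D i k) \<le> 1 / real (Suc n)"
      using transition_almost_diagonal[of "1 / real (Suc n)"] unfolding S_def[symmetric] w_def[symmetric] D_def
      by auto
    have t0S: "of_real t0 \<in> S" using t0 by (simp add: S_def)
    \<comment> \<open>Rescaled initial data of the given basis. The rows of its inverse
      \<open>u\<close> describe the solutions with unit initial data at \<open>t0\<close>, and in
      that basis the shift is \<open>P = u * T * W\<close>.\<close>
    define W where "W = (\<lambda>i k. Y (G i) k (of_real t0) / of_real \<delta> ^ k)"
    have "sq_det p W \<noteq> 0"
      unfolding W_def
    proof (rule det_Y_nonzero[OF S Sexp t0S GS])
      show "\<forall>i<p. c i = 0" if "\<And>t. t \<in> S \<Longrightarrow> (\<Sum>i<p. c i * G i t) = 0" for c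
        using that by (intro ind) (simp add: S_def)
    qed (use t0 in auto)
    then obtain u where u: "sq_mat p u * sq_mat p W = 1\<^sub>m p" using sq_mat_inverse by blast
    then have u': "(\<Sum>l<p. u i l * W l k) = (if i = k then 1 else 0)" if "i < p" "k < p" for i k
      using that unfolding sq_mat_mult_eq_one_iff by blast
    define P where "P = (\<lambda>i k. \<Sum>l<p. u i l * (Y (G l) k (of_real t0 + w) / of_real \<delta> ^ k))"
    have P_eq: "P i k = (\<Sum>l<p. u i l * (\<Sum>m<p. T l m * W m k))" for i k
      unfolding P_def W_def using Y_shift[OF _ t0S]
      by (intro sum.cong refl arg_cong2[where f = "(*)"]) (simp add: sum_divide_distrib)
    have "sq_mat p u * sq_mat p X * sq_mat p W = sq_mat p (\<lambda>i k. (if i = k then \<mu> else 0) - P i k)"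
      unfolding sq_mat_mult sq_mat_eq_iff
    proof (intro allI impI)
      fix i k assume ik: "i < p" "k < p"
      have "(\<Sum>m<p. (\<Sum>l<p. u i l * X l m) * W m k) =
            (\<Sum>m<p. \<mu> * (u i m * W m k) - (\<Sum>l<p. u i l * (T l m * W m k)))"
      proof (intro sum.cong refl)
        fix m assume "m \<in> {..<p}"
        then have "(\<Sum>l<p. u i l * X l m) = (\<Sum>l<p. (if l = m then u i m * \<mu> else 0) - u i l * T l m)"
          by (intro sum.cong refl) (auto simp: X_def algebra_simps)
        also have "\<dots> = u i m * \<mu> - (\<Sum>l<p. u i l * T l m)"
          using \<open>m \<in> {..<p}\<close> by (simp add: sum_subtractf)
        finally have *: "(\<Sum>l<p. u i l * X l m) = u i m * \<mu> - (\<Sum>l<p. u i l * T l m)" .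
        show "(\<Sum>l<p. u i l * X l m) * W m k = \<mu> * (u i m * W m k) - (\<Sum>l<p. u i l * (T l m * W m k))"
          unfolding * left_diff_distrib sum_distrib_right by (simp only: mult_ac)
      qed
      also have "\<dots> = \<mu> * (\<Sum>m<p. u i m * W m k) - P i k"
      proof -
        have "(\<Sum>m<p. \<Sum>l<p. u i l * (T l m * W m k)) = P i k"
          unfolding P_eq sum_distrib_left by (rule sum.swap)
        then show ?thesis by (simp add: sum_subtractf sum_distrib_left)
      qed
      finally show "(\<Sum>m<p. (\<Sum>l<p. u i l * X l m) * W m k) = (if i = k then \<mu> else 0) - P i k"
        using u'[OF ik] by simp
    qed
    then have "sq_det p (\<lambda>i k. (if i = k then \<mu> else 0) - P i k) =
        sq_det p u * sq_det p X * sq_det p W"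
      using Determinant.det_mult[of "sq_mat p u * sq_mat p X" p "sq_mat p W"]
        Determinant.det_mult[of "sq_mat p u" p "sq_mat p X"]
        mult_carrier_mat[of "sq_mat p u" p p "sq_mat p X" p] by simp
    moreover have "sq_det p u * sq_det p W = 1"
      using Determinant.det_mult[OF sq_mat_carrier sq_mat_carrier, of p u W] u by simp
    moreover have "sq_det p u * sq_det p X * sq_det p W =
        (sq_det p u * sq_det p W) * sq_det p X"
      by (simp only: mult_ac)
    ultimately have "sq_det p (\<lambda>i k. (if i = k then \<mu> else 0) - P i k) = sq_det p X"
      by simp
    moreover have "norm (P i k - D i k) \<le> 1 / real (Suc n)" if "i < p" "k < p" for i k
    proof -
      define g where "g = (\<lambda>t. \<Sum>l<p. u i l * G l t)"
      have gs: "sol S g" unfolding g_def by (rule hg_solution_lincomb[OF S(1)]) (use GS in auto)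
      have Yg: "Y g k t / of_real \<delta> ^ k = (\<Sum>l<p. u i l * (Y (G l) k t / of_real \<delta> ^ k))" if "t \<in> S" for k t
      proof -
        have "Y g k t = (\<Sum>l<p. u i l * Y (G l) k t)"
          unfolding g_def by (rule Y_lincomb[OF S(1) that]) (rule GS)
        then show ?thesis by (simp add: sum_divide_distrib)
      qed
      have "P i k = Y g k (of_real t0 + w) / of_real \<delta> ^ k"
        using Yg[OF wS[OF t0S]] by (simp add: P_def)
      moreover have "norm (Y g k (of_real t0 + w) / of_real \<delta> ^ k - D i k) \<le> 1 / real (Suc n)"
        using u' that(1) Yg[OF t0S] by (intro near gs that(2)) (auto simp: W_def)
      ultimately show ?thesis by simp
    qed
    ultimately show ?thesis unfolding near_D_def by blast
  qed
  then have "\<exists>P. \<forall>n. near_D n (P n)" by (intro choice allI)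
  then obtain P where "\<forall>n. near_D n (P n)" ..
  then have P: "\<And>n. sq_det p (\<lambda>i k. (if i = k then \<mu> else 0) - P n i k) = sq_det p X"
    "\<And>n i k. i < p \<Longrightarrow> k < p \<Longrightarrow> norm (P n i k - D i k) \<le> 1 / real (Suc n)"
    unfolding near_D_def by blast+
  have "(\<lambda>n. P n i k) \<longlonglongrightarrow> D i k" if "i < p" "k < p" for i k
  proof -
    have "(\<lambda>n. P n i k - D i k) \<longlonglongrightarrow> 0"
      by (rule Lim_null_comparison[OF _ lim_1_over_n[THEN LIMSEQ_Suc]])
        (use P(2)[OF that] in auto)
    then show ?thesis by (rule LIM_zero_cancel)
  qed
  then have "(\<lambda>n. sq_det p (\<lambda>i k. (if i = k then \<mu> else 0) - P n i k)) \<longlonglongrightarrow>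
         sq_det p (\<lambda>i k. (if i = k then \<mu> else 0) - D i k)"
    by (intro tendsto_det_sq_mat tendsto_intros)
  then have "sq_det p X = sq_det p (\<lambda>i k. (if i = k then \<mu> else 0) - D i k)"
    unfolding P(1) by (simp add: LIMSEQ_const_iff)
  also have "sq_mat p (\<lambda>i k. (if i = k then \<mu> else 0) - D i k) =
             sq_mat p (\<lambda>i k. if i = k then \<mu> - exp (- (w * \<alpha> i)) else 0)"
    by (rule sq_mat_cong) (auto simp: D_def)
  finally show ?thesis by (simp add: det_sq_mat_diag X_def w_def)
qed

text \<open>The number is a root of the characteristic polynomial, and a left kernel vector of
  \<open>\<mu> - T\<close> gives the coefficients of an eigenfunction. If exponents coincide modulo
  the integers, different \<open>k\<close> may yield the same function.\<close>

lemma right_eigenfunction: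
  assumes k: "k < p"
  shows "\<exists>g. sol {t. Re t > 0} g \<and> (\<exists>t. Re t > 0 \<and> g t \<noteq> 0) \<and>
     (\<forall>t. Re t > 0 \<longrightarrow> g (t + 2 * of_real pi * \<i>) = exp (- (2 * of_real pi * \<i> * \<alpha> k)) * g t)"
proof -
  define S where "S = {t :: complex. Re t > 0}"
  define w where "w = 2 * of_real pi * \<i>"
  define \<mu> where "\<mu> = exp (- (w * \<alpha> k))"
  have S: "open S" "connected S" "simply_connected S" "S \<noteq> {}" "S \<noteq> UNIV"
  proof -
    have "convex S" unfolding S_def by (rule convex_halfspace_Re_gt)
    then show "connected S" "simply_connected S"
      by (simp_all add: convex_connected convex_imp_simply_connected)
    have "1 \<in> S" "- 1 \<notin> S" by (auto simp: S_def)
    then show "S \<noteq> {}" "S \<noteq> UNIV" by blast+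
  qed (simp add: S_def open_halfspace_Re_gt)
  have one: "1 \<in> S" by (simp add: S_def)
  have Sexp: "exp t \<noteq> 1" if "t \<in> S" for t
    using that norm_exp_of_real_minus_1[of t "Re t"] by (auto simp: S_def)
  have "\<exists>f. sol S f \<and> (\<forall>k<p. Y f k 1 = (if k = i then 1 else 0))" for i
    by (rule sol_exists) (use S Sexp one in auto)
  then obtain G where G: "\<And>i. sol S (G i)" "\<And>i k. k < p \<Longrightarrow> Y (G i) k 1 = (if k = i then 1 else 0)"
    by metis
  have ind: "\<forall>i<p. c i = 0" if c: "\<And>t. t \<in> S \<Longrightarrow> (\<Sum>i<p. c i * G i t) = 0" for c
  proof (intro allI impI)
    fix k assume k: "k < p"
    have "Y (\<lambda>t. \<Sum>i<p. c i * G i t) k 1 = Y (\<lambda>t. 0) k 1"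
      by (rule diff_op_cong_open[OF S(1) one]) (use c in auto)
    moreover have "Y (\<lambda>t. 0) k 1 = 0" by (simp add: diff_op_def higher_deriv_const)
    moreover have "Y (\<lambda>t. \<Sum>i<p. c i * G i t) k 1 = (\<Sum>i<p. c i * Y (G i) k 1)"
      by (rule Y_lincomb[OF S(1) one]) (rule G)
    moreover have "(\<Sum>i<p. c i * Y (G i) k 1) = (\<Sum>i<p. if i = k then c k else 0)"
      by (intro sum.cong refl) (simp add: G(2)[OF k])
    ultimately show "c k = 0" using k by simp
  qed
  have "\<exists>c. \<forall>t\<in>S. G i (t + w) = (\<Sum>j<p. c j * G j t)" for i
  proof -
    have "sol {t. t + w \<in> S} (\<lambda>t. G i (t + w))"
      by (rule hg_solution_shift[OF G(1)]) (simp add: w_def exp_two_pi_i')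
    moreover have "{t. t + w \<in> S} = S" by (simp add: S_def w_def)
    ultimately have "sol S (\<lambda>t. G i (t + w))" by simp
    note shifted = this
    show ?thesis
    proof (rule sol_in_span[of S G S])
      show "\<forall>i<p. c i = 0" if "\<And>t. t \<in> S \<Longrightarrow> (\<Sum>i<p. c i * G i t) = 0" for c
        using that by (rule ind)
    qed (use S Sexp G(1) shifted in auto)
  qed
  then have "\<forall>i. \<exists>c. \<forall>t\<in>S. G i (t + w) = (\<Sum>j<p. c j * G j t)" ..
  then have "\<exists>T. \<forall>i. \<forall>t\<in>S. G i (t + w) = (\<Sum>j<p. T i j * G j t)" by (rule choice)
  then obtain T where T: "\<And>i t. t \<in> S \<Longrightarrow> G i (t + w) = (\<Sum>j<p. T i j * G j t)"
    by blast
  have "sq_det p (\<lambda>i j. (if i = j then \<mu> else 0) - T i j) =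
         (\<Prod>k<p. \<mu> - exp (- (2 * of_real pi * \<i> * \<alpha> k)))"
  proof (rule det_shift_matrix)
    show "sol {t. Re t > 0} (G i)" for i using G(1) by (simp add: S_def)
    show "\<forall>i<p. c i = 0" if "\<And>t. Re t > 0 \<Longrightarrow> (\<Sum>i<p. c i * G i t) = 0" for c
      using that by (intro ind) (simp add: S_def)
  qed (use T in \<open>simp add: S_def w_def\<close>)
  also have "\<dots> = 0" using k by (intro prod_zero) (auto simp: \<mu>_def w_def)
  finally obtain c i where c: "i < p" "c i \<noteq> 0" "\<And>j. j < p \<Longrightarrow> (\<Sum>i<p. c i * ((if i = j then \<mu> else 0) - T i j)) = 0"
    unfolding det_sq_mat_eq_0_iff by blast
  have cT: "(\<Sum>i<p. c i * T i j) = \<mu> * c j" if "j < p" for j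
  proof -
    have "(\<Sum>i<p. c i * ((if i = j then \<mu> else 0) - T i j)) =
          (\<Sum>i<p. (if i = j then c j * \<mu> else 0) - c i * T i j)"
      by (intro sum.cong refl) (auto simp: algebra_simps)
    also have "\<dots> = c j * \<mu> - (\<Sum>i<p. c i * T i j)" using that by (simp add: sum_subtractf)
    finally show ?thesis using c(3)[OF that] by (simp add: mult.commute)
  qed
  define g where "g = (\<lambda>t. \<Sum>i<p. c i * G i t)"
  have "g (t + w) = \<mu> * g t" if "t \<in> S" for t
  proof -
    have "g (t + w) = (\<Sum>j<p. (\<Sum>i<p. c i * T i j) * G j t)"
      unfolding g_def T[OF that] sum_distrib_left sum_distrib_right by (subst sum.swap) (simp add: mult.assoc)
    also have "\<dots> = \<mu> * g t" by (simp add: cT g_def sum_distrib_left mult.assoc)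
    finally show ?thesis .
  qed
  moreover have "sol S g" unfolding g_def by (rule hg_solution_lincomb[OF S(1)]) (use G in auto)
  moreover have "\<exists>t\<in>S. g t \<noteq> 0" using ind[of c] c(1,2) by (auto simp: g_def)
  ultimately show ?thesis by (intro exI[of _ g]) (auto simp: S_def w_def \<mu>_def)
qed

end

text \<open>Obtained from the reflected equation on the right half-plane. Reflection reverses the
  direction of the shift, which compensates the negated exponent.\<close>

lemma left_eigenfunction:
  assumes k: "k < p"
  shows "\<exists>f. hg_solution p \<alpha> \<beta> {t. Re t < 0} f \<and> (\<exists>t. Re t < 0 \<and> f t \<noteq> 0) \<and>
     (\<forall>t. Re t < 0 \<longrightarrow> f (t + 2 * of_real pi * \<i>) = exp (- (2 * of_real pi * \<i> * \<beta> k)) * f t)"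
proof -
  have p: "p > 0" using k by simp
  obtain q where q: "newton_basis (\<lambda>i. - \<alpha> i) p = newton_basis (\<lambda>i. - \<beta> i) p +
      (\<Sum>k<p. Polynomial.smult (q k) (newton_basis (\<lambda>i. - \<beta> i) k))"
    using newton_basis_change[OF p] by blast
  interpret R: hg_system p "\<lambda>i. - \<beta> i" "\<lambda>i. - \<alpha> i" q
    by (rule hg_system.intro[OF p q])
  obtain g where g: "R.sol {t. Re t > 0} g" "\<exists>t. Re t > 0 \<and> g t \<noteq> 0"
    "\<And>t. Re t > 0 \<Longrightarrow> g (t + 2 * of_real pi * \<i>) = exp (2 * of_real pi * \<i> * \<beta> k) * g t"
    using R.right_eigenfunction[OF k] by auto
  define f where "f = (\<lambda>t. g (- t))"
  have "hg_solution p \<alpha> \<beta> (uminus ` {t. Re t > 0}) f"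
    unfolding f_def by (rule hg_solution_reflect[OF g(1) open_halfspace_Re_gt])
  moreover have "uminus ` {t. Re t > 0} = {t :: complex. Re t < 0}"
  proof (intro equalityI subsetI)
    fix t :: complex assume "t \<in> {t. Re t < 0}"
    then show "t \<in> uminus ` {t. Re t > 0}" by (intro image_eqI[of _ _ "- t"]) auto
  qed auto
  ultimately have "hg_solution p \<alpha> \<beta> {t. Re t < 0} f" by simp
  moreover have "\<exists>t. Re t < 0 \<and> f t \<noteq> 0"
  proof -
    obtain t where "Re t > 0" "g t \<noteq> 0" using g(2) by blast
    then show ?thesis by (intro exI[of _ "- t"]) (auto simp: f_def)
  qed
  moreover have "f (t + 2 * of_real pi * \<i>) = exp (- (2 * of_real pi * \<i> * \<beta> k)) * f t" if "Re t < 0" for t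
  proof -
    have "g (- t) = exp (2 * of_real pi * \<i> * \<beta> k) * g (- t - 2 * of_real pi * \<i>)"
      using g(3)[of "- t - 2 * of_real pi * \<i>"] that by simp
    then show ?thesis by (simp add: f_def exp_minus)
  qed
  ultimately show ?thesis by blast
qed

section \<open>Continuation through the windows\<close>

text \<open>The plane cut along the imaginary axis except for one open gap of length 2 pi. For
  \<open>c = 2 * n * pi\<close> the gap lies between two neighbouring singularities, so the two
  half-planes are joined by exactly one passage.\<close>

definition window :: "real \<Rightarrow> complex set" where
  "window c = {t. Re t \<noteq> 0 \<or> c < Im t \<and> Im t < c + 2 * pi}"

lemma open_window: "open (window c)"
proof -
  have "window c = {t. Re t < 0} \<union> {t. Re t > 0} \<union> ({t. c < Im t} \<inter> {t. Im t < c + 2 * pi})"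
    by (auto simp: window_def)
  then show ?thesis
    by (simp only:) (intro open_Un open_Int open_halfspace_Re_lt open_halfspace_Re_gt
        open_halfspace_Im_lt open_halfspace_Im_gt)
qed

lemma window_segment:
  assumes "t \<in> window c"
  shows "closed_segment (Complex 0 (c + pi)) t \<subseteq> window c"
proof
  fix s assume "s \<in> closed_segment (Complex 0 (c + pi)) t"
  then obtain u where u: "0 \<le> u" "u \<le> 1" "s = (1 - u) *\<^sub>R Complex 0 (c + pi) + u *\<^sub>R t"
    by (auto simp: in_segment)
  then have Re: "Re s = u * Re t" and Im: "Im s = (1 - u) * (c + pi) + u * Im t" by auto
  show "s \<in> window c"
  proof (cases "Re t = 0 \<or> u = 0")
    case False
    then show ?thesis using Re by (simp add: window_def)
  next
    case True
    \<comment> \<open>For \<open>u = 0\<close> nothing is known about \<open>Im t\<close>, so the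
      centre of the gap takes its place.\<close>
    define y where "y = (if u = 0 then c + pi else Im t)"
    have y: "c < y" "y < c + 2 * pi" using True assms by (auto simp: y_def window_def)
    have "Im s = (1 - u) * (c + pi) + u * y" using Im by (simp add: y_def)
    moreover have "(1 - u) * (c + pi) + u * y > (1 - u) * c + u * c"
    proof (cases "u = 0")
      case False
      then show ?thesis using u y by (intro add_le_less_mono mult_left_mono mult_strict_left_mono) auto
    qed simp
    moreover have "(1 - u) * (c + pi) + u * y < (1 - u) * (c + 2 * pi) + u * (c + 2 * pi)"
    proof (cases "u = 0")
      case False
      then show ?thesis using u y by (intro add_le_less_mono mult_left_mono mult_strict_left_mono) auto
    qed simp
    ultimately show ?thesis by (simp add: window_def algebra_simps)
  qed
qed

text \<open>For \<open>B\<close> a disc around the pole this provides connected sets on which a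
  continuation through the window can be compared with solutions holomorphic at the pole.\<close>

lemma starlike_window_Int:
  assumes "convex B" "Complex 0 (c + pi) \<in> B"
  shows "starlike (window c \<inter> B)"
  unfolding starlike_def
proof (intro bexI[of _ "Complex 0 (c + pi)"] ballI)
  fix t assume "t \<in> window c \<inter> B"
  then show "closed_segment (Complex 0 (c + pi)) t \<subseteq> window c \<inter> B"
    using window_segment assms closed_segment_subset by blast
qed (use assms in \<open>simp add: window_def\<close>)

lemma starlike_window: "starlike (window c)"
  using starlike_window_Int[OF convex_UNIV UNIV_I, of c] by (simp only: Int_UNIV_right)

lemma window_neq_UNIV: "window c \<noteq> UNIV"
proof -
  have "Complex 0 c \<notin> window c" by (simp add: window_def)
  then show ?thesis by blast
qed

lemma exp_neq_1_window:
  assumes "t \<in> window (2 * of_int n * pi)"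
  shows "exp t \<noteq> 1"
proof
  assume "exp t = 1"
  then obtain k :: int where k: "Re t = 0" "Im t = of_int (2 * k) * pi"
    by (auto simp: exp_eq_1)
  then have "2 * of_int n * pi < of_int (2 * k) * pi" "of_int (2 * k) * pi < 2 * of_int n * pi + 2 * pi"
    using assms by (auto simp: window_def)
  then have "(of_int n :: real) < of_int k" "(of_int k :: real) < of_int n + 1"
    by (simp_all add: distrib_right[symmetric] flip: distrib_left)
  then have "n < k" "k < n + 1" by linarith+
  then show False by simp
qed

lemma exp_neq_1_ball:
  assumes "t \<in> ball 0 (2 * pi)" "t \<noteq> 0"
  shows "exp t \<noteq> (1 :: complex)"
proof
  assume "exp t = 1"
  then obtain k :: int where k: "Re t = 0" "Im t = of_int (2 * k) * pi"
    by (auto simp: exp_eq_1)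
  have "\<bar>Im t\<bar> < 2 * pi" using assms(1) abs_Im_le_cmod[of t] by simp
  then have "\<bar>of_int k :: real\<bar> < 1" unfolding k by (simp add: abs_mult)
  then have "k = 0" by linarith
  then show False using k assms(2) by (simp add: complex_eq_iff)
qed

context hg_system
begin

lemma sol_eqI:
  assumes S: "open S" "connected S" "\<And>t. t \<in> S \<Longrightarrow> exp t \<noteq> 1" "t0 \<in> S"
    and f: "sol S f" and g: "sol S g" and eq: "\<And>k. k < p \<Longrightarrow> Y f k t0 = Y g k t0" and t: "t \<in> S"
  shows "f t = g t"
proof -
  define F where "F = (\<lambda>j :: nat. if j = 0 then f else g)"
  define h where "h = (\<lambda>t. \<Sum>j\<in>{..<2}. (if j = 0 then 1 else - 1) * F j t)"
  have FS: "sol S (F j)" for j using f g by (simp add: F_def)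
  have two: "{..<2} = {0, 1 :: nat}" by auto
  have h: "sol S h" unfolding h_def by (rule hg_solution_lincomb[OF S(1)]) (use FS in auto)
  have "Y h k t0 = (\<Sum>j\<in>{..<2}. (if j = 0 then 1 else - 1) * Y (F j) k t0)" for k
    unfolding h_def by (rule diff_op_lincomb[of _ S]) (use FS S in \<open>auto simp: hg_solution_def\<close>)
  then have "Y h k t0 = 0" if "k < p" for k using eq[OF that] by (simp add: two F_def)
  then have "h t = 0" using sol_unique[OF S h _ t] by blast
  then show ?thesis by (simp add: h_def two F_def)
qed

lemma sol_eq_extend:
  assumes S: "open S" "connected S" "\<And>t. t \<in> S \<Longrightarrow> exp t \<noteq> 1"
    and f: "sol S f" and g: "sol S g"
    and U: "open U" "U \<subseteq> S" "U \<noteq> {}" and eq: "\<And>t. t \<in> U \<Longrightarrow> f t = g t" and t: "t \<in> S"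
  shows "f t = g t"
proof -
  obtain t0 where t0: "t0 \<in> U" using U by blast
  have "Y f k t0 = Y g k t0" for k by (rule diff_op_cong_open[OF U(1) t0]) (rule eq)
  then show ?thesis using sol_eqI[OF S _ f g _ t] t0 U(2) by blast
qed

text \<open>The window is simply connected and free of singularities, so a solution with the initial
  data of \<open>f\<close> at -1 exists on all of it; uniqueness identifies it with \<open>f\<close>
  on the left.\<close>

lemma sol_extends_window:
  assumes f: "sol {t. Re t < 0} f"
  shows "\<exists>g. sol (window (2 * of_int n * pi)) g \<and> (\<forall>t. Re t < 0 \<longrightarrow> g t = f t)"
proof -
  define W where "W = window (2 * of_int n * pi)"
  have LW: "{t. Re t < 0} \<subseteq> W" by (auto simp: W_def window_def)
  have W: "open W" "simply_connected W" "W \<noteq> UNIV" "\<And>t. t \<in> W \<Longrightarrow> exp t \<noteq> 1" "- 1 \<in> W"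
    using LW exp_neq_1_window
    by (auto simp: W_def open_window window_neq_UNIV starlike_window starlike_imp_simply_connected)
  obtain g where g: "sol W g" "\<And>k. k < p \<Longrightarrow> Y g k (- 1) = Y f k (- 1)"
    using sol_exists[OF W, of "\<lambda>k. Y f k (- 1)"] by blast
  have gL: "sol {t. Re t < 0} g" using hg_solution_subset[OF g(1) LW] .
  have "g t = f t" if "Re t < 0" for t
    by (rule sol_eqI[OF open_halfspace_Re_lt[of 0] _ _ _ gL f g(2)])
      (use that W(4) LW in \<open>auto simp: convex_connected convex_halfspace_Re_lt\<close>)
  then show ?thesis using g(1) by (auto simp: W_def)
qed

text \<open>The system has a first-order pole at \<open>t = 0\<close>, with residue of rank one and nontrivial
  exponent \<open>q (p - 1)\<close>.\<close>

lemma holomorphic_solution_at_pole: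
  assumes q: "q (p - 1) \<notin> \<int>" and y0: "(\<Sum>j<p. q j * y0 j) = 0"
  shows "\<exists>Z. (\<forall>k<p. Z k holomorphic_on ball 0 (2 * pi) \<and> Z k 0 = y0 k \<and>
             (\<forall>t\<in>ball 0 (2 * pi) - {0}. Y (Z 0) k t = Z k t)) \<and> sol (ball 0 (2 * pi) - {0}) (Z 0)"
proof -
  define B :: "complex set" where "B = ball 0 (2 * pi)"
  obtain m where m: "p = Suc m" using p_pos by (cases p) auto
  \<comment> \<open>This is t / (exp t - 1) with the removable singularity filled in;
    \<open>A\<close> below is t times the companion matrix, with residue concentrated in the last
    row.\<close>
  define \<psi> :: "complex \<Rightarrow> complex" where "\<psi> = (\<lambda>t. 1 / (if t = 0 then 1 else (exp t - 1) / t))"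
  have "((\<lambda>t. exp t - 1) has_field_derivative 1) (at (0 :: complex))"
    by (auto intro!: derivative_eq_intros)
  then have d1: "deriv (\<lambda>t. exp t - 1) (0 :: complex) = 1" by (rule DERIV_imp_deriv)
  have "(\<lambda>t. if t = 0 then deriv (\<lambda>t. exp t - 1) 0 else (exp t - 1) / t) holomorphic_on B"
    by (rule pole_theorem_open_0[where a = 0 and g = "\<lambda>t. exp t - 1"])
      (use d1 in \<open>auto simp: B_def intro!: holomorphic_intros\<close>)
  then have \<psi>: "\<psi> holomorphic_on B" unfolding \<psi>_def d1
    by (rule holomorphic_on_divide[OF holomorphic_on_const])
      (use exp_neq_1_ball in \<open>auto simp: B_def\<close>)
  define A where "A = (\<lambda>i j t. (if j = i then - \<alpha> i * t else 0) + (if j = Suc i then t else 0) +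
     (if Suc i = p then q j * \<psi> t else 0))"
  have A0: "A i j 0 = (if Suc i = p then q j else 0)" for i j by (simp add: A_def \<psi>_def)
  have AC: "A i j t = t * C i j t" if "t \<noteq> 0" for i j t
    using that by (simp add: A_def C_def \<psi>_def algebra_simps)
  have "\<exists>Z. \<forall>i<p. Z i holomorphic_on ball 0 (2 * pi) \<and> Z i 0 = y0 i \<and>
           (\<forall>z\<in>ball 0 (2 * pi). z * deriv (Z i) z = (\<Sum>j<p. A i j z * Z j z))"
  proof (rule fuchsian_system_solution)
    fix i j assume "i < p" "j < p"
    show "A i j holomorphic_on ball 0 (2 * pi)"
      using \<psi> unfolding A_def B_def
      by (cases "j = i"; cases "j = Suc i"; cases "Suc i = p") (auto intro!: holomorphic_intros)
  next
    fix i assume "i < p"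
    then show "(\<Sum>j<p. A i j 0 * y0 j) = 0" using y0 by (cases "Suc i = p") (simp_all add: A0)
  next
    fix n :: nat and V :: "nat \<Rightarrow> complex" assume n: "n \<ge> 1"
    have "q m \<notin> \<int>" using q m by simp
    then have "of_nat n \<noteq> q m" by (metis Ints_of_nat)
    then have nq: "of_nat n - q m \<noteq> 0" by simp
    \<comment> \<open>All rows of the residue but the last are zero, so \<open>X i = V i / n\<close>
      for \<open>i < m\<close>, and the last equation determines \<open>X m\<close> because
      \<open>n - q m\<close> is nonzero.\<close>
    define s where "s = (V m + (\<Sum>j<m. q j * (V j / of_nat n))) / (of_nat n - q m)"
    have s: "(of_nat n - q m) * s = V m + (\<Sum>j<m. q j * (V j / of_nat n))"
      using nq by (simp add: s_def)
    define X where "X = (\<lambda>i. if i = m then s else V i / of_nat n)"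
    have "(\<Sum>j<p. q j * X j) = (\<Sum>j<m. q j * (V j / of_nat n)) + q m * s"
      unfolding m sum.lessThan_Suc by (simp add: X_def)
    then have "of_nat n * X i - (\<Sum>j<p. A i j 0 * X j) = V i" if "i < p" for i
      using s n that m by (cases "i = m") (simp_all add: A0 X_def algebra_simps)
    then show "\<exists>X. \<forall>i<p. of_nat n * X i - (\<Sum>j<p. A i j 0 * X j) = V i" by blast
  qed simp
  then obtain Z where Z: "\<And>i. i < p \<Longrightarrow> Z i holomorphic_on B" "\<And>i. i < p \<Longrightarrow> Z i 0 = y0 i"
    "\<And>i z. i < p \<Longrightarrow> z \<in> B \<Longrightarrow> z * deriv (Z i) z = (\<Sum>j<p. A i j z * Z j z)"
    unfolding B_def by blast
  have "linear_system p C (B - {0}) Z"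
    unfolding linear_system_def
  proof (intro allI impI conjI ballI)
    fix i assume i: "i < p"
    show "Z i holomorphic_on B - {0}" using Z(1)[OF i] by (rule holomorphic_on_subset) auto
    fix t assume t: "t \<in> B - {0}"
    then have "t * deriv (Z i) t = t * (\<Sum>j<p. C i j t * Z j t)"
      using Z(3)[OF i, of t] by (simp add: AC sum_distrib_left mult.assoc)
    then show "deriv (Z i) t = (\<Sum>j<p. C i j t * Z j t)" using t by simp
  qed
  then have "sol (B - {0}) (Z 0)" "\<And>k t. k < p \<Longrightarrow> t \<in> B - {0} \<Longrightarrow> Y (Z 0) k t = Z k t"
    using linear_system_sol[of "B - {0}" Z] exp_neq_1_ball by (auto simp: B_def open_delete)
  then show ?thesis using Z(1,2) unfolding B_def by blast
qed

end

context hg_system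
begin

text \<open>A solution on the left half-plane is continued to the right half-plane through the two
  windows adjacent to the singularity \<open>t = 0\<close>; the results \<open>fm\<close> and \<open>fp\<close> differ by the
  monodromy around \<open>x = 1\<close>. Because \<open>fp i (t + 2 \<pi> \<i>) = d i fm i t\<close>, the shift acts on the
  right half-plane by the product of the two circuit matrices.\<close>

lemma circuit_matrices:
  assumes q: "q (p - 1) \<notin> \<int>"
    and d: "d = (\<lambda>i. exp (- (2 * of_real pi * \<i> * \<beta> i)))" "inj_on d {..<p}"
  obtains fm fp :: "nat \<Rightarrow> complex \<Rightarrow> complex" and w u :: "nat \<Rightarrow> complex" where
    "\<And>i. i < p \<Longrightarrow> sol (window (- 2 * pi)) (fm i)"
    "\<And>i. i < p \<Longrightarrow> sol (window 0) (fp i)"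
    "\<And>i t. i < p \<Longrightarrow> Re t < 0 \<Longrightarrow> fm i t = fp i t"
    "\<And>i t. i < p \<Longrightarrow> Re t < 0 \<Longrightarrow> fp i (t + 2 * of_real pi * \<i>) = d i * fp i t"
    "\<And>i t. i < p \<Longrightarrow> Re t > 0 \<Longrightarrow> fm i t = fp i t - w i * (\<Sum>j<p. u j * fp j t)"
    "\<And>c. \<forall>t. Re t < 0 \<longrightarrow> (\<Sum>i<p. c i * fp i t) = 0 \<Longrightarrow> \<forall>i<p. c i = 0"
    "\<And>\<mu>. sq_det p (\<lambda>i j. (if i = j then \<mu> else 0) - d i * ((if i = j then 1 else 0) - w i * u j)) =
         (\<Prod>k<p. \<mu> - exp (- (2 * of_real pi * \<i> * \<alpha> k)))"
proof -
  define L where "L = {t :: complex. Re t < 0}"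
  define R where "R = {t :: complex. Re t > 0}"
  define B :: "complex set" where "B = ball 0 (2 * pi)"
  define Wm where "Wm = window (- 2 * pi)"
  define Wp where "Wp = window 0"
  define s where "s = 2 * of_real pi * \<i>"
  have sub: "L \<subseteq> Wm" "L \<subseteq> Wp" "R \<subseteq> Wm" "R \<subseteq> Wp"
    by (auto simp: L_def R_def Wm_def Wp_def window_def)
  have op: "open L" "open R" "open B" "open Wm" "open Wp"
    by (auto simp: L_def R_def B_def Wm_def Wp_def open_window open_halfspace_Re_lt open_halfspace_Re_gt)
  have cv: "convex L" "convex R" "convex B"
    by (auto simp: L_def R_def B_def convex_halfspace_Re_lt convex_halfspace_Re_gt)
  have W: "Wm = window (2 * of_int (- 1) * pi)" "Wp = window (2 * of_int 0 * pi)"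
    by (simp_all add: Wm_def Wp_def)
  have expW: "exp t \<noteq> 1" if "t \<in> Wm \<or> t \<in> Wp" for t
    using that exp_neq_1_window unfolding W by blast
  have expL: "exp t \<noteq> 1" if "t \<in> L" for t using that sub expW by blast
  have expR: "exp t \<noteq> 1" if "t \<in> R" for t using that sub expW by blast
  have conn: "connected L" "connected R" "connected Wm" "connected Wp" "connected (L \<inter> B)"
    "connected (R \<inter> B)" "connected (Wm \<inter> B)" "connected (Wp \<inter> B)"
  proof -
    show "connected L" "connected R" "connected (L \<inter> B)" "connected (R \<inter> B)"
      using cv by (auto intro!: convex_connected convex_Int)
    show "connected Wm" "connected Wp"
      unfolding Wm_def Wp_def by (rule starlike_imp_connected[OF starlike_window])+
    have "Complex 0 (- 2 * pi + pi) \<in> B" "Complex 0 (0 + pi) \<in> B"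
      by (auto simp: B_def cmod_def)
    then show "connected (Wm \<inter> B)" "connected (Wp \<inter> B)"
      unfolding Wm_def Wp_def
      by (auto intro!: starlike_imp_connected starlike_window_Int simp: B_def)
  qed
  have ne: "- 1 \<in> L \<inter> B" "1 \<in> R \<inter> B"
    using pi_gt3 by (auto simp: L_def R_def B_def)

  have "\<exists>f. \<forall>k<p. sol L (f k) \<and> (\<exists>t\<in>L. f k t \<noteq> 0) \<and> (\<forall>t\<in>L. f k (t + s) = d k * f k t)"
  proof -
    have "\<exists>f. k < p \<longrightarrow> sol L f \<and> (\<exists>t\<in>L. f t \<noteq> 0) \<and> (\<forall>t\<in>L. f (t + s) = d k * f t)" for k
      using left_eigenfunction[of k p \<alpha> \<beta>] unfolding d L_def s_def by auto
    then have "\<forall>k. \<exists>f. k < p \<longrightarrow> sol L f \<and> (\<exists>t\<in>L. f t \<noteq> 0) \<and> (\<forall>t\<in>L. f (t + s) = d k * f t)" ..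
    from choice[OF this] show ?thesis by blast
  qed
  then obtain f where f: "\<And>k. k < p \<Longrightarrow> sol L (f k)" "\<And>k. k < p \<Longrightarrow> \<exists>t\<in>L. f k t \<noteq> 0"
    "\<And>k t. k < p \<Longrightarrow> t \<in> L \<Longrightarrow> f k (t + s) = d k * f k t" by blast
  have indL: "\<forall>i<p. c i = 0" if "\<And>t. t \<in> L \<Longrightarrow> (\<Sum>i<p. c i * f i t) = 0" for c
    by (rule eigenfunctions_independent[of L s p f d c])
      (use f d(2) that in \<open>auto simp: L_def s_def\<close>)
  have "\<exists>g. \<forall>k<p. sol (window (2 * of_int n * pi)) (g k) \<and> (\<forall>t\<in>L. g k t = f k t)" for n
  proof -
    have "\<exists>g. k < p \<longrightarrow> sol (window (2 * of_int n * pi)) g \<and> (\<forall>t\<in>L. g t = f k t)" for k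
      using sol_extends_window[of "f k" n] f(1)[of k] unfolding L_def by auto
    then have "\<forall>k. \<exists>g. k < p \<longrightarrow> sol (window (2 * of_int n * pi)) g \<and> (\<forall>t\<in>L. g t = f k t)" ..
    from choice[OF this] show ?thesis by blast
  qed
  from this[of "- 1"] this[of 0] obtain fm fp where
    fm: "\<And>k. k < p \<Longrightarrow> sol Wm (fm k)" "\<And>k t. k < p \<Longrightarrow> t \<in> L \<Longrightarrow> fm k t = f k t" and
    fp: "\<And>k. k < p \<Longrightarrow> sol Wp (fp k)" "\<And>k t. k < p \<Longrightarrow> t \<in> L \<Longrightarrow> fp k t = f k t"
    unfolding W by blast
  have fmR: "sol R (fm k)" and fpR: "sol R (fp k)" if "k < p" for k
    using hg_solution_subset fm(1) fp(1) sub that by blast+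
  have combo: "sol S (\<lambda>t. \<Sum>i<p. c i * g i t)" if "open S" "\<And>i. i < p \<Longrightarrow> sol S (g i)" for S c g
    by (rule hg_solution_lincomb[OF that(1)]) (use that(2) in auto)

  \<comment> \<open>A relation on the small set \<open>R \<inter> B\<close> continues through
    \<open>Wp\<close> to the left half-plane, where eigenfunctions for distinct eigenvalues are
    independent.\<close>
  have indRB: "\<forall>i<p. c i = 0" if c: "\<And>t. t \<in> R \<inter> B \<Longrightarrow> (\<Sum>i<p. c i * fp i t) = 0" for c
  proof (rule indL)
    fix t assume t: "t \<in> L"
    have "(\<Sum>i<p. c i * fp i t) = (\<Sum>i<p. 0 * fp i t)"
    proof (rule sol_eq_extend[OF op(5) conn(4) _ combo combo, where U = "R \<inter> B"])
      show "t \<in> Wp" using t sub by blast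
      show "R \<inter> B \<noteq> {}" using ne by blast
      show "R \<inter> B \<subseteq> Wp" using sub by blast
    qed (use fp(1) c expW op in auto)
    then show "(\<Sum>i<p. c i * f i t) = 0" using fp(2)[OF _ t] by simp
  qed

  have "\<exists>M. \<forall>i. i < p \<longrightarrow> (\<forall>t\<in>R. fm i t = (\<Sum>j<p. M i j * fp j t))"
  proof -
    have "\<exists>c. i < p \<longrightarrow> (\<forall>t\<in>R. fm i t = (\<Sum>j<p. c j * fp j t))" for i
    proof (cases "i < p")
      case True
      have "\<exists>c. \<forall>t\<in>R. fm i t = (\<Sum>j<p. c j * fp j t)"
      proof (rule sol_in_span[of R fp R])
        show "\<forall>i<p. c i = 0" if "\<And>t. t \<in> R \<Longrightarrow> (\<Sum>i<p. c i * fp i t) = 0" for c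
          using that by (intro indRB) auto
        show "R \<noteq> {}" "R \<noteq> {}" using ne by blast+
      qed (use op conn expR fpR fmR True in auto)
      then show ?thesis by blast
    qed auto
    then have "\<forall>i. \<exists>c. i < p \<longrightarrow> (\<forall>t\<in>R. fm i t = (\<Sum>j<p. c j * fp j t))" ..
    from choice[OF this] show ?thesis .
  qed
  then obtain M where M: "\<And>i t. i < p \<Longrightarrow> t \<in> R \<Longrightarrow> fm i t = (\<Sum>j<p. M i j * fp j t)" by blast

  \<comment> \<open>Translation by \<open>s\<close> carries \<open>Wm\<close> onto
    \<open>Wp\<close>. Both sides solve the equation on \<open>Wm\<close> and agree on the left
    half-plane, so the multiplier \<open>d i\<close> survives on the right at the price of
    exchanging \<open>fp\<close> for \<open>fm\<close>.\<close>
  have shift: "fp i (t + s) = d i * fm i t" if i: "i < p" and t: "t \<in> Wm" for i t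
  proof -
    have Ws: "{t. t + s \<in> Wp} = Wm" by (auto simp: Wp_def Wm_def window_def s_def)
    have "sol {t. t + s \<in> Wp} (\<lambda>t. fp i (t + s))"
      by (rule hg_solution_shift[OF fp(1)[OF i]]) (simp add: s_def exp_two_pi_i')
    then have 1: "sol Wm (\<lambda>t. fp i (t + s))" unfolding Ws .
    have "sol Wm (\<lambda>t. \<Sum>j<p. (if j = i then d i else 0) * fm j t)"
      by (rule combo[OF op(4)]) (rule fm(1))
    moreover have "(\<Sum>j<p. (if j = i then d i else 0) * fm j t) = d i * fm i t" for t
      using i by (simp add: if_distrib[of "\<lambda>z. z * _"] cong: if_cong)
    ultimately have 2: "sol Wm (\<lambda>t. d i * fm i t)" by simp
    show ?thesis
    proof (rule sol_eq_extend[OF op(4) conn(3) _ 1 2 op(1) sub(1) _ _ t])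
      show "L \<noteq> {}" using ne by blast
      fix t assume t: "t \<in> L"
      then have "t + s \<in> L" by (simp add: L_def s_def)
      then show "fp i (t + s) = d i * fm i t" using f(3)[OF i t] fp(2)[OF i] fm(2)[OF i t] by simp
    qed (use expW in auto)
  qed

  have det: "sq_det p (\<lambda>i j. (if i = j then \<mu> else 0) - d i * M i j) =
         (\<Prod>k<p. \<mu> - exp (- (2 * of_real pi * \<i> * \<alpha> k)))" for \<mu>
  proof (rule det_shift_matrix)
    show "sol {t. Re t > 0} (fp i)" if "i < p" for i using fpR[OF that] by (simp add: R_def)
    show "\<forall>i<p. c i = 0" if "\<And>t. Re t > 0 \<Longrightarrow> (\<Sum>i<p. c i * fp i t) = 0" for c
      using that by (intro indRB) (auto simp: R_def)
    fix i t assume i: "i < p" and "Re t > (0 :: real)"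
    then have t: "t \<in> R" by (simp add: R_def)
    then have "fp i (t + s) = d i * (\<Sum>j<p. M i j * fp j t)"
      using shift[OF i] M[OF i t] sub by auto
    then show "fp i (t + 2 * of_real pi * \<i>) = (\<Sum>j<p. d i * M i j * fp j t)"
      by (simp add: s_def sum_distrib_left mult.assoc)
  qed

  have "\<exists>w u. \<forall>i<p. \<forall>j<p. (if i = j then 1 else 0) - M i j = w i * u j"
  proof -
    obtain m where m: "p = Suc m" using p_pos by (cases p) auto
    have qm: "q m \<noteq> 0" using q m by auto
    \<comment> \<open>A basis of the hyperplane of initial vectors admissible at the pole; the last
      coordinate compensates for the unit entry in position \<open>l\<close>.\<close>
    define y0 where "y0 = (\<lambda>l k. if k = l then 1 else if k = m then - q l / q m else 0)"
    have "\<exists>Z. (\<forall>k<p. Z k holomorphic_on B \<and> Z k 0 = y0 l k \<and>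
             (\<forall>t\<in>B - {0}. Y (Z 0) k t = Z k t)) \<and> sol (B - {0}) (Z 0)" if l: "l < m" for l
      unfolding B_def
    proof (rule holomorphic_solution_at_pole[OF q])
      have "(\<Sum>j<p. q j * y0 l j) = (\<Sum>j<m. if j = l then q l else 0) + q m * (- q l / q m)"
        unfolding m sum.lessThan_Suc using l
        by (intro arg_cong2[where f = "(+)"] sum.cong) (auto simp: y0_def)
      then show "(\<Sum>j<p. q j * y0 l j) = 0" using l qm by simp
    qed
    then have "\<forall>l. \<exists>Z. l < m \<longrightarrow> (\<forall>k<p. Z k holomorphic_on B \<and> Z k 0 = y0 l k \<and>
             (\<forall>t\<in>B - {0}. Y (Z 0) k t = Z k t)) \<and> sol (B - {0}) (Z 0)" by blast
    from choice[OF this] obtain Z where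
      Z: "\<And>l k. l < m \<Longrightarrow> k < p \<Longrightarrow> Z l k holomorphic_on B" "\<And>l k. l < m \<Longrightarrow> k < p \<Longrightarrow> Z l k 0 = y0 l k"
        "\<And>l k t. l < m \<Longrightarrow> k < p \<Longrightarrow> t \<in> B - {0} \<Longrightarrow> Y (Z l 0) k t = Z l k t"
        "\<And>l. l < m \<Longrightarrow> sol (B - {0}) (Z l 0)" by blast
    have LB: "L \<inter> B \<subseteq> B - {0}" and RB: "R \<inter> B \<subseteq> B - {0}" by (auto simp: L_def R_def)
    have WB: "Wm \<inter> B \<subseteq> B - {0}" "Wp \<inter> B \<subseteq> B - {0}" by (auto simp: Wm_def Wp_def window_def)
    have "\<exists>c. l < m \<longrightarrow> (\<forall>t\<in>L \<inter> B. Z l 0 t = (\<Sum>i<p. c i * f i t))" for l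
    proof (cases "l < m")
      case True
      have "\<exists>c. \<forall>t\<in>L \<inter> B. Z l 0 t = (\<Sum>i<p. c i * f i t)"
      proof (rule sol_in_span[of L f "L \<inter> B"])
        show "\<forall>i<p. c i = 0" if "\<And>t. t \<in> L \<Longrightarrow> (\<Sum>i<p. c i * f i t) = 0" for c
          using that by (rule indL)
        show "L \<noteq> {}" "L \<inter> B \<noteq> {}" using ne by blast+
        show "sol (L \<inter> B) (Z l 0)" using Z(4)[OF True] LB by (rule hg_solution_subset)
      qed (use op conn expL f in auto)
      then show ?thesis by blast
    qed auto
    then have "\<forall>l. \<exists>c. l < m \<longrightarrow> (\<forall>t\<in>L \<inter> B. Z l 0 t = (\<Sum>i<p. c i * f i t))" ..
    from choice[OF this] obtain c where
      c: "\<And>l t. l < m \<Longrightarrow> t \<in> L \<inter> B \<Longrightarrow> Z l 0 t = (\<Sum>i<p. c l i * f i t)" by blast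
    \<comment> \<open>\<open>Z l\<close> is holomorphic across the pole, so the same combination of
      the continued solutions represents it whichever window is used.\<close>
    have agree: "(\<Sum>i<p. c l i * g i t) = Z l 0 t"
      if l: "l < m" and W': "open W'" "connected (W' \<inter> B)" "L \<subseteq> W'" "W' \<inter> B \<subseteq> B - {0}"
        and g: "\<And>i. i < p \<Longrightarrow> sol W' (g i)" "\<And>i t. i < p \<Longrightarrow> t \<in> L \<Longrightarrow> g i t = f i t"
        and t: "t \<in> W' \<inter> B" for l W' g t
    proof (rule sol_eq_extend[where S = "W' \<inter> B" and U = "L \<inter> B" and f = "\<lambda>t. \<Sum>i<p. c l i * g i t"])
      show "sol (W' \<inter> B) (\<lambda>t. \<Sum>i<p. c l i * g i t)"
        by (rule hg_solution_subset[OF combo[OF W'(1) g(1)]]) auto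
      show "sol (W' \<inter> B) (Z l 0)" using Z(4)[OF l] W'(4) by (rule hg_solution_subset)
      show "L \<inter> B \<noteq> {}" using ne by blast
      show "exp t \<noteq> 1" if "t \<in> W' \<inter> B" for t
        using that W'(4) exp_neq_1_ball[of t] unfolding B_def by blast
      show "(\<Sum>i<p. c l i * g i t) = Z l 0 t" if "t \<in> L \<inter> B" for t
        using c[OF l that] g(2) that by simp
    qed (use op W' t in auto)
    \<comment> \<open>Going through \<open>Wm\<close> or through \<open>Wp\<close> gives the same
      function on the right, so the row \<open>c l\<close> is fixed by \<open>M\<close>.\<close>
    have kernel: "(\<Sum>i<p. c l i * ((if i = j then 1 else 0) - M i j)) = 0" if l: "l < m" and j: "j < p" for l j
    proof -
      have "\<forall>j<p. c l j - (\<Sum>i<p. c l i * M i j) = 0"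
      proof (rule indRB)
        fix t assume t: "t \<in> R \<inter> B"
        have "(\<Sum>i<p. c l i * fm i t) = Z l 0 t"
          by (rule agree[of l Wm]) (use l op conn sub WB fm t in auto)
        moreover have "(\<Sum>i<p. c l i * fp i t) = Z l 0 t"
          by (rule agree[of l Wp]) (use l op conn sub WB fp t in auto)
        moreover have "(\<Sum>i<p. c l i * fm i t) = (\<Sum>i<p. \<Sum>j<p. c l i * M i j * fp j t)"
          by (intro sum.cong refl) (use M t in \<open>simp add: sum_distrib_left mult.assoc\<close>)
        moreover have "(\<Sum>i<p. \<Sum>j<p. c l i * M i j * fp j t) = (\<Sum>j<p. (\<Sum>i<p. c l i * M i j) * fp j t)"
          unfolding sum_distrib_right by (rule sum.swap)
        ultimately show "(\<Sum>j<p. (c l j - (\<Sum>i<p. c l i * M i j)) * fp j t) = 0"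
          by (simp add: left_diff_distrib sum_subtractf)
      qed
      moreover have "(\<Sum>i<p. c l i * ((if i = j then 1 else 0) - M i j)) =
          (\<Sum>i<p. (if i = j then c l j else 0) - c l i * M i j)"
        by (intro sum.cong refl) (auto simp: algebra_simps)
      ultimately show ?thesis using j by (simp add: sum_subtractf)
    qed
    show ?thesis
    proof (rule rank_one_if_left_kernel[OF p_pos, of c])
      show "(\<Sum>i<p. c l i * ((if i = j then 1 else 0) - M i j)) = 0" if "l < p - 1" "j < p" for l j
        using kernel that m by simp
      fix x assume x: "\<And>i. i < p \<Longrightarrow> (\<Sum>l<p-1. x l * c l i) = 0"
      have p1: "p - 1 = m" by (simp add: m)
      show "\<forall>l<p-1. x l = 0"
        unfolding p1
      proof (intro allI impI)
        fix k assume k: "k < m"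
        then have kp: "k < p" by (simp add: m)
        \<comment> \<open>A relation among the rows \<open>c l\<close> makes the same combination of
          the \<open>Z l 0\<close> vanish on the left part of the disc, hence also the combination
          of their components with index \<open>k\<close>. By continuation it vanishes at the pole,
          where the initial vectors \<open>y0\<close> single out \<open>x k\<close>.\<close>
        define h where "h = (\<lambda>t. \<Sum>l<m. x l * Z l k t)"
        have "h t = 0" if t: "t \<in> L \<inter> B" for t
        proof -
          have "Y (\<lambda>t. \<Sum>l<m. x l * Z l 0 t) k t = Y (\<lambda>t. 0) k t"
          proof (rule diff_op_cong_open[of "L \<inter> B"])
            fix t assume t: "t \<in> L \<inter> B"
            have "(\<Sum>l<m. x l * Z l 0 t) = (\<Sum>l<m. \<Sum>i<p. x l * c l i * f i t)"
              by (intro sum.cong refl) (use c t in \<open>simp add: sum_distrib_left mult.assoc\<close>)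
            also have "\<dots> = (\<Sum>i<p. (\<Sum>l<m. x l * c l i) * f i t)"
              unfolding sum_distrib_right by (rule sum.swap)
            also have "\<dots> = 0" using x[unfolded p1] by simp
            finally show "(\<Sum>l<m. x l * Z l 0 t) = 0" .
          qed (use op t in auto)
          also have "Y (\<lambda>t. 0) k t = 0" by (simp add: diff_op_def higher_deriv_const)
          also have "Y (\<lambda>t. \<Sum>l<m. x l * Z l 0 t) k t = (\<Sum>l<m. x l * Y (Z l 0) k t)"
            by (rule diff_op_lincomb[of _ "B - {0}"])
              (use Z(4) LB t op in \<open>auto simp: hg_solution_def open_delete\<close>)
          also have "\<dots> = h t" unfolding h_def using Z(3) kp LB t by (intro sum.cong refl) auto
          finally show ?thesis .
        qed
        moreover have "h holomorphic_on B"
          unfolding h_def using Z(1) kp by (auto intro!: holomorphic_intros)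
        ultimately have "h 0 = 0"
        proof (intro analytic_continuation_open[of "L \<inter> B" B h "\<lambda>_. 0" 0])
          show "L \<inter> B \<noteq> {}" using ne by blast
          show "connected B" using cv(3) by (rule convex_connected)
        qed (use op in \<open>auto simp: B_def\<close>)
        moreover have "h 0 = (\<Sum>l<m. if l = k then x k else 0)"
          unfolding h_def using Z(2) kp k m by (intro sum.cong refl) (auto simp: y0_def)
        ultimately show "x k = 0" using k by simp
      qed
    qed
  qed
  then obtain w u where wu: "\<And>i j. i < p \<Longrightarrow> j < p \<Longrightarrow> (if i = j then 1 else 0) - M i j = w i * u j"
    by blast
  have M_wu: "M i j = (if i = j then 1 else 0) - w i * u j" if "i < p" "j < p" for i j
    using wu[OF that] by (simp add: algebra_simps)

  show ?thesis
  proof (rule that[of fm fp w u])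
    fix i assume i: "i < p"
    show "sol (window (- 2 * pi)) (fm i)" "sol (window 0) (fp i)"
      using fm(1) fp(1) i by (auto simp: Wm_def Wp_def)
    show "fm i t = fp i t" if "Re t < 0" for t using fm(2) fp(2) i that by (simp add: L_def)
    show "fp i (t + 2 * of_real pi * \<i>) = d i * fp i t" if "Re t < 0" for t
      using shift[OF i, of t] that fm(2)[OF i, of t] fp(2)[OF i, of t] sub(1) by (auto simp: s_def L_def)
    show "fm i t = fp i t - w i * (\<Sum>j<p. u j * fp j t)" if "Re t > 0" for t
    proof -
      have "fm i t = (\<Sum>j<p. (if j = i then fp i t else 0) - w i * (u j * fp j t))"
        using M[OF i, of t] that i by (auto simp: R_def M_wu algebra_simps intro!: sum.cong)
      then show ?thesis using i by (simp add: sum_subtractf sum_distrib_left)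
    qed
  next
    show "\<forall>i<p. c i = 0" if "\<forall>t. Re t < 0 \<longrightarrow> (\<Sum>i<p. c i * fp i t) = 0" for c
      using that fp(2) by (intro indL) (simp add: L_def)
  next
    fix \<mu>
    have "sq_mat p (\<lambda>i j. (if i = j then \<mu> else 0) - d i * ((if i = j then 1 else 0) - w i * u j)) =
          sq_mat p (\<lambda>i j. (if i = j then \<mu> else 0) - d i * M i j)"
      by (rule sq_mat_cong) (simp add: M_wu)
    then show "sq_det p (\<lambda>i j. (if i = j then \<mu> else 0) - d i * ((if i = j then 1 else 0) - w i * u j)) =
         (\<Prod>k<p. \<mu> - exp (- (2 * of_real pi * \<i> * \<alpha> k)))"
      using det by simp
  qed
qed

end

section \<open>Analytic continuation in the variable x\<close>

lemma eventually_nhds_exp: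
  assumes "eventually P (nhds (exp t :: complex))"
  shows "eventually (\<lambda>t. P (exp t)) (nhds t)"
  using assms by (rule eventually_compose_filterlim) (intro tendsto_exp filterlim_ident)

lemma eventually_nhds_Ln:
  assumes "eventually P (nhds (Ln x))" "x \<notin> \<real>\<^sub>\<le>\<^sub>0"
  shows "eventually (\<lambda>x. P (Ln x)) (nhds x)"
  using assms(1)
  by (rule eventually_compose_filterlim) (intro tendsto_Ln filterlim_ident assms(2))

text \<open>\<open>\<Gamma>\<close> lifts the path to the logarithmic plane. The germ at time s is
  \<open>g1\<close> or \<open>g2\<close> composed with the branch of the logarithm selected by
  \<open>\<Gamma>\<close>; the change from one to the other happens at s = 1/2, inside
  \<open>V\<close>. The final branch differs from the principal one by
  \<open>\<omega>\<close>.\<close>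

lemma continues_along_lift:
  assumes \<gamma>: "path \<gamma>" and \<Gamma>: "continuous_on {0..1} \<Gamma>"
    and exp: "\<And>s. s \<in> {0..1} \<Longrightarrow> \<gamma> s = exp (\<Gamma> s)"
    and D: "open D1" "open D2" "open V" "g1 holomorphic_on D1" "g2 holomorphic_on D2"
      "\<And>z. z \<in> V \<Longrightarrow> g1 z = g2 z"
    and \<Gamma>D: "\<And>s. 0 \<le> s \<Longrightarrow> s \<le> 1 / 2 \<Longrightarrow> \<Gamma> s \<in> D1" "\<And>s. 1 / 2 \<le> s \<Longrightarrow> s \<le> 1 \<Longrightarrow> \<Gamma> s \<in> D2" "\<Gamma> (1 / 2) \<in> V"
    and start: "\<bar>Im (\<Gamma> 0)\<bar> < pi" "\<Gamma> 1 = \<Gamma> 0 + \<omega>" "exp \<omega> = 1"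
    and f: "\<forall>\<^sub>F x in nhds (\<gamma> 0). f x = g1 (Ln x)"
    and g: "\<forall>\<^sub>F x in nhds (\<gamma> 1). g x = g2 (Ln x + \<omega>)"
  shows "continues_along \<gamma> f g"
proof -
  \<comment> \<open>The branch of the logarithm near \<open>\<gamma> s\<close> that takes the value
    \<open>\<Gamma> s\<close> at \<open>\<gamma> s\<close>.\<close>
  define \<Lambda> where "\<Lambda> = (\<lambda>s x. \<Gamma> s + Ln (x / \<gamma> s))"
  define \<phi> where "\<phi> = (\<lambda>s x. (if s \<le> 1 / 2 then g1 else g2) (\<Lambda> s x))"
  have \<gamma>0: "\<gamma> s \<noteq> 0" if "s \<in> {0..1}" for s using exp[OF that] by simp
  have \<Lambda>_self: "\<Lambda> s (\<gamma> s) = \<Gamma> s" if "s \<in> {0..1}" for s using \<gamma>0[OF that] by (simp add: \<Lambda>_def)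
  have \<Lambda>_an: "\<Lambda> s analytic_on {\<gamma> s}" if "s \<in> {0..1}" for s
    unfolding \<Lambda>_def using \<gamma>0[OF that] by (auto intro!: analytic_intros)
  \<comment> \<open>Two branches based at \<open>z\<close> and \<open>z'\<close> have the same germ
    at \<open>exp z\<close> as soon as the imaginary parts are less than pi apart, since then the
    principal logarithm meets no cut.\<close>
  have branch: "\<forall>\<^sub>F x in nhds (exp z). z + Ln (x / exp z) = z' + Ln (x / exp z')"
    if "\<bar>Im z - Im z'\<bar> < pi" for z z'
  proof -
    have "isCont (\<lambda>x. \<bar>Im (Ln (x / exp z))\<bar>) (exp z)"
      by (intro continuous_intros) auto
    then have "((\<lambda>x. \<bar>Im (Ln (x / exp z))\<bar>) \<longlongrightarrow> \<bar>Im (Ln (exp z / exp z))\<bar>) (nhds (exp z))"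
      unfolding isCont_def
      using tendsto_at_iff_tendsto_nhds[of "\<lambda>x. \<bar>Im (Ln (x / exp z))\<bar>" "exp z"] by blast
    then have "\<forall>\<^sub>F x in nhds (exp z). \<bar>Im (Ln (x / exp z))\<bar> < pi - \<bar>Im z - Im z'\<bar>"
      by (rule order_tendstoD) (use that in simp)
    moreover have "\<forall>\<^sub>F x in nhds (exp z). x \<noteq> 0" by (rule t1_space_nhds) simp
    ultimately show ?thesis
    proof eventually_elim
      case (elim x)
      have "x / exp z' = exp (z - z' + Ln (x / exp z))"
        using elim(2) by (simp add: exp_add exp_diff)
      moreover have "- pi < Im (z - z' + Ln (x / exp z))" "Im (z - z' + Ln (x / exp z)) \<le> pi"
        using elim(1) by auto
      ultimately have "Ln (x / exp z') = z - z' + Ln (x / exp z)" by (simp only: Ln_exp)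
      then show ?case by simp
    qed
  qed
  have in_D: "\<forall>\<^sub>F x in nhds (\<gamma> s). \<Lambda> s x \<in> S" if "s \<in> {0..1}" "open S" "\<Gamma> s \<in> S" for s S
  proof -
    have "isCont (\<Lambda> s) (\<gamma> s)" using \<Lambda>_an[OF that(1)] by (rule analytic_at_imp_isCont)
    then have "(\<Lambda> s \<longlongrightarrow> \<Lambda> s (\<gamma> s)) (nhds (\<gamma> s))" 
      using tendsto_at_iff_tendsto_nhds[of "\<Lambda> s" "\<gamma> s"] by (simp add: isCont_def)
    from topological_tendstoD[OF this that(2)] show ?thesis using that(3) \<Lambda>_self[OF that(1)] by simp
  qed
  have an: "\<phi> s analytic_on {\<gamma> s}" if s: "s \<in> {0..1}" for s
  proof -
    have "(g1 \<circ> \<Lambda> s) analytic_on {\<gamma> s}" if "s \<le> 1 / 2"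
      by (rule analytic_on_compose[OF \<Lambda>_an[OF s]])
        (use that s D \<Gamma>D \<Lambda>_self[OF s] in \<open>auto intro: analytic_on_subset simp: analytic_at\<close>)
    moreover have "(g2 \<circ> \<Lambda> s) analytic_on {\<gamma> s}" if "\<not> s \<le> 1 / 2"
      by (rule analytic_on_compose[OF \<Lambda>_an[OF s]])
        (use that s D \<Gamma>D \<Lambda>_self[OF s] in \<open>auto intro: analytic_on_subset simp: analytic_at\<close>)
    ultimately show ?thesis unfolding \<phi>_def by (cases "s \<le> 1 / 2") (auto simp: o_def)
  qed
  have const: "\<forall>\<^sub>F s in at t within {0..1}. \<forall>\<^sub>F x in nhds (\<gamma> s). \<phi> s x = \<phi> t x" if t: "t \<in> {0..1}" for t
  proof -
    have lim: "(\<Gamma> \<longlongrightarrow> \<Gamma> t) (at t within {0..1})" using \<Gamma> t by (simp add: continuous_on_def)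
    then have "((\<lambda>s. \<bar>Im (\<Gamma> s) - Im (\<Gamma> t)\<bar>) \<longlongrightarrow> \<bar>Im (\<Gamma> t) - Im (\<Gamma> t)\<bar>) (at t within {0..1})"
      by (intro tendsto_intros)
    then have near: "\<forall>\<^sub>F s in at t within {0..1}. \<bar>Im (\<Gamma> s) - Im (\<Gamma> t)\<bar> < pi"
      by (rule order_tendstoD) simp
    have mem: "\<forall>\<^sub>F s in at t within {0..1}. s \<in> {0..1}" by (simp add: eventually_at_filter)
    have id: "((\<lambda>s. s) \<longlongrightarrow> t) (at t within {0..1})" by (rule tendsto_ident_at)
    \<comment> \<open>Nearby parameters use the same function, or else t = 1/2 and the lift is in
      \<open>V\<close>, where the two functions agree.\<close>
    have side: "\<forall>\<^sub>F s in at t within {0..1}. (s \<le> 1 / 2 \<longleftrightarrow> t \<le> 1 / 2) \<or> \<Gamma> s \<in> V"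
    proof (cases "t = 1 / 2")
      case True
      then have "\<Gamma> t \<in> V" using \<Gamma>D(3) by (simp only:)
      from topological_tendstoD[OF lim D(3) this] have "\<forall>\<^sub>F s in at t within {0..1}. \<Gamma> s \<in> V" .
      then show ?thesis by eventually_elim simp
    next
      case False
      show ?thesis
      proof (cases "t < 1 / 2")
        case True
        from order_tendstoD(2)[OF id this] show ?thesis by eventually_elim (use True in auto)
      next
        case False
        with \<open>t \<noteq> 1 / 2\<close> have "1 / 2 < t" by simp
        from order_tendstoD(1)[OF id this] show ?thesis by eventually_elim (use \<open>1 / 2 < t\<close> in auto)
      qed
    qed
    from near mem side show ?thesis
    proof eventually_elim
      case (elim s)
      have same: "\<forall>\<^sub>F x in nhds (\<gamma> s). \<Lambda> s x = \<Lambda> t x"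
        using branch[OF elim(1)] exp[OF elim(2)] exp[OF t] by (simp add: \<Lambda>_def)
      show ?case
      proof (cases "s \<le> 1 / 2 \<longleftrightarrow> t \<le> 1 / 2")
        case True
        from same show ?thesis by eventually_elim (use True in \<open>simp add: \<phi>_def\<close>)
      next
        case False
        then have "\<forall>\<^sub>F x in nhds (\<gamma> s). \<Lambda> s x \<in> V" using in_D elim D(3) by blast
        with same show ?thesis by eventually_elim (auto simp: \<phi>_def D(6))
      qed
    qed
  qed
  have Ln_branch: "\<forall>\<^sub>F x in nhds (\<gamma> 0). \<Lambda> 0 x = Ln x"
    using branch[of "\<Gamma> 0" 0] start exp[of 0] by (simp add: \<Lambda>_def)
  have "\<gamma> 1 = \<gamma> 0" using exp[of 0] exp[of 1] start by (simp add: exp_add)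
  then have Ln_branch1: "\<forall>\<^sub>F x in nhds (\<gamma> 1). \<Lambda> 1 x = Ln x + \<omega>"
    using Ln_branch start(2) by (simp add: \<Lambda>_def algebra_simps)
  have "\<forall>\<^sub>F x in nhds (\<gamma> 0). \<phi> 0 x = f x"
    using Ln_branch f by eventually_elim (simp add: \<phi>_def)
  moreover have "\<forall>\<^sub>F x in nhds (\<gamma> 1). \<phi> 1 x = g x"
    using Ln_branch1 g by eventually_elim (simp add: \<phi>_def)
  ultimately show ?thesis
    unfolding continues_along_def using \<gamma> an const by blast
qed

section \<open>The differential equation in the coordinates x and log x\<close>

text \<open>Under x = exp t each factor x d/dx + c becomes D + c. Holomorphy is carried along in the
  induction so that the next derivative makes sense.\<close>

lemma foldr_theta_shift:
  assumes V: "open V" and f: "f holomorphic_on V"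
  shows "foldr (\<lambda>i. \<theta>_shift (c i)) is f holomorphic_on V \<and>
     (\<forall>t. exp t \<in> V \<longrightarrow> foldr (\<lambda>i. \<theta>_shift (c i)) is f (exp t) =
        diff_op (prod_list (map (\<lambda>i. [:c i, 1:]) is)) (\<lambda>t. f (exp t)) t)"
proof (induction "is")
  case Nil
  then show ?case using f by simp
next
  case (Cons i "is")
  define h where "h = foldr (\<lambda>i. \<theta>_shift (c i)) is f"
  define r where "r = prod_list (map (\<lambda>i. [:c i, 1:]) is)"
  have h: "h holomorphic_on V" "\<And>t. exp t \<in> V \<Longrightarrow> h (exp t) = diff_op r (\<lambda>t. f (exp t)) t"
    using Cons by (auto simp: h_def r_def)
  have S: "open (exp -` V)" using V by (intro open_vimage continuous_intros)
  have "(f \<circ> exp) holomorphic_on exp -` V"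
    by (rule holomorphic_on_compose_gen[OF _ f]) (auto intro!: holomorphic_intros)
  then have fe: "(\<lambda>t. f (exp t)) holomorphic_on exp -` V" by (simp add: o_def)
  have "\<theta>_shift (c i) h holomorphic_on V"
    unfolding \<theta>_shift_def using h V by (intro holomorphic_intros holomorphic_deriv)
  moreover have "\<theta>_shift (c i) h (exp t) = diff_op ([:c i, 1:] * r) (\<lambda>t. f (exp t)) t" if t: "exp t \<in> V" for t
  proof -
    have "(h has_field_derivative deriv h (exp t)) (at (exp t))"
      using h(1) V t by (rule holomorphic_derivI)
    then have "((\<lambda>t. h (exp t)) has_field_derivative deriv h (exp t) * exp t) (at t)"
      by (rule DERIV_chain2) (rule DERIV_exp)
    moreover have "deriv (\<lambda>t. h (exp t)) t = deriv (diff_op r (\<lambda>t. f (exp t))) t"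
    proof (rule deriv_cong_ev)
      have "\<forall>\<^sub>F t in nhds t. t \<in> exp -` V" by (rule eventually_nhds_in_open[OF S]) (use t in auto)
      then show "\<forall>\<^sub>F t in nhds t. h (exp t) = diff_op r (\<lambda>t. f (exp t)) t"
        by eventually_elim (use h(2) in auto)
    qed simp
    ultimately have "deriv (diff_op r (\<lambda>t. f (exp t))) t = exp t * deriv h (exp t)"
      by (metis DERIV_imp_deriv mult.commute)
    then show ?thesis
      using diff_op_linear_factor[OF fe S, of t "c i" r] t h(2)[OF t] by (simp add: \<theta>_shift_def)
  qed
  ultimately show ?case by (simp add: h_def r_def)
qed

lemma newton_basis_conv_prod_list:
  "newton_basis (\<lambda>i. c (Suc i)) n = prod_list (map (\<lambda>i. [:c i, 1:]) [1..<n + 1])"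
proof (induction n)
  case (Suc n)
  then show ?case by (simp add: newton_basis_Suc mult.commute del: mult_pCons_left mult_pCons_right)
qed simp

text \<open>Multiplying by x = exp t, which never vanishes, turns the outer d/dx into x d/dx. It is
  the factor with exponent 0, which explains the special value at index 0.\<close>

lemma hypergeometric_equation_log:
  fixes a b :: "nat \<Rightarrow> complex"
  assumes p: "p \<ge> 1" and V: "open V" and f: "f holomorphic_on V" and t: "exp t \<in> V"
  shows "foldr (\<lambda>i. \<theta>_shift (a i)) [1..<p + 1] f (exp t) =
           deriv (foldr (\<lambda>j. \<theta>_shift (b j - 1)) [1..<p] f) (exp t) \<longleftrightarrow>
         exp t * diff_op (newton_basis (\<lambda>i. a (Suc i)) p) (\<lambda>t. f (exp t)) t =
           diff_op (newton_basis (\<lambda>i. if i = 0 then 0 else b i - 1) p) (\<lambda>t. f (exp t)) t"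
proof -
  obtain m where m: "p = Suc m" using p by (cases p) auto
  define g where "g = foldr (\<lambda>j. \<theta>_shift (b j - 1)) [1..<p] f"
  have g: "g holomorphic_on V" unfolding g_def using foldr_theta_shift[OF V f, of "\<lambda>j. b j - 1"] by blast
  have "\<theta>_shift 0 g (exp t) = diff_op (prod_list (map (\<lambda>i. [:if i = 0 then 0 else b i - 1, 1:]) [0..<p])) (\<lambda>t. f (exp t)) t"
  proof -
    define c where "c = (\<lambda>i. if i = 0 then 0 else b i - 1)"
    have "foldr (\<lambda>j. \<theta>_shift (c j)) [1..<p] f = g"
      unfolding g_def by (rule foldr_cong) (auto simp: c_def)
    then have "foldr (\<lambda>j. \<theta>_shift (c j)) [0..<p] f = \<theta>_shift 0 g"
      by (simp add: upt_conv_Cons m c_def del: upt_Suc)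
    then show ?thesis using foldr_theta_shift[OF V f, of c "[0..<p]"] t by (simp add: c_def)
  qed
  moreover have "prod_list (map (\<lambda>i. [:c i, 1:]) [0..<p]) = newton_basis c p" for c :: "nat \<Rightarrow> complex"
    by (simp add: newton_basis_def prod.list_conv_set_nth atLeast0LessThan)
  ultimately have e1: "exp t * deriv g (exp t) =
      diff_op (newton_basis (\<lambda>i. if i = 0 then 0 else b i - 1) p) (\<lambda>t. f (exp t)) t"
    by (simp add: \<theta>_shift_def)
  have e2: "foldr (\<lambda>i. \<theta>_shift (a i)) [1..<p + 1] f (exp t) =
      diff_op (newton_basis (\<lambda>i. a (Suc i)) p) (\<lambda>t. f (exp t)) t"
    unfolding newton_basis_conv_prod_list using foldr_theta_shift[OF V f, of a] t by blast
  show ?thesis unfolding g_def[symmetric] e1[symmetric] e2 by simp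
qed

lemma hypergeometric_solution_of_log:
  fixes a b :: "nat \<Rightarrow> complex"
  assumes p: "p \<ge> 1" and \<epsilon>: "0 < \<epsilon>" "\<epsilon> < 1"
    and g: "hg_solution p (\<lambda>i. a (Suc i)) (\<lambda>i. if i = 0 then 0 else b i - 1) {t. Re t < 0} g"
  shows "hypergeometric_solution p a b (of_real \<epsilon>) (\<lambda>x. g (Ln x))"
proof -
  \<comment> \<open>On this half disc \<open>Ln\<close> is a holomorphic inverse of
    \<open>exp\<close> with values in the left half-plane.\<close>
  define V :: "complex set" where "V = {x. Re x > 0} \<inter> ball 0 1"
  have V: "open V" unfolding V_def by (intro open_Int open_halfspace_Re_gt open_ball)
  have \<epsilon>V: "of_real \<epsilon> \<in> V" using \<epsilon> by (simp add: V_def)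
  have Ln: "Re (Ln x) < 0" "exp (Ln x) = x" "\<bar>Im (Ln x)\<bar> < pi" "x \<notin> \<real>\<^sub>\<le>\<^sub>0" if "x \<in> V" for x
  proof -
    have x: "x \<noteq> 0" "Re x > 0" "norm x < 1" using that by (auto simp: V_def)
    show "Re (Ln x) < 0" "exp (Ln x) = x" using x by auto
    show "\<bar>Im (Ln x)\<bar> < pi" using Re_Ln_pos_lt_imp[OF x(2)] pi_gt_zero by linarith
    show "x \<notin> \<real>\<^sub>\<le>\<^sub>0" using x by (auto simp: complex_nonpos_Reals_iff)
  qed
  have "(g \<circ> Ln) holomorphic_on V"
    by (rule holomorphic_on_compose_gen[of _ _ _ "{t. Re t < 0}"])
      (use Ln g in \<open>auto simp: hg_solution_def intro!: holomorphic_intros\<close>)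
  then have h: "(\<lambda>x. g (Ln x)) holomorphic_on V" by (simp add: o_def)
  have "foldr (\<lambda>i. \<theta>_shift (a i)) [1..<p + 1] (\<lambda>x. g (Ln x)) x =
        deriv (foldr (\<lambda>j. \<theta>_shift (b j - 1)) [1..<p] (\<lambda>x. g (Ln x))) x" if x: "x \<in> V" for x
  proof -
    have eq: "diff_op r (\<lambda>t. g (Ln (exp t))) (Ln x) = diff_op r g (Ln x)" for r
    proof (rule diff_op_cong)
      have "open {t. \<bar>Im t\<bar> < pi}"
        by (intro open_Collect_less continuous_intros)
      then have "\<forall>\<^sub>F t in nhds (Ln x). t \<in> {t. \<bar>Im t\<bar> < pi}"
        by (rule eventually_nhds_in_open) (use Ln(3)[OF x] in simp)
      then show "\<forall>\<^sub>F t in nhds (Ln x). g (Ln (exp t)) = g t"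
        by eventually_elim auto
    qed
    have "exp (Ln x) \<in> V" using Ln(2)[OF x] x by simp
    note iff = hypergeometric_equation_log[OF p V h this, of a b, unfolded eq Ln(2)[OF x]]
    have "exp (Ln x) * diff_op (newton_basis (\<lambda>i. a (Suc i)) p) g (Ln x) =
          diff_op (newton_basis (\<lambda>i. if i = 0 then 0 else b i - 1) p) g (Ln x)"
      using g Ln(1)[OF x] unfolding hg_solution_def by blast
    then show ?thesis by (intro iffD2[OF iff]) (simp only: Ln(2)[OF x])
  qed
  then show ?thesis
    unfolding hypergeometric_solution_def
    using V \<epsilon>V h eventually_nhds_in_open[OF V \<epsilon>V] by (auto simp: analytic_at elim!: eventually_mono)
qed

text \<open>A germ is controlled only near \<open>\<epsilon>\<close>, hence the small disc around
  \<open>ln \<epsilon>\<close>; there \<open>sol_in_span\<close> can compare it with the global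
  basis.\<close>

lemma log_solution_of_hypergeometric:
  fixes a b :: "nat \<Rightarrow> complex"
  assumes p: "p \<ge> 1" and \<epsilon>: "0 < \<epsilon>" "\<epsilon> < 1"
    and f: "hypergeometric_solution p a b (of_real \<epsilon>) f"
  shows "\<exists>r>0. ball (of_real (ln \<epsilon>)) r \<subseteq> {t. Re t < 0} \<and>
     hg_solution p (\<lambda>i. a (Suc i)) (\<lambda>i. if i = 0 then 0 else b i - 1) (ball (of_real (ln \<epsilon>)) r) (\<lambda>t. f (exp t))"
proof -
  obtain V where V: "open V" "of_real \<epsilon> \<in> V" "f holomorphic_on V"
    using f unfolding hypergeometric_solution_def analytic_at by blast
  obtain W where W: "open W" "of_real \<epsilon> \<in> W"
    "\<And>x. x \<in> W \<Longrightarrow> foldr (\<lambda>i. \<theta>_shift (a i)) [1..<p + 1] f x = deriv (foldr (\<lambda>j. \<theta>_shift (b j - 1)) [1..<p] f) x"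
    using f unfolding hypergeometric_solution_def eventually_nhds by blast
  define U where "U = exp -` (V \<inter> W) \<inter> {t. Re t < 0}"
  have "open U" unfolding U_def
    using V W by (intro open_Int open_vimage open_halfspace_Re_lt continuous_intros)
  moreover have "of_real (ln \<epsilon>) \<in> U"
    using V W \<epsilon> by (simp add: U_def exp_of_real)
  ultimately obtain r where r: "r > 0" "ball (of_real (ln \<epsilon>)) r \<subseteq> U"
    using openE by blast
  have "(f \<circ> exp) holomorphic_on ball (of_real (ln \<epsilon>)) r"
    by (rule holomorphic_on_compose_gen[OF _ V(3)])
      (use r(2) in \<open>auto simp: U_def intro!: holomorphic_intros\<close>)
  moreover have "exp t * diff_op (newton_basis (\<lambda>i. a (Suc i)) p) (\<lambda>t. f (exp t)) t =
           diff_op (newton_basis (\<lambda>i. if i = 0 then 0 else b i - 1) p) (\<lambda>t. f (exp t)) t"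
    if "t \<in> ball (of_real (ln \<epsilon>)) r" for t
  proof -
    have t: "exp t \<in> V" "exp t \<in> W" using that r(2) by (auto simp: U_def)
    show ?thesis using hypergeometric_equation_log[OF p V(1,3) t(1), of a b] W(3)[OF t(2)] by blast
  qed
  ultimately have "hg_solution p (\<lambda>i. a (Suc i)) (\<lambda>i. if i = 0 then 0 else b i - 1) (ball (of_real (ln \<epsilon>)) r) (\<lambda>t. f (exp t))"
    unfolding hg_solution_def by (simp add: o_def)
  moreover have "ball (of_real (ln \<epsilon>)) r \<subseteq> {t. Re t < 0}" using r(2) by (auto simp: U_def)
  ultimately show ?thesis using r(1) by blast
qed

section \<open>Continuation along the two loops\<close>

text \<open>The lift is the vertical segment from \<open>ln \<epsilon>\<close> to
  \<open>ln \<epsilon> + 2 pi i\<close>. It stays in the left half-plane, so one function serves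
  along the whole loop.\<close>

lemma circuit_around_0:
  assumes F: "F holomorphic_on {t. Re t < 0}"
    and shift: "\<And>t. Re t < 0 \<Longrightarrow> F (t + 2 * of_real pi * \<i>) = \<mu> * F t"
    and \<epsilon>: "0 < \<epsilon>" "\<epsilon> < 1"
    and f: "\<And>x. f x = F (Ln x)" and g: "\<And>x. g x = \<mu> * F (Ln x)"
  shows "continues_along (\<rho>\<^sub>0 \<epsilon>) f g"
proof (rule continues_along_lift[where \<Gamma> = "\<lambda>s. of_real (ln \<epsilon>) + 2 * of_real pi * \<i> * of_real s"
      and ?D1.0 = "{t. Re t < 0}" and ?D2.0 = "{t. Re t < 0}" and V = "{t. Re t < 0}"
      and ?g1.0 = F and ?g2.0 = F and \<omega> = "2 * of_real pi * \<i>"])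
  show "path (\<rho>\<^sub>0 \<epsilon>)" unfolding path_def \<rho>\<^sub>0_def by (intro continuous_intros)
  show "\<rho>\<^sub>0 \<epsilon> s = exp (of_real (ln \<epsilon>) + 2 * of_real pi * \<i> * of_real s)" for s
    using \<epsilon> by (simp add: \<rho>\<^sub>0_def exp_add exp_of_real)
  have "exp (2 * of_real pi * \<i>) = 1" by (rule exp_two_pi_i)
  then have ends: "\<rho>\<^sub>0 \<epsilon> 0 = of_real \<epsilon>" "\<rho>\<^sub>0 \<epsilon> 1 = of_real \<epsilon>" by (simp_all add: \<rho>\<^sub>0_def)
  show "\<forall>\<^sub>F x in nhds (\<rho>\<^sub>0 \<epsilon> 0). f x = F (Ln x)" by (simp add: f)
  have "\<forall>\<^sub>F x in nhds (of_real \<epsilon>). x \<in> ball 0 1 - {0 :: complex}"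
    using \<epsilon> by (intro eventually_nhds_in_open) (auto simp: open_delete)
  then show "\<forall>\<^sub>F x in nhds (\<rho>\<^sub>0 \<epsilon> 1). g x = F (Ln x + 2 * of_real pi * \<i>)"
    unfolding ends by eventually_elim (simp add: g shift)
qed (use \<epsilon> F in \<open>auto simp: open_halfspace_Re_lt exp_two_pi_i' intro!: continuous_intros\<close>)

lemma Re_\<rho>\<^sub>1:
  assumes "0 < \<epsilon>" "\<epsilon> < 1"
  shows "Re (\<rho>\<^sub>1 \<epsilon> s) > 0"
proof -
  have "(1 - \<epsilon>) * cos (2 * pi * s) \<le> (1 - \<epsilon>) * 1"
    using assms by (intro mult_left_mono) auto
  also have "\<dots> < 1" using assms by simp
  finally have "1 - (1 - \<epsilon>) * cos (2 * pi * s) > 0" by (simp only: diff_gt_0_iff_gt)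
  moreover have "Re (\<rho>\<^sub>1 \<epsilon> s) = 1 - (1 - \<epsilon>) * cos (2 * pi * s)"
    by (simp add: \<rho>\<^sub>1_def Re_exp)
  ultimately show ?thesis by (simp only:)
qed

text \<open>The loop stays in Re x > 0, so the principal logarithm lifts it. Its first half runs
  below the real axis, through the window under the singularity, and its second half above. The
  halves meet at \<open>2 - \<epsilon>\<close>, whose logarithm lies in the right half-plane, where
  \<open>Fm\<close> and \<open>Fp\<close> agree.\<close>

lemma circuit_around_1:
  assumes F: "Fm holomorphic_on window (- 2 * pi)" "Fp holomorphic_on window 0"
    and agree: "\<And>t. Re t > 0 \<Longrightarrow> Fm t = Fp t"
    and \<epsilon>: "0 < \<epsilon>" "\<epsilon> < 1"
    and f: "\<And>x. x \<noteq> 0 \<Longrightarrow> norm x < 1 \<Longrightarrow> f x = Fm (Ln x)"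
    and g: "\<And>x. x \<noteq> 0 \<Longrightarrow> norm x < 1 \<Longrightarrow> g x = Fp (Ln x)"
  shows "continues_along (\<rho>\<^sub>1 \<epsilon>) f g"
proof (rule continues_along_lift[where \<Gamma> = "\<lambda>s. Ln (\<rho>\<^sub>1 \<epsilon> s)"
      and ?D1.0 = "window (- 2 * pi)" and ?D2.0 = "window 0" and V = "{t. Re t > 0}"
      and ?g1.0 = Fm and ?g2.0 = Fp and \<omega> = 0])
  have cont: "continuous_on {0..1} (\<rho>\<^sub>1 \<epsilon>)" unfolding \<rho>\<^sub>1_def by (intro continuous_intros)
  then show "path (\<rho>\<^sub>1 \<epsilon>)" by (simp add: path_def)
  have nz: "\<rho>\<^sub>1 \<epsilon> s \<noteq> 0" and nonpos: "\<rho>\<^sub>1 \<epsilon> s \<notin> \<real>\<^sub>\<le>\<^sub>0" for s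
    using Re_\<rho>\<^sub>1[OF \<epsilon>, of s] by (auto simp: complex_nonpos_Reals_iff)
  show "continuous_on {0..1} (\<lambda>s. Ln (\<rho>\<^sub>1 \<epsilon> s))"
    using cont nonpos by (intro continuous_intros) auto
  show "\<rho>\<^sub>1 \<epsilon> s = exp (Ln (\<rho>\<^sub>1 \<epsilon> s))" for s using nz by simp
  have "exp (2 * of_real pi * \<i>) = 1" by (rule exp_two_pi_i)
  then have ends: "\<rho>\<^sub>1 \<epsilon> 0 = of_real \<epsilon>" "\<rho>\<^sub>1 \<epsilon> 1 = of_real \<epsilon>" by (simp_all add: \<rho>\<^sub>1_def)
  have half: "\<rho>\<^sub>1 \<epsilon> (1 / 2) = of_real (2 - \<epsilon>)"
  proof -
    have "exp (of_real pi * \<i>) = - 1" by (rule exp_pi_i)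
    then show ?thesis by (simp add: \<rho>\<^sub>1_def)
  qed
  have Ln_\<epsilon>: "Ln (of_real \<epsilon>) = of_real (ln \<epsilon>)" using \<epsilon> by (intro Ln_of_real)
  have Ln_half: "Ln (of_real (2 - \<epsilon>)) = of_real (ln (2 - \<epsilon>))" using \<epsilon> by (intro Ln_of_real) simp
  have pos: "ln (2 - \<epsilon>) > 0" and neg: "ln \<epsilon> < 0" using \<epsilon> by simp_all
  show "Ln (\<rho>\<^sub>1 \<epsilon> (1 / 2)) \<in> {t. Re t > 0}" unfolding half Ln_half using pos by simp
  have Im: "Im (\<rho>\<^sub>1 \<epsilon> s) = - ((1 - \<epsilon>) * sin (2 * pi * s))" for s
    by (simp add: \<rho>\<^sub>1_def Im_exp)
  have sin_pos: "sin (2 * pi * s) > 0" if "0 < s" "s < 1 / 2" for s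
    using that by (intro sin_gt_zero) auto
  have sin_neg: "sin (2 * pi * s) < 0" if "1 / 2 < s" "s < 1" for s
  proof -
    have "sin (2 * pi * (s - 1 / 2)) > 0" using that by (intro sin_pos) auto
    moreover have "2 * pi * (s - 1 / 2) = 2 * pi * s - pi" by (simp add: algebra_simps)
    ultimately show ?thesis by simp
  qed
  show "Ln (\<rho>\<^sub>1 \<epsilon> s) \<in> window (- 2 * pi)" if s: "0 \<le> s" "s \<le> 1 / 2" for s
  proof -
    consider "s = 0" | "s = 1 / 2" | "0 < s" "s < 1 / 2" using s by linarith
    then show ?thesis
    proof cases
      case 1
      show ?thesis unfolding 1 ends Ln_\<epsilon> using neg by (simp add: window_def)
    next
      case 2
      show ?thesis unfolding 2 half Ln_half using pos by (simp add: window_def)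
    next
      case 3
      then have "Im (\<rho>\<^sub>1 \<epsilon> s) < 0" unfolding Im using sin_pos[of s] \<epsilon> by simp
      then have "Im (Ln (\<rho>\<^sub>1 \<epsilon> s)) < 0"
        using Im_Ln_pos_le[OF nz, of s] Im_Ln_le_pi[OF nz, of s] by linarith
      moreover have "- pi < Im (Ln (\<rho>\<^sub>1 \<epsilon> s))" by (rule mpi_less_Im_Ln[OF nz])
      ultimately show ?thesis using pi_gt_zero by (simp add: window_def)
    qed
  qed
  show "Ln (\<rho>\<^sub>1 \<epsilon> s) \<in> window 0" if s: "1 / 2 \<le> s" "s \<le> 1" for s
  proof -
    consider "s = 1" | "s = 1 / 2" | "1 / 2 < s" "s < 1" using s by linarith
    then show ?thesis
    proof cases
      case 1
      show ?thesis unfolding 1 ends Ln_\<epsilon> using neg by (simp add: window_def)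
    next
      case 2
      show ?thesis unfolding 2 half Ln_half using pos by (simp add: window_def)
    next
      case 3
      then have "Im (\<rho>\<^sub>1 \<epsilon> s) > 0" unfolding Im using sin_neg[of s] \<epsilon> by (simp add: mult_pos_neg)
      then show ?thesis using Im_Ln_pos_lt_imp[of "\<rho>\<^sub>1 \<epsilon> s"] by (simp add: window_def)
    qed
  qed
  have near: "\<forall>\<^sub>F x in nhds (of_real \<epsilon>). x \<in> ball 0 1 - {0 :: complex}"
    using \<epsilon> by (intro eventually_nhds_in_open) (auto simp: open_delete)
  show "\<forall>\<^sub>F x in nhds (\<rho>\<^sub>1 \<epsilon> 0). f x = Fm (Ln x)"
    unfolding ends using near by eventually_elim (use f in auto)
  show "\<forall>\<^sub>F x in nhds (\<rho>\<^sub>1 \<epsilon> 1). g x = Fp (Ln x + 0)"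
    unfolding ends using near by eventually_elim (use g in auto)
  show "\<bar>Im (Ln (\<rho>\<^sub>1 \<epsilon> 0))\<bar> < pi" unfolding ends Ln_\<epsilon> by simp
  show "Ln (\<rho>\<^sub>1 \<epsilon> 1) = Ln (\<rho>\<^sub>1 \<epsilon> 0) + 0" by (simp add: ends)
qed (use F agree in \<open>auto simp: open_window open_halfspace_Re_gt\<close>)

section \<open>The circuit matrices\<close>

text \<open>The hypotheses \<open>c0\<close> and \<open>ck\<close> come from the characteristic
  polynomial at the eigenvalues 1 and 1/B_k. Writing 1/B_k - 1/A_i = (A_i - B_k) / (B_k A_i), and
  likewise for the other factors, makes the full products of the A and of the B cancel in the
  ratio.\<close>

lemma residue_ratio:
  fixes A B :: "nat \<Rightarrow> complex" and c :: "nat \<Rightarrow> complex"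
  assumes k: "k \<in> {1..m}"
    and A: "\<And>i. i \<in> {1..Suc m} \<Longrightarrow> A i \<noteq> 0 \<and> A i \<noteq> 1"
    and B: "\<And>j. j \<in> {1..m} \<Longrightarrow> B j \<noteq> 0 \<and> B j \<noteq> 1" "\<And>j. j \<in> {1..m} - {k} \<Longrightarrow> B j \<noteq> B k"
    and c0: "c 0 * (\<Prod>j=1..m. 1 - inverse (B j)) = (\<Prod>i=1..Suc m. 1 - inverse (A i))"
    and ck: "inverse (B k) * c k * ((inverse (B k) - 1) * (\<Prod>j\<in>{1..m} - {k}. inverse (B k) - inverse (B j))) =
       (\<Prod>i=1..Suc m. inverse (B k) - inverse (A i))"
  shows "c k = c 0 * (- ((\<Prod>j\<in>{1..m} - {k}. (B j - 1)) * (\<Prod>i=1..Suc m. (A i - B k))) /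
        (B k * (\<Prod>j\<in>{1..m} - {k}. (B j - B k)) * (\<Prod>i=1..Suc m. (A i - 1))))"
proof -
  define J where "J = {1..m} - {k}"
  define PA where "PA = (\<Prod>i=1..Suc m. A i)"
  define PB where "PB = (\<Prod>j\<in>J. B j)"
  define Q1 where "Q1 = (\<Prod>j\<in>J. (B j - 1))"
  define Qk where "Qk = (\<Prod>j\<in>J. (B j - B k))"
  define X1 where "X1 = (\<Prod>i=1..Suc m. (A i - 1))"
  define X where "X = (\<Prod>i=1..Suc m. (A i - B k))"
  have Bk: "B k \<noteq> 0" "B k \<noteq> 1" using B k by auto
  have nz: "PA \<noteq> 0" "PB \<noteq> 0" "Qk \<noteq> 0" "X1 \<noteq> 0"
    using A B by (auto simp: PA_def PB_def Qk_def X1_def J_def)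
  obtain n where n: "m = Suc n" using k by (cases m) auto
  have cardJ: "card J = n" using k by (simp add: J_def n)
  have eA1: "(\<Prod>i=1..Suc m. 1 - inverse (A i)) = X1 / PA"
    unfolding X1_def PA_def prod_dividef[symmetric]
    by (intro prod.cong refl) (use A in \<open>simp add: field_simps\<close>)
  have eB1: "(\<Prod>j=1..m. 1 - inverse (B j)) = (1 - inverse (B k)) * (Q1 / PB)"
  proof -
    have "(\<Prod>j=1..m. 1 - inverse (B j)) = (1 - inverse (B k)) * (\<Prod>j\<in>J. 1 - inverse (B j))"
      unfolding J_def using k by (intro prod.remove) auto
    also have "(\<Prod>j\<in>J. 1 - inverse (B j)) = Q1 / PB"
      unfolding Q1_def PB_def prod_dividef[symmetric]
      by (intro prod.cong refl) (use B in \<open>simp add: J_def field_simps\<close>)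
    finally show ?thesis .
  qed
  have eAk: "(\<Prod>i=1..Suc m. inverse (B k) - inverse (A i)) = X / (B k ^ Suc m * PA)"
  proof -
    have "(\<Prod>i=1..Suc m. inverse (B k) - inverse (A i)) = (\<Prod>i=1..Suc m. (A i - B k) / (B k * A i))"
      by (intro prod.cong refl) (use A Bk in \<open>simp add: field_simps\<close>)
    then show ?thesis by (simp only: prod_dividef prod.distrib X_def PA_def prod_constant) simp
  qed
  have eBk: "(\<Prod>j\<in>J. inverse (B k) - inverse (B j)) = Qk / (B k ^ n * PB)"
  proof -
    have "(\<Prod>j\<in>J. inverse (B k) - inverse (B j)) = (\<Prod>j\<in>J. (B j - B k) / (B k * B j))"
      by (intro prod.cong refl) (use B Bk in \<open>simp add: J_def field_simps\<close>)
    then show ?thesis by (simp only: prod_dividef prod.distrib Qk_def PB_def prod_constant cardJ)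
  qed
  have "c 0 * ((1 - inverse (B k)) * (Q1 / PB)) = X1 / PA"
    using c0 unfolding eA1 eB1 .
  then have 0: "c 0 * (B k - 1) * Q1 * PA = X1 * PB * B k"
    using nz Bk by (simp add: field_simps)
  \<comment> \<open>Of the powers of \<open>B k\<close>, n + 2 from the A and n from the B, only the
    square is kept explicit; the common power is abstracted so that it cancels.\<close>
  define y where "y = B k ^ n"
  have y: "y \<noteq> 0" "B k ^ Suc m = B k * B k * y" using Bk by (simp_all add: y_def n)
  have "c k * (1 - B k) * Qk * PA =
      inverse (B k) * c k * ((inverse (B k) - 1) * (Qk / (y * PB))) * (B k * B k * y * PA * PB)"
    using nz Bk y(1) by (simp add: field_simps)
  also have "inverse (B k) * c k * ((inverse (B k) - 1) * (Qk / (y * PB))) = X / (B k * B k * y * PA)"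
    using ck unfolding J_def[symmetric] eAk eBk y(2) y_def[symmetric] .
  also have "X / (B k * B k * y * PA) * (B k * B k * y * PA * PB) = X * PB"
    using nz Bk y(1) by simp
  finally have 1: "c k * (1 - B k) * Qk * PA = X * PB" .
  \<comment> \<open>Fact \<open>1\<close> times \<open>B k * X1\<close> and fact \<open>0\<close>
    times \<open>X\<close> have equal right-hand sides; the common factor
    \<open>(1 - B k) * PA\<close> is nonzero and cancels.\<close>
  have "(c k * (B k * Qk * X1) + c 0 * (Q1 * X)) * ((1 - B k) * PA) =
        (c k * (1 - B k) * Qk * PA) * (B k * X1) - (c 0 * (B k - 1) * Q1 * PA) * X"
    by (simp add: algebra_simps)
  also have "\<dots> = 0" unfolding 0 1 by (simp add: algebra_simps)
  finally have "c k * (B k * Qk * X1) + c 0 * (Q1 * X) = 0" using nz Bk by simp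
  then have eq: "c k * (B k * Qk * X1) = c 0 * (- (Q1 * X))" by (simp add: add_eq_0_iff)
  have "B k * Qk * X1 \<noteq> 0" using nz Bk by simp
  from nonzero_eq_divide_eq[OF this] eq have "c k = c 0 * (- (Q1 * X)) / (B k * Qk * X1)" by blast
  then show ?thesis
    unfolding J_def[symmetric] Q1_def[symmetric] Qk_def[symmetric] X1_def[symmetric] X_def[symmetric] by simp
qed

lemma exp_2pi_eq_1_imp_Ints:
  assumes "exp (2 * of_real pi * \<i> * z) = 1"
  shows "z \<in> \<int>"
proof -
  obtain n :: int where "Im z = 0" "2 * pi * Re z = of_int (2 * n) * pi"
    using assms by (auto simp: exp_eq_1)
  then have "z = of_int n" by (simp add: complex_eq_iff)
  then show ?thesis by simp
qed

lemma exp_2pi_eq_imp_Ints: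
  assumes "exp (2 * of_real pi * \<i> * z) = exp (2 * of_real pi * \<i> * w)"
  shows "z - w \<in> \<int>"
proof (rule exp_2pi_eq_1_imp_Ints)
  show "exp (2 * of_real pi * \<i> * (z - w)) = 1"
    using assms by (simp add: right_diff_distrib exp_diff)
qed

theorem theorem3p1:
  fixes p :: nat and a b A B h :: "nat \<Rightarrow> complex" and lam :: complex
    and v H :: "complex mat"
  assumes p: "p \<ge> 2"
    and a: "\<forall>i\<in>{1..p}. a i \<notin> \<int>"
    and b: "\<forall>j\<in>{1..p-1}. b j \<notin> \<int>"
    and ab: "\<forall>i\<in>{1..p}. \<forall>j\<in>{1..p-1}. a i - b j \<notin> \<int>"
    and bb: "\<forall>j\<in>{1..p-1}. \<forall>j'\<in>{1..p-1}. j \<noteq> j' \<longrightarrow> b j - b j' \<notin> \<int>"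
    and sum_ab: "(\<Sum>i=1..p. a i) - (\<Sum>j=1..p-1. b j) \<notin> \<int>"
    and A: "\<forall>i\<in>{1..p}. A i = exp (2 * of_real pi * \<i> * a i)"
    and B: "\<forall>j\<in>{1..p-1}. B j = exp (2 * of_real pi * \<i> * b j)"
    and lam: "lam = (\<Prod>j=1..p-1. B j) / (\<Prod>i=1..p. A i)"
    and v: "v = Matrix.mat 1 p (\<lambda>_. 1)"
    and h: "\<forall>k\<in>{1..p-1}. h k =
        - ((\<Prod>j\<in>{1..p-1} - {k}. (B j - 1)) * (\<Prod>i=1..p. (A i - B k))) /
        (B k * (\<Prod>j\<in>{1..p-1} - {k}. (B j - B k)) * (\<Prod>i=1..p. (A i - 1)))"
    and H: "H = mat_diag p (\<lambda>k. if k = 0 then 1 else h k)"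
  shows "\<forall>\<^sub>F \<epsilon> in at_right (0::real). \<exists>F :: complex \<Rightarrow> complex vec.
      fundamental_system p a b (of_real \<epsilon>) F \<and>
      circuit_matrix p F (\<rho>\<^sub>0 \<epsilon>) (mat_diag p (\<lambda>k. if k = 0 then 1 else inverse (B k))) \<and>
      circuit_matrix p F (\<rho>\<^sub>1 \<epsilon>)
        (1\<^sub>m p - ((1 - lam) / ((v * H * transpose_mat v) $$ (0, 0))) \<cdot>\<^sub>m (H * transpose_mat v * v))"
proof -
  obtain m where m: "p = Suc m" using p by (cases p) auto
  have p0: "p > 0" "p \<ge> 1" using p by auto
  have m1: "p - 1 = m" by (simp add: m)
  have A0: "A i \<noteq> 0 \<and> A i \<noteq> 1" if "i \<in> {1..Suc m}" for i
    using A a that exp_2pi_eq_1_imp_Ints[of "a i"] by (auto simp: m)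
  have B0: "B j \<noteq> 0" "B j \<noteq> 1" if "j \<in> {1..m}" for j
    using B b that exp_2pi_eq_1_imp_Ints[of "b j"] by (auto simp: m)
  have BB: "B j \<noteq> B k" if "j \<in> {1..m}" "k \<in> {1..m}" "j \<noteq> k" for j k
    using B bb that exp_2pi_eq_imp_Ints[of "b j" "b k"] by (auto simp: m)
  have AB: "A i \<noteq> B k" if "i \<in> {1..Suc m}" "k \<in> {1..m}" for i k
    using A B ab that exp_2pi_eq_imp_Ints[of "a i" "b k"] by (auto simp: m)

  \<comment> \<open>Indices are moved to start at 0. The entry \<open>\<beta> 0 = 0\<close> belongs
    to the outer derivative, and the shifts by 1 disappear under the exponential.\<close>
  define \<alpha> where "\<alpha> = (\<lambda>i. a (Suc i))"
  define \<beta> where "\<beta> = (\<lambda>i. if i = 0 then 0 else b i - 1)"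
  define d where "d = (\<lambda>i. exp (- (2 * of_real pi * \<i> * \<beta> i)))"
  have d0: "d 0 = 1" by (simp add: d_def \<beta>_def)
  have dk: "d k = inverse (B k)" if "k \<in> {1..m}" for k
  proof -
    have "d k = exp (- (2 * of_real pi * \<i> * b k) + 2 * of_real pi * \<i>)"
      using that by (simp add: d_def \<beta>_def algebra_simps)
    also have "\<dots> = exp (- (2 * of_real pi * \<i> * b k)) * exp (2 * of_real pi * \<i>)" by (rule exp_add)
    also have "\<dots> = inverse (B k)" using B that by (simp add: m exp_minus exp_two_pi_i')
    finally show ?thesis .
  qed
  have e: "exp (- (2 * of_real pi * \<i> * \<alpha> i)) = inverse (A (Suc i))" if "i < p" for i
    using A that by (simp add: \<alpha>_def exp_minus)
  have idx: "i = 0 \<or> i \<in> {1..m}" if "i < p" for i using that by (auto simp: m)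
  have d_nz: "d i \<noteq> 0" for i by (simp add: d_def)
  have inj: "inj_on d {..<p}"
  proof (rule inj_onI)
    fix i j assume ij: "i \<in> {..<p}" "j \<in> {..<p}" "d i = d j"
    show "i = j"
    proof (rule ccontr)
      assume "i \<noteq> j"
      then show False
        using ij idx[of i] idx[of j] dk[of i] dk[of j] d0 B0[of i] B0[of j] BB[of i j] by auto
    qed
  qed

  obtain q where q: "newton_basis \<beta> p = newton_basis \<alpha> p + (\<Sum>k<p. Polynomial.smult (q k) (newton_basis \<alpha> k))"
    "q (p - 1) = (\<Sum>i<p. \<beta> i) - (\<Sum>i<p. \<alpha> i)"
    using newton_basis_change[OF p0(1)] by blast
  interpret hg_system p \<alpha> \<beta> q by (rule hg_system.intro[OF p0(1) q(1)])
  have "(\<Sum>i<p. \<alpha> i) = (\<Sum>i=1..p. a i)"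
    unfolding \<alpha>_def by (simp add: sum.atLeast1_atMost_eq)
  moreover have "(\<Sum>i<p. \<beta> i) = (\<Sum>j=1..p-1. b j) - of_nat m"
    unfolding m1 unfolding m sum.lessThan_Suc_shift
    by (simp add: \<beta>_def sum_subtractf sum.atLeast1_atMost_eq)
  \<comment> \<open>The shifts in \<open>\<beta>\<close> contribute only the integer
    \<open>m\<close>, so the hypothesis on the sums says exactly that the exponent
    \<open>q (p - 1)\<close> is not an integer.\<close>
  ultimately have "(\<Sum>i=1..p. a i) - (\<Sum>j=1..p-1. b j) = - q (p - 1) - of_nat m"
    using q(2) by simp
  then have q_notin: "q (p - 1) \<notin> \<int>"
    using sum_ab by (metis Ints_diff Ints_minus Ints_of_nat)

  obtain fm fp w u where
    fm: "\<And>i. i < p \<Longrightarrow> sol (window (- 2 * pi)) (fm i)" and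
    fp: "\<And>i. i < p \<Longrightarrow> sol (window 0) (fp i)" and
    left: "\<And>i t. i < p \<Longrightarrow> Re t < 0 \<Longrightarrow> fm i t = fp i t" and
    shift: "\<And>i t. i < p \<Longrightarrow> Re t < 0 \<Longrightarrow> fp i (t + 2 * of_real pi * \<i>) = d i * fp i t" and
    right: "\<And>i t. i < p \<Longrightarrow> Re t > 0 \<Longrightarrow> fm i t = fp i t - w i * (\<Sum>j<p. u j * fp j t)" and
    ind: "\<And>c. \<forall>t. Re t < 0 \<longrightarrow> (\<Sum>i<p. c i * fp i t) = 0 \<Longrightarrow> \<forall>i<p. c i = 0" and
    det: "\<And>\<mu>. sq_det p (\<lambda>i j. (if i = j then \<mu> else 0) - d i * ((if i = j then 1 else 0) - w i * u j)) =
         (\<Prod>k<p. \<mu> - exp (- (2 * of_real pi * \<i> * \<alpha> k)))"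
    by (rule circuit_matrices[OF q_notin d_def inj]) (rule that)

  define c where "c = (\<lambda>i. w i * u i)"
  have char: "(\<Prod>i<p. \<mu> - d i) + (\<Sum>i<p. d i * c i * (\<Prod>j\<in>{..<p} - {i}. \<mu> - d j)) =
      (\<Prod>i=1..Suc m. \<mu> - inverse (A i))" for \<mu>
  proof -
    have "(\<Prod>i=1..Suc m. \<mu> - inverse (A i)) = (\<Prod>k<p. \<mu> - inverse (A (Suc k)))"
      unfolding m by (simp only: One_nat_def prod.atLeast1_atMost_eq)
    also have "\<dots> = (\<Prod>k<p. \<mu> - exp (- (2 * of_real pi * \<i> * \<alpha> k)))"
      by (intro prod.cong refl) (simp add: e)
    also have "\<dots> = sq_det p (\<lambda>i j. (if i = j then \<mu> - d i else 0) + (d i * w i) * u j)"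
      unfolding det[symmetric]
      by (intro arg_cong[where f = Determinant.det] sq_mat_cong) (simp add: algebra_simps)
    finally show ?thesis unfolding det_diag_plus_rank_one by (simp add: c_def mult.assoc)
  qed
  \<comment> \<open>At \<open>\<mu> = d k\<close> every product containing the factor
    \<open>\<mu> - d k\<close> vanishes, which leaves the single term with
    \<open>c k\<close>.\<close>
  have residue: "d k * c k * (\<Prod>j\<in>{..<p} - {k}. d k - d j) = (\<Prod>i=1..Suc m. d k - inverse (A i))"
    if k: "k < p" for k
  proof -
    have z: "(\<Prod>i<p. d k - d i) = 0" using k by (intro prod_zero) auto
    have "(\<Sum>i<p. d i * c i * (\<Prod>j\<in>{..<p} - {i}. d k - d j)) =
        (\<Sum>i\<in>{k}. d i * c i * (\<Prod>j\<in>{..<p} - {i}. d k - d j))"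
    proof (rule sum.mono_neutral_right)
      show "\<forall>i\<in>{..<p} - {k}. d i * c i * (\<Prod>j\<in>{..<p} - {i}. d k - d j) = 0"
      proof
        fix i assume "i \<in> {..<p} - {k}"
        then have "(\<Prod>j\<in>{..<p} - {i}. d k - d j) = 0" using k by (intro prod_zero) auto
        then show "d i * c i * (\<Prod>j\<in>{..<p} - {i}. d k - d j) = 0" by simp
      qed
    qed (use k in auto)
    also have "\<dots> = d k * c k * (\<Prod>j\<in>{..<p} - {k}. d k - d j)" by simp
    finally show ?thesis using char[of "d k"] unfolding z by (simp only: add_0)
  qed
  have set0: "{..<p} - {0} = {1..m}" by (auto simp: m)
  have c0: "c 0 * (\<Prod>j=1..m. 1 - inverse (B j)) = (\<Prod>i=1..Suc m. 1 - inverse (A i))"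
    using residue[OF p0(1)] dk unfolding set0 d0 by simp
  define Hk where "Hk = (\<lambda>k. if k = 0 then 1 else h k)"
  have ck: "c k = c 0 * Hk k" if "k < p" for k
  proof (cases "k = 0")
    case False
    then have k: "k \<in> {1..m}" using idx[OF that] by blast
    have "{..<p} - {k} = insert 0 ({1..m} - {k})" using k by (auto simp: m)
    then have "(\<Prod>j\<in>{..<p} - {k}. d k - d j) =
        (inverse (B k) - 1) * (\<Prod>j\<in>{1..m} - {k}. inverse (B k) - inverse (B j))"
      using dk k d0 by simp
    then have "inverse (B k) * c k * ((inverse (B k) - 1) * (\<Prod>j\<in>{1..m} - {k}. inverse (B k) - inverse (B j))) =
       (\<Prod>i=1..Suc m. inverse (B k) - inverse (A i))"
      using residue[OF that] dk[OF k] by simp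
    then have "c k = c 0 * (- ((\<Prod>j\<in>{1..m} - {k}. (B j - 1)) * (\<Prod>i=1..Suc m. (A i - B k))) /
        (B k * (\<Prod>j\<in>{1..m} - {k}. (B j - B k)) * (\<Prod>i=1..Suc m. (A i - 1))))"
      by (intro residue_ratio k A0 c0) (use B0 BB k in auto)
    then show ?thesis using h k False unfolding m1 unfolding m by (simp add: Hk_def)
  qed (simp add: Hk_def)
  \<comment> \<open>The right-hand side of \<open>residue\<close> is nonzero:
    \<open>A i \<noteq> 1\<close> is used for \<open>k = 0\<close> and
    \<open>A i \<noteq> B k\<close> otherwise.\<close>
  have c_nz: "c k \<noteq> 0" if "k < p" for k
  proof -
    have "(\<Prod>i=1..Suc m. d k - inverse (A i)) \<noteq> 0"
      using idx[OF that] dk[of k] d0 A0 AB B0 by (auto simp: inverse_eq_iff_eq)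
    then show ?thesis using residue[OF that] by auto
  qed
  then have u_nz: "u k \<noteq> 0" if "k < p" for k using that by (auto simp: c_def)

  \<comment> \<open>The characteristic polynomial at \<open>\<mu> = 0\<close> compares determinants;
    the sign (-1)^p occurs on both sides.\<close>
  have sum_c: "1 - (\<Sum>i<p. c i) = lam"
  proof -
    have neg: "(\<Prod>i<n. - x i) = (- 1) ^ n * (\<Prod>i<n. x i)" for n and x :: "nat \<Rightarrow> complex"
      by (induction n) auto
    have "d i * c i * (\<Prod>j\<in>{..<p} - {i}. - d j) = - ((\<Prod>j<p. - d j) * c i)" if "i < p" for i
      using that by (subst prod.remove[of "{..<p}" i]) auto
    then have "(\<Sum>i<p. d i * c i * (\<Prod>j\<in>{..<p} - {i}. - d j)) = - ((\<Prod>j<p. - d j) * (\<Sum>i<p. c i))"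
      by (simp add: sum_distrib_left sum_negf)
    then have "(\<Prod>j<p. - d j) * (1 - (\<Sum>i<p. c i)) = (\<Prod>i=1..Suc m. - inverse (A i))"
      using char[of 0] by (simp add: algebra_simps)
    also have "\<dots> = (- 1) ^ p * (\<Prod>i=1..p. inverse (A i))"
      unfolding One_nat_def prod.atLeast1_atMost_eq m by (rule neg)
    finally have "(\<Prod>j<p. d j) * (1 - (\<Sum>i<p. c i)) = (\<Prod>i=1..p. inverse (A i))"
      by (simp add: neg)
    moreover have "(\<Prod>j<p. d j) = (\<Prod>j=1..m. inverse (B j))"
      unfolding m prod.lessThan_Suc_shift d0 by (simp add: prod.atLeast1_atMost_eq dk)
    ultimately have 1: "(\<Prod>j=1..m. inverse (B j)) * (1 - (\<Sum>i<p. c i)) = (\<Prod>i=1..p. inverse (A i))"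
      by (simp only:)
    have "(\<Prod>j=1..m. B j) * (\<Prod>j=1..m. inverse (B j)) = 1"
      unfolding prod.distrib[symmetric] using B0 by (intro prod.neutral) auto
    then have "1 - (\<Sum>i<p. c i) = (\<Prod>j=1..m. B j) * ((\<Prod>j=1..m. inverse (B j)) * (1 - (\<Sum>i<p. c i)))"
      unfolding mult.assoc[symmetric] by (simp only: mult_1)
    also have "(\<Prod>i=1..p. inverse (A i)) = inverse (\<Prod>i=1..p. A i)"
      using prod_inversef[of A "{1..p}"] by (simp only: o_def)
    with 1 have "(\<Prod>j=1..m. B j) * ((\<Prod>j=1..m. inverse (B j)) * (1 - (\<Sum>i<p. c i))) = lam"
      unfolding lam m1 divide_inverse by (simp only:)
    finally show ?thesis .
  qed
  have lam_eq: "lam = exp (2 * of_real pi * \<i> * ((\<Sum>j=1..m. b j) - (\<Sum>i=1..p. a i)))"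
  proof -
    have "(\<Prod>j=1..m. B j) = exp (2 * of_real pi * \<i> * (\<Sum>j=1..m. b j))"
      unfolding sum_distrib_left exp_sum[OF finite_atLeastAtMost] using B by (intro prod.cong) (auto simp: m)
    moreover have "(\<Prod>i=1..p. A i) = exp (2 * of_real pi * \<i> * (\<Sum>i=1..p. a i))"
      unfolding sum_distrib_left exp_sum[OF finite_atLeastAtMost] using A by (intro prod.cong) auto
    ultimately show ?thesis unfolding lam m1 by (simp add: right_diff_distrib exp_diff)
  qed
  have lam_nz: "lam \<noteq> 0" by (simp add: lam_eq)
  have lam_1: "lam \<noteq> 1"
  proof
    assume "lam = 1"
    then have "(\<Sum>j=1..m. b j) - (\<Sum>i=1..p. a i) \<in> \<int>"
      unfolding lam_eq by (rule exp_2pi_eq_1_imp_Ints)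
    then have "- ((\<Sum>j=1..m. b j) - (\<Sum>i=1..p. a i)) \<in> \<int>" by (rule Ints_minus)
    then show False using sum_ab unfolding m1 by simp
  qed
  have sum_H: "1 - lam = c 0 * (\<Sum>k<p. Hk k)"
  proof -
    have "(\<Sum>k<p. c k) = (\<Sum>k<p. c 0 * Hk k)"
      by (intro sum.cong refl ck) simp
    then show ?thesis unfolding sum_c[symmetric] sum_distrib_left by simp
  qed
  \<comment> \<open>\<open>lam \<noteq> 1\<close> forces the sum of the \<open>Hk\<close> to be
    nonzero, so the division in the claimed matrix is genuine.\<close>
  then have scalar: "(1 - lam) / (\<Sum>k<p. Hk k) = c 0"
    using lam_1 by auto

  define M1 where "M1 = sq_mat p (\<lambda>i j. (if i = j then 1 else 0) - c i)"
  have M1: "1\<^sub>m p - ((1 - lam) / ((v * H * transpose_mat v) $$ (0, 0))) \<cdot>\<^sub>m (H * transpose_mat v * v) = M1"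
  proof -
    have vc: "v \<in> carrier_mat 1 p" "transpose_mat v \<in> carrier_mat p 1" by (simp_all add: v)
    have "v * H = Matrix.mat 1 p (\<lambda>(i, j). Hk j)"
      unfolding H using mat_diag_mult_right[OF vc(1)] by (auto simp: v Hk_def)
    then have "(v * H * transpose_mat v) $$ (0, 0) = (\<Sum>k<p. Hk k)"
      by (simp add: v scalar_prod_def atLeast0LessThan)
    moreover have "H * transpose_mat v = Matrix.mat p 1 (\<lambda>(i, j). Hk i)"
      unfolding H using mat_diag_mult_left[OF vc(2)] by (auto simp: v Hk_def)
    then have "H * transpose_mat v * v = sq_mat p (\<lambda>i j. Hk i)"
      by (intro eq_matI) (auto simp: v sq_mat_def scalar_prod_def)
    ultimately show ?thesis
      by (intro eq_matI) (auto simp: scalar M1_def sq_mat_def ck[symmetric])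
  qed
  define M0 where "M0 = sq_mat p (\<lambda>i j. if i = j then d i else 0)"
  have M0: "mat_diag p (\<lambda>k. if k = 0 then 1 else inverse (B k)) = M0"
  proof -
    have "(if k = 0 then 1 else inverse (B k)) = d k" if "k < p" for k
      using idx[OF that] d0 dk[of k] by auto
    then show ?thesis unfolding M0_def mat_diag_def sq_mat_def by (intro eq_matI) auto
  qed
  have inv0: "invertible_mat M0"
    unfolding M0_def by (rule invertible_sq_mat) (simp add: det_sq_mat_diag d_nz)
  \<comment> \<open>By the matrix determinant lemma the determinant is
    \<open>1 - (\<Sum>i<p. c i) = lam\<close>.\<close>
  have inv1: "invertible_mat M1"
  proof -
    have "M1 = sq_mat p (\<lambda>i j. (if i = j then 1 else 0) + (- c i) * 1)" by (simp add: M1_def)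
    then have "Determinant.det M1 = lam"
      using sum_c det_one_plus_rank_one[of p "\<lambda>i. - c i" "\<lambda>_. 1"] by (simp add: sum_negf)
    then show ?thesis unfolding M1_def using lam_nz by (intro invertible_sq_mat) simp
  qed

  define L where "L = {t :: complex. Re t < 0}"
  have L: "open L" "connected L" "L \<noteq> {}"
    unfolding L_def by (auto simp: open_halfspace_Re_lt convex_connected convex_halfspace_Re_lt intro: exI[of _ "- 1"])
  have fpL: "sol L (fp i)" if "i < p" for i
    by (rule hg_solution_subset[OF fp[OF that]]) (auto simp: L_def window_def)
  have expL: "exp t \<noteq> 1" if "t \<in> L" for t
  proof -
    have "Re t \<noteq> 0" using that by (simp add: L_def)
    then show ?thesis by (simp add: exp_eq_1)
  qed
  have indL: "\<forall>i<p. c i = 0" if "\<And>t. t \<in> L \<Longrightarrow> (\<Sum>i<p. c i * fp i t) = 0" for c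
    using that by (intro ind) (simp add: L_def)
  \<comment> \<open>Scaling by \<open>u i\<close> turns the row \<open>u\<close> into (1, ..., 1)
    and the column \<open>w\<close> into \<open>c\<close>, while the diagonal matrix
    \<open>M0\<close> is unaffected.\<close>
  define F where "F = (\<lambda>x. vec p (\<lambda>i. u i * fp i (Ln x)))"

  have "\<exists>F. fundamental_system p a b (of_real \<epsilon>) F \<and> circuit_matrix p F (\<rho>\<^sub>0 \<epsilon>) M0 \<and> circuit_matrix p F (\<rho>\<^sub>1 \<epsilon>) M1"
    if \<epsilon>: "0 < \<epsilon>" "\<epsilon> < 1" for \<epsilon> :: real
  proof (intro exI[of _ F] conjI)
    have lnL: "of_real (ln \<epsilon>) \<in> L" using \<epsilon> by (simp add: L_def)
    have exp_ln: "exp (of_real (ln \<epsilon>)) = (of_real \<epsilon> :: complex)"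
      using \<epsilon> by (simp add: exp_of_real)
    have Ln_\<epsilon>: "Ln (of_real \<epsilon>) = of_real (ln \<epsilon>)" using \<epsilon> by (intro Ln_of_real)
    have \<epsilon>_nonpos: "of_real \<epsilon> \<notin> (\<real>\<^sub>\<le>\<^sub>0 :: complex set)" using \<epsilon> by simp
    show "fundamental_system p a b (of_real \<epsilon>) F"
      unfolding fundamental_system_def
    proof (intro conjI allI impI)
      show "F x \<in> carrier_vec p" for x by (simp add: F_def)
    next
      fix i assume i: "i < p"
      have "sol L (\<lambda>t. \<Sum>j\<in>{i}. u j * fp j t)"
        by (rule hg_solution_lincomb[OF L(1)]) (use fpL i in auto)
      then have "sol L (\<lambda>t. u i * fp i t)" by simp
      then have "hypergeometric_solution p a b (of_real \<epsilon>) (\<lambda>x. u i * fp i (Ln x))"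
        using hypergeometric_solution_of_log[OF p0(2) \<epsilon>, of a b "\<lambda>t. u i * fp i t"]
        by (simp add: L_def \<alpha>_def \<beta>_def)
      then show "hypergeometric_solution p a b (of_real \<epsilon>) (\<lambda>x. F x $ i)"
        using i by (simp add: F_def)
    next
      fix c i assume c: "\<forall>\<^sub>F x in nhds (of_real \<epsilon>). (\<Sum>i<p. c i * F x $ i) = 0" and i: "i < p"
      have "\<forall>\<^sub>F t in nhds (of_real (ln \<epsilon>)). (\<Sum>i<p. c i * F (exp t) $ i) = 0"
        by (rule eventually_nhds_exp) (simp only: exp_ln c)
      then obtain U where U: "open U" "of_real (ln \<epsilon>) \<in> U" "\<And>t. t \<in> U \<Longrightarrow> (\<Sum>i<p. c i * F (exp t) $ i) = 0"
        unfolding eventually_nhds by blast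
      \<comment> \<open>Restriction to the strip on which \<open>Ln (exp t) = t\<close>.\<close>
      define U' where "U' = U \<inter> L \<inter> {t. - pi < Im t} \<inter> {t. Im t < pi}"
      have U': "open U'" "U' \<subseteq> L" "U' \<noteq> {}"
      proof -
        show "open U'" unfolding U'_def
          using U(1) L(1) by (intro open_Int open_halfspace_Im_lt open_halfspace_Im_gt)
        have "of_real (ln \<epsilon>) \<in> U'" using U(2) lnL by (simp add: U'_def)
        then show "U' \<noteq> {}" by blast
      qed (auto simp: U'_def)
      have zero: "(\<Sum>i<p. (c i * u i) * fp i t) = 0" if "t \<in> U'" for t
      proof -
        have "Ln (exp t) = t" using that by (intro Ln_exp) (auto simp: U'_def)
        then show ?thesis using U(3)[of t] that by (simp add: U'_def F_def mult.assoc)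
      qed
      have "(\<Sum>i<p. (c i * u i) * fp i t) = (\<Sum>i<p. 0 * fp i t)" if t: "t \<in> L" for t
      proof (rule sol_eq_extend[OF L(1,2) expL _ _ U' _ t])
        show "sol L (\<lambda>t. \<Sum>i<p. (c i * u i) * fp i t)" "sol L (\<lambda>t. \<Sum>i<p. 0 * fp i t)"
          by (rule hg_solution_lincomb[OF L(1)]; use fpL in auto)+
      qed (use zero in auto)
      then have "\<forall>i<p. c i * u i = 0" by (intro indL) simp
      then show "c i = 0" using i u_nz by auto
    next
      fix f assume "hypergeometric_solution p a b (of_real \<epsilon>) f"
      then obtain r where r: "r > 0" "ball (of_real (ln \<epsilon>)) r \<subseteq> L"
        "sol (ball (of_real (ln \<epsilon>)) r) (\<lambda>t. f (exp t))"
        using log_solution_of_hypergeometric[OF p0(2) \<epsilon>, of a b f] by (auto simp: L_def \<alpha>_def \<beta>_def)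
      obtain c where c: "\<And>t. t \<in> ball (of_real (ln \<epsilon>)) r \<Longrightarrow> f (exp t) = (\<Sum>i<p. c i * fp i t)"
      proof -
        have "\<exists>c. \<forall>t\<in>ball (of_real (ln \<epsilon>)) r. f (exp t) = (\<Sum>i<p. c i * fp i t)"
        proof (rule sol_in_span[of L fp "ball (of_real (ln \<epsilon>)) r" "\<lambda>t. f (exp t)"])
          show "\<forall>i<p. c i = 0" if "\<And>t. t \<in> L \<Longrightarrow> (\<Sum>i<p. c i * fp i t) = 0" for c
            using that by (rule indL)
        qed (use L expL fpL r in auto)
        then show ?thesis using that by blast
      qed
      have "\<forall>\<^sub>F x in nhds (of_real \<epsilon>). Ln x \<in> ball (of_real (ln \<epsilon>)) r"
      proof (rule eventually_nhds_Ln[OF _ \<epsilon>_nonpos])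
        show "\<forall>\<^sub>F t in nhds (Ln (of_real \<epsilon>)). t \<in> ball (of_real (ln \<epsilon>)) r"
          unfolding Ln_\<epsilon> using r(1) by (intro eventually_nhds_in_open) auto
      qed
      moreover have "\<forall>\<^sub>F x in nhds (of_real \<epsilon>). x \<noteq> (0 :: complex)"
        using \<epsilon> by (intro t1_space_nhds) simp
      ultimately have "\<forall>\<^sub>F x in nhds (of_real \<epsilon>). f x = (\<Sum>i<p. (c i / u i) * F x $ i)"
      proof eventually_elim
        case (elim x)
        then have "f x = (\<Sum>i<p. c i * fp i (Ln x))" using c[of "Ln x"] by simp
        also have "\<dots> = (\<Sum>i<p. (c i / u i) * F x $ i)"
          by (intro sum.cong refl) (use u_nz in \<open>simp add: F_def\<close>)
        finally show ?case .
      qed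
      then show "\<exists>c. \<forall>\<^sub>F x in nhds (of_real \<epsilon>). f x = (\<Sum>i<p. c i * F x $ i)"
        by (intro exI[of _ "\<lambda>i. c i / u i"])
    qed
    show "circuit_matrix p F (\<rho>\<^sub>0 \<epsilon>) M0"
      unfolding circuit_matrix_def
    proof (intro conjI allI impI)
      show "M0 \<in> carrier_mat p p" "invertible_mat M0" by (simp_all add: M0_def inv0[unfolded M0_def])
      fix i assume i: "i < p"
      have M0F: "(M0 *\<^sub>v F x) $ i = d i * (u i * fp i (Ln x))" for x
      proof -
        have "(M0 *\<^sub>v F x) $ i = (\<Sum>j<p. (if i = j then d i else 0) * (u j * fp j (Ln x)))"
          using i by (simp add: M0_def sq_mat_def F_def scalar_prod_def atLeast0LessThan)
        also have "\<dots> = (\<Sum>j<p. if j = i then d i * (u i * fp i (Ln x)) else 0)"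
          by (intro sum.cong refl) auto
        finally show ?thesis using i by simp
      qed
      show "continues_along (\<rho>\<^sub>0 \<epsilon>) (\<lambda>x. F x $ i) (\<lambda>x. (M0 *\<^sub>v F x) $ i)"
      proof (rule circuit_around_0[OF _ _ \<epsilon>, where F = "\<lambda>t. u i * fp i t" and \<mu> = "d i"])
        show "(\<lambda>t. u i * fp i t) holomorphic_on {t. Re t < 0}"
          using fpL[OF i] by (auto simp: hg_solution_def L_def intro!: holomorphic_intros)
      qed (use i shift M0F in \<open>simp_all add: F_def\<close>)
    qed
    show "circuit_matrix p F (\<rho>\<^sub>1 \<epsilon>) M1"
      unfolding circuit_matrix_def
    proof (intro conjI allI impI)
      show "M1 \<in> carrier_mat p p" "invertible_mat M1" by (simp_all add: M1_def inv1[unfolded M1_def])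
      fix i assume i: "i < p"
      have M1F: "(M1 *\<^sub>v F x) $ i = u i * (fp i (Ln x) - w i * (\<Sum>j<p. u j * fp j (Ln x)))" for x
      proof -
        have "(M1 *\<^sub>v F x) $ i = (\<Sum>j<p. ((if i = j then 1 else 0) - c i) * (u j * fp j (Ln x)))"
          using i by (simp add: M1_def sq_mat_def F_def scalar_prod_def atLeast0LessThan)
        also have "\<dots> = (\<Sum>j<p. (if j = i then u i * fp i (Ln x) else 0) - c i * (u j * fp j (Ln x)))"
          by (intro sum.cong refl) (auto simp: algebra_simps)
        also have "\<dots> = u i * fp i (Ln x) - c i * (\<Sum>j<p. u j * fp j (Ln x))"
          using i by (simp add: sum_subtractf sum_distrib_left)
        finally show ?thesis by (simp add: c_def algebra_simps)
      qed
      show "continues_along (\<rho>\<^sub>1 \<epsilon>) (\<lambda>x. F x $ i) (\<lambda>x. (M1 *\<^sub>v F x) $ i)"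
      proof (rule circuit_around_1[OF _ _ _ \<epsilon>, where Fm = "\<lambda>t. u i * fm i t" and
            Fp = "\<lambda>t. u i * (fp i t - w i * (\<Sum>j<p. u j * fp j t))"])
        show "(\<lambda>t. u i * fm i t) holomorphic_on window (- 2 * pi)"
          using fm[OF i] by (auto simp: hg_solution_def intro!: holomorphic_intros)
        show "(\<lambda>t. u i * (fp i t - w i * (\<Sum>j<p. u j * fp j t))) holomorphic_on window 0"
          using fp i by (auto simp: hg_solution_def intro!: holomorphic_intros)
        show "u i * fm i t = u i * (fp i t - w i * (\<Sum>j<p. u j * fp j t))" if "Re t > 0" for t
          using right[OF i that] by simp
        show "F x $ i = u i * fm i (Ln x)" if "x \<noteq> 0" "norm x < 1" for x
          using i left[OF i, of "Ln x"] that by (simp add: F_def)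
      qed (rule M1F)
    qed
  qed
  \<comment> \<open>Every \<open>\<epsilon>\<close> between 0 and 1 is small enough.\<close>
  then show ?thesis
    unfolding M0 M1 eventually_at_right_field by (intro exI[of _ 1]) auto
qed

end
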